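(* Let $M,N\ge 1$ be integers with $M$ even. Let $m=\lfloor \frac{M+1}{3}\rfloor$ and $n=\lceil N/3\rceil$, and let $G=\mathcal R^c(M,N)$. Then: \begin{itemize} \item If $N\equiv 1\pmod 3$, then $\Sigma(G)$ is contractible and $Z_G(-1)=0$. \item Otherwise: \begin{itemize} \item if $M\equiv 0\pmod 3$, then $\Sigma(G)$ is homotopy equivalent to a wedge of $2^n$ spheres of dimension $mn-1$, and $Z_G(-1)=2^n$; \item if $M\equiv 1$ or $2\pmod 3$, then $\Sigma(G)$ is homotopy equivalent to a single sphere of dimension $mn-1$, and $Z_G(-1)=(-1)^n$. \end{itemize} \end{itemize}
   Context: The square grid $\mathbb Z^2$ is regarded as an infinite graph, with edges joining vertices at distance $1$ from each other. For $M,N\ge 1$, $\mathcal R(M,N)$ is the subgraph of $\mathbb Z^2$ induced by the points $(x,y)\in\mathbb Z^2$ satisfying $y\le x\le y+M-1$ and $-y\le x\le -y+N-1$. For $M$ even, the cylindric graph $\mathcal R^c(M,N)$ is obtained from $\mathcal R(M+1,N)$ by identifying the vertices $(i,i)$ and $(M/2+i,\,-M/2+i)$ for $0\le i\le \lfloor\frac{N-1}{2}\rfloor$ (two vertices of the quotient are adjacent if and only if they have adjacent representatives; multiple edges are irrelevant). For a finite graph $G$, an independent set is a set of pairwise non-adjacent vertices (the empty set is included). The independence complex $\Sigma(G)$ is the simplicial complex formed by all independent sets of $G$, ordered by inclusion; an independent set $I$ is a cell of dimension $|I|-1$. Topological statements about $\Sigma(G)$ refer to its geometric realization. The alternating number of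 independent sets of $G$ is $Z_G(-1)=\sum_{I\in\Sigma(G)}(-1)^{|I|}$, where the sum includes $I=\emptyset$. The sphere of dimension $0$ consists of two points. *)

theory Defs
  imports "HOL-Analysis.Analysis"
begin

section \<open>Graphs\<close>

record 'a graph =
  vertices :: "'a set"
  edges :: "'a set set"

definition adjacent :: "'a graph \<Rightarrow> 'a \<Rightarrow> 'a \<Rightarrow> bool" where
  "adjacent G u v \<longleftrightarrow> {u, v} \<in> edges G"

definition induced_subgraph :: "'a graph \<Rightarrow> 'a set \<Rightarrow> 'a graph" where
  "induced_subgraph G W =
     \<lparr>vertices = vertices G \<inter> W, edges = {e \<in> edges G. e \<subseteq> W}\<rparr>"

text \<open>For \<open>S \<subseteq> V \<times> V\<close> this is the least equivalence relation on \<open>V\<close> containing \<open>S\<close>.\<close>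

definition generated_equiv :: "'a set \<Rightarrow> 'a rel \<Rightarrow> 'a rel" where
  "generated_equiv V S = Restr ((S \<union> S\<inverse>)\<^sup>*) V"

lemma equiv_generated_equiv: "equiv V (generated_equiv V S)"
proof (rule equivI)
  have "sym ((S \<union> S\<inverse>)\<^sup>*)"
    by (intro sym_rtrancl sym_Un_converse)
  then show "sym (generated_equiv V S)"
    by (auto simp: generated_equiv_def sym_def)
  show "trans (generated_equiv V S)"
    unfolding generated_equiv_def by (intro trans_Restr trans_rtrancl)
qed (auto simp: generated_equiv_def refl_on_def)

text \<open>Vertices are identified along the pairs in \<open>S\<close>; two classes are adjacent iff they have
  adjacent representatives.\<close>

definition identify_vertices :: "'a graph \<Rightarrow> 'a rel \<Rightarrow> 'a set graph" where
  "identify_vertices G S =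
     (let r = generated_equiv (vertices G) S in
      \<lparr>vertices = vertices G // r,
       edges = {{r `` {u}, r `` {v}} | u v. u \<in> vertices G \<and> v \<in> vertices G \<and> adjacent G u v}\<rparr>)"

definition square_grid :: "(int \<times> int) graph" where
  "square_grid =
     \<lparr>vertices = UNIV,
      edges = {{(x, y), (x', y')} | x y x' y'.
        dist (real_of_int x, real_of_int y) (real_of_int x', real_of_int y') = 1}\<rparr>"

definition grid_R :: "nat \<Rightarrow> nat \<Rightarrow> (int \<times> int) graph" where
  "grid_R M N = induced_subgraph square_grid
     {(x, y). y \<le> x \<and> x \<le> y + int M - 1 \<and> - y \<le> x \<and> x \<le> - y + int N - 1}"

text \<open>Only meaningful for even \<open>M\<close>.\<close>

definition cyl_R :: "nat \<Rightarrow> nat \<Rightarrow> (int \<times> int) set graph" where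
  "cyl_R M N = identify_vertices (grid_R (M + 1) N)
     {((i, i), (int M div 2 + i, - (int M div 2) + i)) | i. 0 \<le> i \<and> i \<le> \<lfloor>(real N - 1) / 2\<rfloor>}"

section \<open>Independence complexes\<close>

definition independence_complex :: "'a graph \<Rightarrow> 'a set set" where
  "independence_complex G =
     {I. I \<subseteq> vertices G \<and> pairwise (\<lambda>u v. \<not> adjacent G u v) I}"

text \<open>The value at \<open>-1\<close> of the independence polynomial of a finite graph.\<close>

definition alternating_number :: "'a graph \<Rightarrow> int" where
  "alternating_number G = (\<Sum>I\<in>independence_complex G. (-1) ^ card I)"

section \<open>Geometric realization, wedges of spheres\<close>

text \<open>Barycentric coordinates: the points are the convex combinations of vertices whose support
  is a simplex. The empty simplex contributes no point. For a finite complex the subspace topology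
  used here is the usual (weak) one.\<close>

definition geometric_realization :: "'a set set \<Rightarrow> ('a \<Rightarrow> real) topology" where
  "geometric_realization K = subtopology (powertop_real UNIV)
     {t. (\<forall>v. 0 \<le> t v) \<and> {v. t v \<noteq> 0} \<in> K \<and> sum t {v. t v \<noteq> 0} = 1}"

definition quotient_topology :: "'a topology \<Rightarrow> 'a rel \<Rightarrow> 'a set topology" where
  "quotient_topology X r = topology (\<lambda>U. U \<subseteq> topspace X // r \<and> openin X {x \<in> topspace X. r `` {x} \<in> U})"

lemma openin_quotient_topology:
  "openin (quotient_topology X r) U \<longleftrightarrow>
     U \<subseteq> topspace X // r \<and> openin X {x \<in> topspace X. r `` {x} \<in> U}"
proof -
  have "istopology (\<lambda>U. U \<subseteq> topspace X // r \<and> openin X {x \<in> topspace X. r `` {x} \<in> U})"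
    unfolding istopology_def
  proof (intro conjI allI impI)
    fix S T
    assume "S \<subseteq> topspace X // r \<and> openin X {x \<in> topspace X. r `` {x} \<in> S}"
      and "T \<subseteq> topspace X // r \<and> openin X {x \<in> topspace X. r `` {x} \<in> T}"
    then have "openin X ({x \<in> topspace X. r `` {x} \<in> S} \<inter> {x \<in> topspace X. r `` {x} \<in> T})"
      by blast
    moreover have "{x \<in> topspace X. r `` {x} \<in> S} \<inter> {x \<in> topspace X. r `` {x} \<in> T}
        = {x \<in> topspace X. r `` {x} \<in> S \<inter> T}" by blast
    ultimately show "openin X {x \<in> topspace X. r `` {x} \<in> S \<inter> T}" by simp
  next
    fix \<K> assume "\<forall>K\<in>\<K>. K \<subseteq> topspace X // r \<and> openin X {x \<in> topspace X. r `` {x} \<in> K}"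
    then have "openin X (\<Union>K\<in>\<K>. {x \<in> topspace X. r `` {x} \<in> K})" by blast
    moreover have "(\<Union>K\<in>\<K>. {x \<in> topspace X. r `` {x} \<in> K}) = {x \<in> topspace X. r `` {x} \<in> \<Union>\<K>}"
      by blast
    ultimately show "openin X {x \<in> topspace X. r `` {x} \<in> \<Union>\<K>}" by simp
  qed blast+
  then show ?thesis
    by (simp add: quotient_topology_def)
qed

lemma topspace_quotient_topology: "topspace (quotient_topology X r) = topspace X // r"
proof
  show "topspace (quotient_topology X r) \<subseteq> topspace X // r"
    by (metis openin_quotient_topology openin_topspace)
  have "{x \<in> topspace X. r `` {x} \<in> topspace X // r} = topspace X"
    by (auto simp: quotient_def)
  then have "openin (quotient_topology X r) (topspace X // r)"
    by (simp add: openin_quotient_topology)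
  then show "topspace X // r \<subseteq> topspace (quotient_topology X r)"
    by (rule openin_subset)
qed

lemma quotient_map_quotient_topology:
  "quotient_map X (quotient_topology X r) (\<lambda>x. r `` {x})"
  by (auto simp: quotient_map_def openin_quotient_topology topspace_quotient_topology quotient_def)

text \<open>The wedge of the pointed spaces \<open>(X i, p i)\<close>, for a nonempty index set \<open>I\<close>.\<close>

definition wedge :: "'i set \<Rightarrow> ('i \<Rightarrow> 'a topology) \<Rightarrow> ('i \<Rightarrow> 'a) \<Rightarrow> ('i \<times> 'a) set topology" where
  "wedge I X p = quotient_topology (sum_topology X I)
     (generated_equiv (topspace (sum_topology X I)) {((i, p i), (j, p j)) | i j. i \<in> I \<and> j \<in> I})"

definition wedge_of_spheres :: "nat \<Rightarrow> nat \<Rightarrow> (nat \<times> (nat \<Rightarrow> real)) set topology" where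
  "wedge_of_spheres k d =
     wedge {..<k} (\<lambda>_. nsphere d) (\<lambda>_ i. if i = 0 then 1 else 0)"

end

theory Submission
  imports Defs
begin

text \<open>
The proof reduces the graph by elementary moves to a disjoint union of edges and triangles, whose
independence complex is a join of two-point and three-point sets, and then recognizes this join as a
wedge of spheres.

In the coordinates \<open>x + y\<close> (row) and \<open>x - y\<close> modulo \<open>M\<close> (column), the cylinder has the cells of even
coordinate sum, two cells being adjacent if both coordinates differ by one. The only move is this: if
every face of a complex containing \<open>u\<close> and \<open>v\<close> can be enlarged by \<open>w\<close>, the faces containing both \<open>u\<close> and
\<open>v\<close> may be deleted, because mass can be moved linearly from \<open>u\<close> and \<open>v\<close> to \<open>w\<close> until one of them is
empty (\<open>homotopy_equivalent_delete\<close>). The deleted faces cancel in the alternating sum, by toggling \<open>w\<close>.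
For independence complexes the move adds or removes an edge, and for \<open>u = v\<close> it is the fold lemma.

A cell in row \<open>3 k + 2\<close> is dominated by the cell of the same column in row \<open>3 k\<close>, as soon as the rows below of
this kind have been deleted (\<open>fold_equiv_kept_cells\<close>). If \<open>N\<close> is \<open>1\<close> modulo \<open>3\<close>, the last row now consists
of isolated vertices and the complex is a cone. Otherwise the rows pair up to \<open>n\<close> disjoint cycles of
length \<open>M\<close> (\<open>cells_to_cycles\<close>). A cycle may be shortened by three at the cost of one disjoint edge
(\<open>fold_equiv_cycle_step\<close>), so every cycle becomes \<open>m\<close> disjoint edges, one of them replaced by a triangle
if three divides \<open>M\<close> (\<open>fold_equiv_cycle\<close>).

There remains a join of \<open>m n\<close> discrete sets. Choosing a centre in each of them presents the
realization as a unit sphere in a product of stars, that is, as a union of spheres of dimension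
\<open>m n - 1\<close>, one for every choice of a noncentral point in each set. An explicit flow pushes the complement of
the open facets of noncentral points to a single point, which yields the wedge (\<open>wedge_decomposition\<close>).
A set of \<open>k\<close> points contributes the factor \<open>k - 1\<close> to the number of spheres and \<open>1 - k\<close> to the
alternating number. Hence triangles account for the factors of two, and pairs only for signs.
\<close>

section \<open>Finite simplicial complexes and their realizations\<close>
definition simplicial_complex :: "'a set set \<Rightarrow> bool" where
  "simplicial_complex K \<longleftrightarrow> finite K \<and> (\<forall>\<sigma>\<in>K. finite \<sigma> \<and> Pow \<sigma> \<subseteq> K)"

lemma simplicial_complexD:
  assumes "simplicial_complex K"
  shows "finite K" "finite (\<Union>K)" "\<sigma> \<in> K \<Longrightarrow> finite \<sigma>" "\<sigma> \<in> K \<Longrightarrow> \<tau> \<subseteq> \<sigma> \<Longrightarrow> \<tau> \<in> K"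
  using assms by (auto simp: simplicial_complex_def)

definition alternating_sum :: "'a set set \<Rightarrow> int" where
  "alternating_sum K = (\<Sum>\<sigma>\<in>K. (-1) ^ card \<sigma>)"

text \<open>Adding or removing \<open>w\<close> is a sign-reversing involution of \<open>S\<close>.\<close>
lemma sum_toggle_eq_0:
  assumes "\<And>\<sigma>. \<sigma> \<in> S \<Longrightarrow> finite \<sigma> \<and> insert w \<sigma> \<in> S \<and> \<sigma> - {w} \<in> S"
  shows "(\<Sum>\<sigma>\<in>S. (-1) ^ card \<sigma>) = (0::int)"
proof -
  define toggle where "toggle \<sigma> = (if w \<in> \<sigma> then \<sigma> - {w} else insert w \<sigma>)" for \<sigma>
  have "(\<Sum>\<sigma>\<in>S. (-1) ^ card \<sigma>) = (\<Sum>\<sigma>\<in>S. - ((-1) ^ card \<sigma>) :: int)"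
  proof (rule sum.reindex_bij_witness[where i = toggle and j = toggle])
    fix \<sigma> assume "\<sigma> \<in> S"
    then have \<sigma>: "finite \<sigma>" "insert w \<sigma> \<in> S" "\<sigma> - {w} \<in> S"
      using assms by blast+
    then show "toggle \<sigma> \<in> S" by (simp add: toggle_def)
    show "toggle (toggle \<sigma>) = \<sigma>" by (auto simp: toggle_def)
    have "card \<sigma> = Suc (card (\<sigma> - {w}))" if "w \<in> \<sigma>"
      using \<sigma>(1) that by (metis card_Suc_Diff1)
    then show "- ((-1) ^ card (toggle \<sigma>)) = ((-1) ^ card \<sigma> :: int)"
      using \<sigma>(1) by (cases "w \<in> \<sigma>") (simp_all add: toggle_def del: card_Diff_insert card_Diff_singleton)
  qed (use assms in \<open>auto simp: toggle_def\<close>)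
  then show ?thesis by (simp add: sum_negf)
qed

text \<open>The total mass is taken over a fixed finite \<open>V\<close> and not over the varying support, so that it is
visibly preserved by the homotopies below, which move mass linearly between vertices.\<close>
definition barycentric_points :: "'a set \<Rightarrow> 'a set set \<Rightarrow> ('a \<Rightarrow> real) set" where
  "barycentric_points V K = {t. (\<forall>v. 0 \<le> t v) \<and> {v. t v \<noteq> 0} \<in> K \<and> sum t V = 1}"

lemma geometric_realization_eq:
  assumes "finite V" "\<Union>K \<subseteq> V"
  shows "geometric_realization K = subtopology (powertop_real UNIV) (barycentric_points V K)"
proof -
  have "sum t {v. t v \<noteq> 0} = sum t V" if "{v. t v \<noteq> 0} \<in> K" for t :: "'a \<Rightarrow> real"
    using assms that by (intro sum.mono_neutral_left) auto
  then show ?thesis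
    unfolding geometric_realization_def barycentric_points_def
    by (intro arg_cong[where f = "subtopology _"]) auto
qed

lemma topspace_geometric_realization:
  assumes "finite V" "\<Union>K \<subseteq> V"
  shows "topspace (geometric_realization K) = barycentric_points V K"
  by (simp add: geometric_realization_eq[OF assms])

lemma continuous_map_coordinate:
  "continuous_map (geometric_realization K) euclideanreal (\<lambda>t. t v)"
  unfolding geometric_realization_def
  by (intro continuous_map_from_subtopology continuous_map_product_projection) simp

lemma continuous_map_into_realization:
  assumes "finite V" "\<Union>K \<subseteq> V"
    and "\<And>v. continuous_map X euclideanreal (\<lambda>x. f x v)"
    and "\<And>x. x \<in> topspace X \<Longrightarrow> f x \<in> barycentric_points V K"
  shows "continuous_map X (geometric_realization K) f"
  using assms(3,4) unfolding geometric_realization_eq[OF assms(1,2)] continuous_map_in_subtopology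
  by (auto simp: continuous_map_componentwise_UNIV)

lemma homotopic_in_realization:
  assumes "finite V" "\<Union>K \<subseteq> V"
    and cont: "\<And>v. continuous_map (prod_topology (top_of_set {0..1::real}) X) euclideanreal (\<lambda>p. h (fst p) (snd p) v)"
    and "\<And>s x. s \<in> {0..1} \<Longrightarrow> x \<in> topspace X \<Longrightarrow> h s x \<in> barycentric_points V K"
    and "\<And>x. x \<in> topspace X \<Longrightarrow> h 0 x = f x" "\<And>x. x \<in> topspace X \<Longrightarrow> h 1 x = g x"
  shows "homotopic_with (\<lambda>_. True) X (geometric_realization K) f g"
proof -
  have "continuous_map (prod_topology (top_of_set {0..1::real}) X) (geometric_realization K) (\<lambda>p. h (fst p) (snd p))"
    using assms by (intro continuous_map_into_realization) auto
  then show ?thesis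
    using assms by (subst homotopic_with) (auto intro!: exI[where x = "\<lambda>p. h (fst p) (snd p)"])
qed

lemma continuous_map_homotopy_projections:
  "continuous_map (prod_topology (top_of_set {0..1::real}) X) euclideanreal fst"
  "continuous_map X euclideanreal f \<Longrightarrow>
    continuous_map (prod_topology (top_of_set {0..1::real}) X) euclideanreal (\<lambda>p. f (snd p))"
proof -
  show "continuous_map (prod_topology (top_of_set {0..1::real}) X) euclideanreal fst"
    using continuous_map_fst continuous_map_into_fulltopology by blast
  show "continuous_map (prod_topology (top_of_set {0..1::real}) X) euclideanreal (\<lambda>p. f (snd p))"
    if "continuous_map X euclideanreal f"
    using continuous_map_compose[OF continuous_map_snd that] by (simp add: o_def)
qed

section \<open>Deleting the faces that contain a given pair of vertices\<close>
text \<open>Move the mass \<open>min (t u) (t v)\<close> away from each of \<open>u\<close> and \<open>v\<close> and put it on \<open>w\<close>. The hypothesis on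
\<open>w\<close> says that the support may be enlarged by \<open>w\<close> whenever there is mass to move; at the end
\<open>u\<close> or \<open>v\<close> has lost all its mass, and points whose support lacks \<open>u\<close> or \<open>v\<close> never move. So this is a
deformation retraction. The case \<open>u = v\<close> is meant to be covered: it deletes the vertex \<open>u\<close>, and
\<open>card {u, v}\<close> in the proof is the amount that \<open>w\<close> gains per unit moved in either case.\<close>
lemma homotopy_equivalent_delete:
  fixes K :: "'a set set"
  assumes K: "simplicial_complex K" and w: "w \<notin> {u, v}"
    and ext: "\<And>\<tau>. \<tau> \<in> K \<Longrightarrow> u \<in> \<tau> \<Longrightarrow> v \<in> \<tau> \<Longrightarrow> insert w \<tau> \<in> K"
  defines "L \<equiv> {\<tau> \<in> K. \<not> (u \<in> \<tau> \<and> v \<in> \<tau>)}"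
  shows "geometric_realization K homotopy_equivalent_space geometric_realization L"
proof -
  define V where "V = \<Union>K \<union> {u, v, w}"
  have V: "finite V" "\<Union>K \<subseteq> V" "\<Union>L \<subseteq> V"
    using simplicial_complexD(2)[OF K] by (auto simp: V_def L_def)
  define c where "c x = (if x = w then real (card {u, v}) else if x \<in> {u, v} then -1 else 0)" for x
  define h where "h s t x = t x + s * min (t u) (t v) * c x" for s :: real and t x
  have "sum c V = sum c {w} + sum c {u, v}"
    using V(1) w by (subst sum.union_disjoint[symmetric])
      (auto intro!: sum.mono_neutral_right simp: V_def c_def split: if_splits)
  also have "\<dots> = 0"
    using w by (cases "u = v") (auto simp: c_def)
  finally have "sum c V = 0" .
  then have sum_h: "sum (h s t) V = sum t V" for s t
    by (simp add: h_def sum.distrib sum_distrib_left[symmetric])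
  have h_in_K: "h s t \<in> barycentric_points V K"
    and h_in_L: "s = 1 \<Longrightarrow> h s t \<in> barycentric_points V L"
    if s: "s \<in> {0..1}" and t: "t \<in> barycentric_points V K" for s t
  proof -
    have t_nonneg: "0 \<le> t x" for x
      using t by (simp add: barycentric_points_def)
    have le: "s * min (t u) (t v) \<le> min (t u) (t v)"
      using s t_nonneg by (intro mult_left_le_one_le) auto
    have nonneg: "0 \<le> h s t x" for x
    proof -
      have "0 \<le> s * min (t u) (t v)" using s t_nonneg by simp
      then have "0 \<le> s * min (t u) (t v) * real (card {u, v})" by (rule mult_nonneg_nonneg) simp
      moreover have "s * min (t u) (t v) \<le> t u" "s * min (t u) (t v) \<le> t v"
        using le by linarith+
      ultimately show ?thesis
        using t_nonneg[of x] unfolding h_def c_def by (auto simp del: of_nat_mult)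
    qed
    have supp: "{x. h s t x \<noteq> 0} \<in> K"
    proof (cases "min (t u) (t v) = 0")
      case True
      then show ?thesis using t by (simp add: h_def barycentric_points_def)
    next
      case False
      then have "t u \<noteq> 0" "t v \<noteq> 0"
        using t_nonneg[of u] t_nonneg[of v] by (auto simp: min_def split: if_splits)
      then have "insert w {x. t x \<noteq> 0} \<in> K"
        using t by (intro ext) (auto simp: barycentric_points_def)
      moreover have "{x. h s t x \<noteq> 0} \<subseteq> insert w {x. t x \<noteq> 0}"
        using False t_nonneg[of u] t_nonneg[of v] by (auto simp: h_def c_def split: if_splits)
      ultimately show ?thesis using simplicial_complexD(4)[OF K] by blast
    qed
    show "h s t \<in> barycentric_points V K"
      using nonneg supp sum_h t by (simp add: barycentric_points_def)
    have "h 1 t u = 0 \<or> h 1 t v = 0"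
      using w by (auto simp: h_def c_def min_def)
    then show "h s t \<in> barycentric_points V L" if "s = 1"
      using nonneg supp sum_h t that by (auto simp: barycentric_points_def L_def)
  qed
  have h_L: "h s t = t" if "t \<in> barycentric_points V L" for s t
  proof -
    have "t u = 0 \<or> t v = 0" "0 \<le> t u" "0 \<le> t v"
      using that by (auto simp: barycentric_points_def L_def)
    then have "min (t u) (t v) = 0" by (auto simp: min_def)
    then show ?thesis by (simp add: h_def fun_eq_iff)
  qed
  have LK: "barycentric_points V L \<subseteq> barycentric_points V K"
    by (auto simp: barycentric_points_def L_def)
  have min_cont: "continuous_map (geometric_realization K) euclideanreal (\<lambda>t. min (t u) (t v))"
    by (intro continuous_intros continuous_map_coordinate)
  show ?thesis
  proof (rule deformation_retraction_imp_homotopy_equivalent_space)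
    show "homotopic_with (\<lambda>_. True) (geometric_realization K) (geometric_realization K) (id \<circ> h 1) id"
    proof (rule homotopic_with_symD, rule homotopic_in_realization[OF V(1,2)])
      fix x
      show "continuous_map (prod_topology (top_of_set {0..1}) (geometric_realization K))
          euclideanreal (\<lambda>p. h (fst p) (snd p) x)"
        unfolding h_def
        by (intro continuous_map_add continuous_map_real_mult continuous_map_homotopy_projections
            continuous_map_coordinate min_cont) simp
    next
      show "h s t \<in> barycentric_points V K"
        if "s \<in> {0..1}" "t \<in> topspace (geometric_realization K)" for s t
        using that h_in_K by (simp add: topspace_geometric_realization[OF V(1,2)])
    qed (simp_all add: h_def fun_eq_iff)
    show "retraction_maps (geometric_realization K) (geometric_realization L) (h 1) id"
      unfolding retraction_maps_def
    proof (intro conjI)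
      show "continuous_map (geometric_realization K) (geometric_realization L) (h 1)"
      proof (rule continuous_map_into_realization[OF V(1,3)])
        show "continuous_map (geometric_realization K) euclideanreal (\<lambda>t. h 1 t x)" for x
          unfolding h_def
          by (intro continuous_map_add continuous_map_real_mult continuous_map_coordinate min_cont) simp_all
      qed (simp add: topspace_geometric_realization[OF V(1,2)] h_in_L)
      show "continuous_map (geometric_realization L) (geometric_realization K) id"
        using LK by (intro continuous_map_into_realization[OF V(1,2)])
          (auto simp: topspace_geometric_realization[OF V(1,3)] continuous_map_coordinate)
    qed (simp add: h_L topspace_geometric_realization[OF V(1,3)])
  qed
qed

lemma alternating_sum_delete:
  assumes K: "simplicial_complex K" and w: "w \<notin> {u, v}"
    and ext: "\<And>\<tau>. \<tau> \<in> K \<Longrightarrow> u \<in> \<tau> \<Longrightarrow> v \<in> \<tau> \<Longrightarrow> insert w \<tau> \<in> K"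
  shows "alternating_sum K = alternating_sum {\<tau> \<in> K. \<not> (u \<in> \<tau> \<and> v \<in> \<tau>)}"
proof -
  let ?D = "{\<tau> \<in> K. u \<in> \<tau> \<and> v \<in> \<tau>}"
  have "(\<Sum>\<tau>\<in>?D. (-1) ^ card \<tau>) = (0::int)"
    by (rule sum_toggle_eq_0[where w = w])
      (use simplicial_complexD[OF K] ext w in auto)
  moreover have "alternating_sum K
      = alternating_sum {\<tau> \<in> K. \<not> (u \<in> \<tau> \<and> v \<in> \<tau>)} + (\<Sum>\<tau>\<in>?D. (-1) ^ card \<tau>)"
    unfolding alternating_sum_def using simplicial_complexD(1)[OF K]
    by (subst sum.union_disjoint[symmetric]) (auto intro: sum.cong)
  ultimately show ?thesis by simp
qed

text \<open>Keeping track of the single moves, and not only of the homotopy type, is what makes the relation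
compatible with joins: a move on one factor is literally a move of the same kind on the join.\<close>
inductive fold_equiv :: "'a set set \<Rightarrow> 'a set set \<Rightarrow> bool" where
  fold_delete: "simplicial_complex K \<Longrightarrow> w \<notin> {u, v} \<Longrightarrow>
    (\<And>\<tau>. \<tau> \<in> K \<Longrightarrow> u \<in> \<tau> \<Longrightarrow> v \<in> \<tau> \<Longrightarrow> insert w \<tau> \<in> K) \<Longrightarrow>
    fold_equiv K {\<tau> \<in> K. \<not> (u \<in> \<tau> \<and> v \<in> \<tau>)}"
| fold_refl: "fold_equiv K K"
| fold_sym: "fold_equiv K L \<Longrightarrow> fold_equiv L K"
| fold_trans [trans]: "fold_equiv K L \<Longrightarrow> fold_equiv L J \<Longrightarrow> fold_equiv K J"

lemma fold_equiv_imp: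
  assumes "fold_equiv K L"
  shows "geometric_realization K homotopy_equivalent_space geometric_realization L"
    and "alternating_sum K = alternating_sum L"
  using assms
proof induction
  case (fold_delete K w u v)
  {
    case 1
    show ?case by (rule homotopy_equivalent_delete) (use fold_delete in auto)
  next
    case 2
    show ?case by (rule alternating_sum_delete) (use fold_delete in auto)
  }
next
  case (fold_refl K)
  {
    case 1 show ?case by (rule homotopy_equivalent_space_refl)
  next
    case 2 show ?case ..
  }
next
  case (fold_sym K L)
  {
    case 1 show ?case using fold_sym.IH(1) homotopy_equivalent_space_sym by blast
  next
    case 2 show ?case using fold_sym.IH by simp
  }
next
  case (fold_trans K L J)
  {
    case 1 show ?case using fold_trans.IH(1,3) by (rule homotopy_eqv_trans)
  next
    case 2 show ?case using fold_trans.IH by simp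
  }
qed

text \<open>A cone contracts to its apex along straight lines, and toggling the apex cancels the alternating sum.\<close>
lemma contractible_cone:
  assumes K: "simplicial_complex K" and "K \<noteq> {}" and cone: "\<And>\<tau>. \<tau> \<in> K \<Longrightarrow> insert w \<tau> \<in> K"
  shows "contractible_space (geometric_realization K)" and "alternating_sum K = 0"
proof -
  define V where "V = \<Union>K"
  have V: "finite V" "\<Union>K \<subseteq> V"
    using simplicial_complexD(2)[OF K] by (auto simp: V_def)
  have wV: "w \<in> V" using \<open>K \<noteq> {}\<close> cone by (force simp: V_def)
  define e where "e x = (if x = w then 1 else 0 :: real)" for x
  define h where "h s t x = (1 - s) * t x + s * e x" for s :: real and t x
  have h_in_K: "h s t \<in> barycentric_points V K"
    if s: "s \<in> {0..1}" and t: "t \<in> barycentric_points V K" for s t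
  proof -
    have "insert w {x. t x \<noteq> 0} \<in> K"
      using t by (intro cone) (auto simp: barycentric_points_def)
    moreover have "{x. h s t x \<noteq> 0} \<subseteq> insert w {x. t x \<noteq> 0}"
      by (auto simp: h_def e_def)
    ultimately have "{x. h s t x \<noteq> 0} \<in> K"
      using simplicial_complexD(4)[OF K] by blast
    moreover have "sum (h s t) V = 1"
      using t V(1) wV by (simp add: h_def e_def sum.distrib barycentric_points_def flip: sum_distrib_left)
    ultimately show ?thesis
      using s t by (auto simp: barycentric_points_def h_def e_def)
  qed
  have "homotopic_with (\<lambda>_. True) (geometric_realization K) (geometric_realization K) id (\<lambda>_. e)"
  proof (rule homotopic_in_realization[OF V])
    fix x
    show "continuous_map (prod_topology (top_of_set {0..1}) (geometric_realization K))
        euclideanreal (\<lambda>p. h (fst p) (snd p) x)"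
      unfolding h_def
      by (intro continuous_map_add continuous_map_real_mult continuous_map_homotopy_projections
          continuous_map_coordinate continuous_map_diff) simp_all
  next
    show "h s t \<in> barycentric_points V K"
      if "s \<in> {0..1}" "t \<in> topspace (geometric_realization K)" for s t
      using that h_in_K by (simp add: topspace_geometric_realization[OF V])
  qed (simp_all add: h_def fun_eq_iff)
  then show "contractible_space (geometric_realization K)"
    unfolding contractible_space_def by blast
  show "alternating_sum K = 0"
    unfolding alternating_sum_def
    by (rule sum_toggle_eq_0[where w = w]) (use simplicial_complexD[OF K] cone in auto)
qed

lemma relabel_complex:
  assumes K: "simplicial_complex K" and inj: "inj_on f (\<Union>K)"
  shows "geometric_realization K homotopy_equivalent_space geometric_realization ((`) f ` K)"
    and "alternating_sum ((`) f ` K) = alternating_sum K"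
proof -
  define V where "V = \<Union>K"
  have V: "finite V" "\<Union>K \<subseteq> V" "finite (f ` V)" "\<Union>((`) f ` K) \<subseteq> f ` V"
    using simplicial_complexD(2)[OF K] by (auto simp: V_def)
  have injV: "inj_on f V" using inj by (simp add: V_def)
  define F where "F t y = (if y \<in> f ` V then t (inv_into V f y) else 0)" for t :: "_ \<Rightarrow> real" and y
  define G where "G t x = (if x \<in> V then t (f x) else 0)" for t :: "_ \<Rightarrow> real" and x
  have Ff: "F t (f x) = t x" if "x \<in> V" for t x
    using that injV by (simp add: F_def)
  have suppF: "{y. F t y \<noteq> 0} = f ` {x. t x \<noteq> 0}" if "{x. t x \<noteq> 0} \<subseteq> V" for t
  proof -
    have "F t y = 0" if "y \<notin> f ` V" for y using that by (simp add: F_def)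
    then have "{y. F t y \<noteq> 0} = {y \<in> f ` V. F t y \<noteq> 0}" by metis
    also have "\<dots> = f ` {x \<in> V. F t (f x) \<noteq> 0}" by auto
    also have "{x \<in> V. F t (f x) \<noteq> 0} = {x. t x \<noteq> 0}"
      using that Ff by auto
    finally show ?thesis .
  qed
  have F_in: "F t \<in> barycentric_points (f ` V) ((`) f ` K)" if t: "t \<in> barycentric_points V K" for t
  proof -
    have "sum (F t) (f ` V) = sum t V"
      using injV by (subst sum.reindex) (auto simp: F_def intro!: sum.cong)
    moreover have "{x. t x \<noteq> 0} \<subseteq> V" "{x. t x \<noteq> 0} \<in> K"
      using t V(2) by (auto simp: barycentric_points_def)
    ultimately show ?thesis
      using t suppF[of t] by (auto simp: barycentric_points_def) (simp add: F_def)
  qed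
  have G_in: "G t \<in> barycentric_points V K" if t: "t \<in> barycentric_points (f ` V) ((`) f ` K)" for t
  proof -
    obtain \<tau> where \<tau>: "\<tau> \<in> K" "{y. t y \<noteq> 0} = f ` \<tau>"
      using t by (auto simp: barycentric_points_def)
    have "\<tau> \<subseteq> V" using \<tau>(1) V(2) by blast
    then have "x \<in> V \<Longrightarrow> t (f x) \<noteq> 0 \<longleftrightarrow> x \<in> \<tau>" for x
      using \<tau>(2) injV by (metis (mono_tags) inj_on_image_mem_iff mem_Collect_eq)
    then have "{x. G t x \<noteq> 0} = \<tau>"
      using \<open>\<tau> \<subseteq> V\<close> by (auto simp: G_def)
    moreover have "sum (G t) V = sum t (f ` V)"
      using injV by (subst sum.reindex) (auto simp: G_def intro!: sum.cong)
    ultimately show ?thesis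
      using t \<tau>(1) by (auto simp: barycentric_points_def) (simp add: G_def)
  qed
  have supp0: "t x = 0" if "t \<in> barycentric_points V K" "x \<notin> V" for t x
    using that V(2) by (auto simp: barycentric_points_def)
  have supp0': "t x = 0" if "t \<in> barycentric_points (f ` V) ((`) f ` K)" "x \<notin> f ` V" for t x
  proof -
    have "{y. t y \<noteq> 0} \<subseteq> f ` V"
      using that(1) V(4) unfolding barycentric_points_def by blast
    then show ?thesis using that(2) by blast
  qed
  have "homeomorphic_maps (geometric_realization K) (geometric_realization ((`) f ` K)) F G"
    unfolding homeomorphic_maps_def
  proof (intro conjI ballI)
    show "continuous_map (geometric_realization K) (geometric_realization ((`) f ` K)) F"
    proof (rule continuous_map_into_realization[OF V(3,4)])
      show "continuous_map (geometric_realization K) euclideanreal (\<lambda>t. F t y)" for y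
        by (cases "y \<in> f ` V") (simp_all add: F_def continuous_map_coordinate)
    qed (simp add: topspace_geometric_realization[OF V(1,2)] F_in)
    show "continuous_map (geometric_realization ((`) f ` K)) (geometric_realization K) G"
    proof (rule continuous_map_into_realization[OF V(1,2)])
      show "continuous_map (geometric_realization ((`) f ` K)) euclideanreal (\<lambda>t. G t x)" for x
        by (cases "x \<in> V") (simp_all add: G_def continuous_map_coordinate)
    qed (simp add: topspace_geometric_realization[OF V(3,4)] G_in)
    show "G (F t) = t" if "t \<in> topspace (geometric_realization K)" for t
    proof
      fix x
      show "G (F t) x = t x"
        using that supp0[of t x] Ff[of x t]
        by (cases "x \<in> V") (simp_all add: topspace_geometric_realization[OF V(1,2)] G_def)
    qed
    show "F (G t) = t" if "t \<in> topspace (geometric_realization ((`) f ` K))" for t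
    proof
      fix y
      show "F (G t) y = t y"
        using that supp0'[of t y]
        by (cases "y \<in> f ` V")
          (simp_all add: topspace_geometric_realization[OF V(3,4)] F_def G_def inv_into_into f_inv_into_f)
    qed
  qed
  then show "geometric_realization K homotopy_equivalent_space geometric_realization ((`) f ` K)"
    by (blast intro: homeomorphic_imp_homotopy_equivalent_space homeomorphic_maps_imp_homeomorphic_space)
  have "card (f ` \<tau>) = card \<tau>" if "\<tau> \<in> K" for \<tau>
    using inj that by (intro card_image) (auto intro: inj_on_subset)
  moreover have "inj_on ((`) f) K"
    using inj by (intro inj_on_image) 
  ultimately show "alternating_sum ((`) f ` K) = alternating_sum K"
    by (simp add: alternating_sum_def sum.reindex)
qed

section \<open>Wedges of spheres\<close>
lemma continuous_map_from_sum_topology: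
  assumes "\<And>i. i \<in> I \<Longrightarrow> continuous_map (X i) Y (\<lambda>x. f (i, x))"
  shows "continuous_map (sum_topology X I) Y f"
  unfolding continuous_map_def
proof (intro conjI allI impI)
  show "f \<in> topspace (sum_topology X I) \<rightarrow> topspace Y"
    using assms by (fastforce simp: continuous_map_def)
  fix U assume U: "openin Y U"
  have "openin (X i) {x \<in> topspace (X i). f (i, x) \<in> U}" if "i \<in> I" for i
    using assms[OF that] U by (simp add: continuous_map_def)
  moreover have "{x. (i, x) \<in> {a \<in> topspace (sum_topology X I). f a \<in> U}}
      = {x \<in> topspace (X i). f (i, x) \<in> U}" if "i \<in> I" for i
    using that by auto
  ultimately show "openin (sum_topology X I) {a \<in> topspace (sum_topology X I). f a \<in> U}"
    unfolding openin_sum_topology by auto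
qed

lemma continuous_map_sum_injection:
  assumes "i \<in> I"
  shows "continuous_map (X i) (sum_topology X I) (\<lambda>x. (i, x))"
  using assms unfolding continuous_map_def openin_sum_topology
  by (auto simp: Int_def[symmetric] Collect_conj_eq dest: openin_subset intro: openin_Int)

text \<open>Products distribute over disjoint sums. This is used with the unit interval as \<open>Z\<close>, to define a
homotopy on a wedge of spheres one sphere at a time.\<close>
lemma continuous_map_from_prod_sum_topology:
  assumes "\<And>i. i \<in> I \<Longrightarrow> continuous_map (prod_topology Z (X i)) Y (\<lambda>(z, x). f (z, i, x))"
  shows "continuous_map (prod_topology Z (sum_topology X I)) Y f"
proof (rule pasting_lemma[where I = I and f = "\<lambda>_. f" and T = "\<lambda>i. topspace Z \<times> ({i} \<times> topspace (X i))"])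
  let ?S = "sum_topology X I"
  let ?T = "\<lambda>i. topspace Z \<times> ({i} \<times> topspace (X i))"
  show "\<exists>j. j \<in> I \<and> p \<in> ?T j \<and> f p = f p" if "p \<in> topspace (prod_topology Z ?S)" for p
    using that by auto
  fix i assume i: "i \<in> I"
  have open_summand: "openin ?S ({i} \<times> U)" if "openin (X i) U" for U
  proof -
    have "{x. (j, x) \<in> {i} \<times> U} = (if j = i then U else {})" for j by auto
    then show ?thesis using i that openin_subset[OF that] by (auto simp: openin_sum_topology)
  qed
  then show "openin (prod_topology Z ?S) (?T i)"
    by (simp add: openin_prod_Times_iff)
  have "continuous_map (subtopology ?S ({i} \<times> topspace (X i))) (X i) snd"
    unfolding continuous_map_def
  proof (intro conjI allI impI)
    show "openin (subtopology ?S ({i} \<times> topspace (X i)))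
        {a \<in> topspace (subtopology ?S ({i} \<times> topspace (X i))). snd a \<in> U}" if "openin (X i) U" for U
      unfolding openin_subtopology
      using open_summand[OF that] openin_subset[OF that] i by (intro exI[of _ "{i} \<times> U"]) auto
  qed auto
  then have "continuous_map (prod_topology Z (subtopology ?S ({i} \<times> topspace (X i))))
      (prod_topology Z (X i)) (\<lambda>(z, a). (z, snd a))"
    by (intro continuous_map_prod_top[THEN iffD2] disjI2 conjI) auto
  from continuous_map_compose[OF this assms[OF i]]
  have "continuous_map (prod_topology Z (subtopology ?S ({i} \<times> topspace (X i)))) Y
      (\<lambda>p. f (fst p, i, snd (snd p)))"
    by (simp add: o_def case_prod_unfold)
  moreover have "prod_topology Z (subtopology ?S ({i} \<times> topspace (X i)))
      = subtopology (prod_topology Z ?S) (?T i)"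
    by (simp add: prod_topology_subtopology)
  ultimately show "continuous_map (subtopology (prod_topology Z ?S) (?T i)) Y f"
    by (auto elim!: continuous_map_eq)
qed simp

text \<open>The identification of base points is already transitive, so the generated equivalence relation adds
only the diagonal. After this lemma a wedge is used only through its quotient map and the
description of the fibres.\<close>
lemma wedge_quotient_map:
  assumes p: "\<And>i. i \<in> I \<Longrightarrow> p i \<in> topspace (X i)"
  obtains q where "quotient_map (sum_topology X I) (wedge I X p) q"
    and "\<And>i x j y. i \<in> I \<Longrightarrow> x \<in> topspace (X i) \<Longrightarrow> j \<in> I \<Longrightarrow> y \<in> topspace (X j) \<Longrightarrow>
      q (i, x) = q (j, y) \<longleftrightarrow> i = j \<and> x = y \<or> x = p i \<and> y = p j"
proof
  define P where "P = {((i, p i), (j, p j)) | i j. i \<in> I \<and> j \<in> I}"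
  define T where "T = topspace (sum_topology X I)"
  define r where "r = generated_equiv T P"
  have "trans (P \<union> P\<inverse>)" by (auto simp: P_def trans_def)
  then have "(P \<union> P\<inverse>)\<^sup>* = P\<^sup>="
    by (auto simp: rtrancl_trancl_reflcl P_def)
  then have r: "(a, b) \<in> r \<longleftrightarrow> a \<in> T \<and> b \<in> T \<and> (a = b \<or> (a, b) \<in> P)" for a b
    by (auto simp: r_def generated_equiv_def)
  show "quotient_map (sum_topology X I) (wedge I X p) (\<lambda>a. r `` {a})"
    unfolding wedge_def r_def T_def P_def by (rule quotient_map_quotient_topology)
  have "equiv T r" by (simp add: r_def equiv_generated_equiv)
  then show "r `` {(i, x)} = r `` {(j, y)} \<longleftrightarrow> i = j \<and> x = y \<or> x = p i \<and> y = p j"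
    if "i \<in> I" "x \<in> topspace (X i)" "j \<in> I" "y \<in> topspace (X j)" for i x j y
    using that by (subst eq_equiv_class_iff) (auto simp: T_def r P_def)
qed

abbreviation sphere_base :: "nat \<Rightarrow> real" where
  "sphere_base \<equiv> \<lambda>i. if i = 0 then 1 else 0"

lemma wedge_of_spheres_quotient_map:
  obtains q where "quotient_map (sum_topology (\<lambda>_. nsphere d) {..<k}) (wedge_of_spheres k d) q"
    and "\<And>i x j y. i < k \<Longrightarrow> x \<in> topspace (nsphere d) \<Longrightarrow> j < k \<Longrightarrow> y \<in> topspace (nsphere d) \<Longrightarrow>
      q (i, x) = q (j, y) \<longleftrightarrow> i = j \<and> x = y \<or> x = sphere_base \<and> y = sphere_base"
proof (rule wedge_quotient_map)
  show "sphere_base \<in> topspace (nsphere d)" by (rule in_topspace_nsphere)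
  fix q
  assume "quotient_map (sum_topology (\<lambda>_. nsphere d) {..<k}) (wedge {..<k} (\<lambda>_. nsphere d) (\<lambda>_. sphere_base)) q"
    and "\<And>i x j y. i \<in> {..<k} \<Longrightarrow> x \<in> topspace (nsphere d) \<Longrightarrow> j \<in> {..<k} \<Longrightarrow>
      y \<in> topspace (nsphere d) \<Longrightarrow>
      q (i, x) = q (j, y) \<longleftrightarrow> i = j \<and> x = y \<or> x = sphere_base \<and> y = sphere_base"
  then show thesis by (intro that[of q]) (simp_all add: wedge_of_spheres_def)
qed

lemma wedge_of_one_sphere: "wedge_of_spheres 1 d homeomorphic_space nsphere d"
proof -
  obtain q where q: "quotient_map (sum_topology (\<lambda>_. nsphere d) {..<1::nat}) (wedge_of_spheres 1 d) q"
    and q_eq: "\<And>i x j y. i < 1 \<Longrightarrow> x \<in> topspace (nsphere d) \<Longrightarrow> j < (1::nat) \<Longrightarrow>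
        y \<in> topspace (nsphere d) \<Longrightarrow>
        q (i, x) = q (j, y) \<longleftrightarrow> i = j \<and> x = y \<or> x = sphere_base \<and> y = sphere_base"
    by (rule wedge_of_spheres_quotient_map[of d 1], rule that)
  let ?S = "sum_topology (\<lambda>_. nsphere d) {..<1::nat}"
  have "homeomorphic_map ?S (wedge_of_spheres 1 d) q"
  proof -
    have "inj_on q (topspace ?S)"
      using q_eq by (auto simp: inj_on_def)
    then show ?thesis using q by (simp add: homeomorphic_map_def)
  qed
  moreover have "homeomorphic_maps (nsphere d) ?S (\<lambda>x. (0, x)) snd"
    unfolding homeomorphic_maps_def
  proof (intro conjI)
    show "continuous_map (nsphere d) ?S (\<lambda>x. (0, x))"
      by (rule continuous_map_sum_injection) simp
    show "continuous_map ?S (nsphere d) snd"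
      by (rule continuous_map_from_sum_topology) simp
  qed auto
  ultimately show ?thesis
    by (meson homeomorphic_map_imp_homeomorphic_space homeomorphic_maps_imp_homeomorphic_space
        homeomorphic_space_sym homeomorphic_space_trans)
qed

section \<open>Coordinates on the sphere\<close>
definition l1_norm :: "nat \<Rightarrow> (nat \<Rightarrow> real) \<Rightarrow> real" where
  "l1_norm d y = (\<Sum>i<d. \<bar>y i\<bar>)"

text \<open>A linear involution of \<open>\<real>\<^sup>d\<close> that maps \<open>(-1, \<dots>, -1)\<close> to the first unit vector, that is, to the base
point of the sphere in a wedge of spheres. It reconciles that base point with the symmetric one that
is natural for a join of discrete sets.\<close>
definition reflect :: "nat \<Rightarrow> (nat \<Rightarrow> real) \<Rightarrow> nat \<Rightarrow> real" where
  "reflect d y i = (if i < d then (if i = 0 then 0 else y i) - y 0 else 0)"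

text \<open>Radial projection after the reflection. It is inverse to \<open>reflect\<close> up to positive scaling, see
\<open>reflect_to_sphere\<close> and \<open>to_sphere_reflect\<close>.\<close>
definition to_sphere :: "nat \<Rightarrow> (nat \<Rightarrow> real) \<Rightarrow> nat \<Rightarrow> real" where
  "to_sphere d y i = reflect d y i / sqrt (\<Sum>j<d. (reflect d y j)\<^sup>2)"

lemma topspace_nsphere:
  assumes "0 < d"
  shows "topspace (nsphere (d - Suc 0)) = {x. (\<Sum>i<d. (x i)\<^sup>2) = 1 \<and> (\<forall>i\<ge>d. x i = 0)}"
proof -
  have "{..d - Suc 0} = {..<d}" "\<And>i. i > d - Suc 0 \<longleftrightarrow> i \<ge> d" using assms by auto
  then show ?thesis by (simp add: nsphere)
qed

lemma reflect_reflect: "i < d \<Longrightarrow> reflect d (reflect d y) i = y i"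
  by (simp add: reflect_def)

lemma reflect_scale: "reflect d (\<lambda>i. y i / c) i = reflect d y i / c"
  by (simp add: reflect_def diff_divide_distrib)

lemma reflect_cong: "(\<And>i. i < d \<Longrightarrow> y i = y' i) \<Longrightarrow> reflect d y = reflect d y'"
  by (auto simp: reflect_def fun_eq_iff)

lemma to_sphere_cong: "(\<And>i. i < d \<Longrightarrow> y i = y' i) \<Longrightarrow> to_sphere d y = to_sphere d y'"
  using reflect_cong[of d y y'] by (simp add: to_sphere_def fun_eq_iff)

lemma sum_squares_reflect_pos:
  assumes "0 < l1_norm d y"
  shows "0 < (\<Sum>j<d. (reflect d y j)\<^sup>2)"
proof (rule ccontr)
  assume "\<not> ?thesis"
  then have "(\<Sum>j<d. (reflect d y j)\<^sup>2) = 0"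
    by (meson not_less order.antisym sum_nonneg zero_le_power2)
  then have zero: "reflect d y j = 0" if "j < d" for j
    using that by (subst (asm) sum_nonneg_eq_0_iff) auto
  have "y j = 0" if "j < d" for j
    using zero[OF that] zero[of 0] that by (simp add: reflect_def split: if_splits)
  then show False using assms by (simp add: l1_norm_def)
qed

lemma l1_norm_pos_iff: "0 < l1_norm d y \<longleftrightarrow> (\<exists>i<d. y i \<noteq> 0)"
  by (auto simp: l1_norm_def sum_nonneg less_le sum_nonneg_eq_0_iff)

lemma to_sphere_in_nsphere:
  assumes "0 < d" "0 < l1_norm d y"
  shows "to_sphere d y \<in> topspace (nsphere (d - 1))"
  using sum_squares_reflect_pos[OF assms(2)] assms(1)
  by (simp add: topspace_nsphere to_sphere_def power_divide reflect_def flip: sum_divide_distrib)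

lemma reflect_to_sphere:
  assumes "0 < l1_norm d y"
  obtains c where "0 < c" "\<And>i. i < d \<Longrightarrow> reflect d (to_sphere d y) i = y i / c"
proof
  show "0 < sqrt (\<Sum>j<d. (reflect d y j)\<^sup>2)"
    using sum_squares_reflect_pos[OF assms] by simp
  show "reflect d (to_sphere d y) i = y i / sqrt (\<Sum>j<d. (reflect d y j)\<^sup>2)" if "i < d" for i
    using that unfolding to_sphere_def[abs_def] by (simp add: reflect_scale reflect_reflect)
qed

lemma to_sphere_scale:
  assumes "0 < c"
  shows "to_sphere d (\<lambda>i. y i / c) = to_sphere d y"
proof -
  have "sqrt (\<Sum>j<d. (reflect d (\<lambda>i. y i / c) j)\<^sup>2) = sqrt (\<Sum>j<d. (reflect d y j)\<^sup>2) / c"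
    using assms by (simp add: reflect_scale power_divide real_sqrt_divide flip: sum_divide_distrib)
  then show ?thesis using assms by (simp add: to_sphere_def fun_eq_iff reflect_scale)
qed

lemma to_sphere_reflect:
  assumes "0 < d" "x \<in> topspace (nsphere (d - 1))"
  shows "to_sphere d (reflect d x) = x"
proof
  fix i
  have "reflect d (reflect d x) j = x j" for j
    using assms by (cases "j < d") (auto simp: reflect_reflect topspace_nsphere, simp add: reflect_def)
  then show "to_sphere d (reflect d x) i = x i"
    using assms by (simp add: to_sphere_def topspace_nsphere)
qed

lemma l1_norm_reflect_pos:
  assumes "0 < d" "x \<in> topspace (nsphere (d - 1))"
  shows "0 < l1_norm d (reflect d x)"
proof -
  have "0 < (\<Sum>i<d. (x i)\<^sup>2)" using assms by (simp add: topspace_nsphere)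
  moreover have "(\<Sum>i<d. (x i)\<^sup>2) = 0" if "\<forall>j<d. x j = 0"
    using that by simp
  ultimately have "\<not> (\<forall>j<d. x j = 0)" by fastforce
  then obtain j where "j < d" "x j \<noteq> 0" by blast
  then have "reflect d x j \<noteq> 0 \<or> reflect d x 0 \<noteq> 0"
    using assms(1) by (auto simp: reflect_def)
  then show ?thesis using \<open>j < d\<close> assms(1) l1_norm_pos_iff by blast
qed

lemma to_sphere_negative_const:
  assumes "0 < d" "0 < c" "\<And>i. i < d \<Longrightarrow> y i = - c"
  shows "to_sphere d y = (\<lambda>i. if i = 0 then 1 else 0)"
proof -
  have r: "reflect d y i = (if i = 0 then c else 0)" for i
    using assms by (auto simp: reflect_def)
  have "(\<Sum>j<d. (reflect d y j)\<^sup>2) = (\<Sum>j<d. if j = 0 then c\<^sup>2 else 0)"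
    by (intro sum.cong) (auto simp: r)
  then have "(\<Sum>j<d. (reflect d y j)\<^sup>2) = c\<^sup>2" using assms(1) by simp
  then show ?thesis using assms(2) by (simp add: to_sphere_def[abs_def] r fun_eq_iff)
qed

lemma continuous_map_to_sphere:
  assumes d: "0 < d"
    and cont: "\<And>i. i < d \<Longrightarrow> continuous_map X euclideanreal (\<lambda>x. z x i)"
    and pos: "\<And>x. x \<in> topspace X \<Longrightarrow> 0 < l1_norm d (z x)"
  shows "continuous_map X (nsphere (d - 1)) (\<lambda>x. to_sphere d (z x))"
proof -
  have r: "continuous_map X euclideanreal (\<lambda>x. reflect d (z x) i)" for i
    using d cont by (auto simp: reflect_def intro!: continuous_intros)
  have "continuous_map X euclideanreal (\<lambda>x. to_sphere d (z x) i)" for i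
    unfolding to_sphere_def
    by (intro continuous_map_real_divide r continuous_map_sqrt continuous_map_sum
        continuous_map_real_pow) (use sum_squares_reflect_pos pos in force)+
  moreover have "to_sphere d (z x) \<in> topspace (nsphere (d - 1))" if "x \<in> topspace X" for x
    using to_sphere_in_nsphere[OF d pos[OF that]] .
  ultimately show ?thesis
    by (auto simp: nsphere continuous_map_in_subtopology continuous_map_componentwise_UNIV)
qed

section \<open>Pushing towards the negative diagonal\<close>
text \<open>The segment from a nonzero \<open>y\<close> to \<open>(-1, \<dots>, -1)\<close> meets the origin only if \<open>y\<close> is a positive multiple of
\<open>(1, \<dots>, 1)\<close>. The cut-off below vanishes exactly at the point \<open>(1/d, \<dots>, 1/d)\<close> of that kind on the unit
sphere of the \<open>l1\<close> norm, and it equals \<open>1\<close> as soon as some coordinate is not positive.\<close>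
definition push_amount :: "nat \<Rightarrow> (nat \<Rightarrow> real) \<Rightarrow> real" where
  "push_amount d y = min 1 (\<Sum>i<d. \<bar>real d * y i - 1\<bar>)"

text \<open>The point at time \<open>s * push_amount d y\<close> on the segment from \<open>y\<close> to \<open>(-1, \<dots>, -1)\<close>. At \<open>s = 1\<close> every
\<open>y\<close> with a nonpositive coordinate has arrived at \<open>(-1, \<dots>, -1)\<close>, while the barycentre
\<open>(1/d, \<dots>, 1/d)\<close> of the positive facet has not moved.\<close>
definition push :: "nat \<Rightarrow> real \<Rightarrow> (nat \<Rightarrow> real) \<Rightarrow> nat \<Rightarrow> real" where
  "push d s y i = (1 - s * push_amount d y) * y i - s * push_amount d y"

lemma push_amount_bounds: "0 \<le> push_amount d y" "push_amount d y \<le> 1"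
  by (auto simp: push_amount_def sum_nonneg)

lemma push_amount_eq_1:
  assumes "i < d" "y i \<le> 0"
  shows "push_amount d y = 1"
proof -
  have "1 \<le> \<bar>real d * y i - 1\<bar>"
    using assms mult_nonneg_nonpos[of "real d" "y i"] by linarith
  also have "\<dots> \<le> (\<Sum>i<d. \<bar>real d * y i - 1\<bar>)"
    using assms(1) by (intro member_le_sum) auto
  finally show ?thesis by (simp add: push_amount_def)
qed

lemma push_0: "push d 0 y = y"
  by (simp add: push_def fun_eq_iff)

lemma push_cong: "(\<And>i. i < d \<Longrightarrow> y i = y' i) \<Longrightarrow> i < d \<Longrightarrow> push d s y i = push d s y' i"
  by (simp add: push_def push_amount_def)

lemma push_pos_imp_pos:
  assumes "s \<in> {0..1}" "0 < push d s y i"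
  shows "0 < y i"
proof (rule ccontr)
  assume "\<not> 0 < y i"
  moreover have "0 \<le> s * push_amount d y" "s * push_amount d y \<le> 1"
    using assms(1) push_amount_bounds by (auto simp: mult_le_one)
  ultimately have "(1 - s * push_amount d y) * y i - s * push_amount d y \<le> 0"
    by (smt (verit) mult_nonneg_nonpos)
  then show False using assms(2) by (simp add: push_def)
qed

text \<open>If the push reaches the origin, then all coordinates of \<open>y\<close> are equal and positive, hence equal to
\<open>1/d\<close>. But there the cut-off is \<open>0\<close> and the point does not move.\<close>
lemma l1_norm_push_pos:
  assumes s: "s \<in> {0..1}" and y: "l1_norm d y = 1"
  shows "0 < l1_norm d (push d s y)"
proof (rule ccontr)
  assume "\<not> ?thesis"
  then have zero: "push d s y i = 0" if "i < d" for i
    using that l1_norm_pos_iff by blast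
  define c where "c = s * push_amount d y"
  have c: "0 \<le> c" "(1 - c) * y i = c" if "i < d" for i
    using s push_amount_bounds zero[OF that] by (auto simp: c_def push_def)
  have "d \<noteq> 0" using y by (metis l1_norm_def lessThan_0 sum.empty zero_neq_one)
  show False
  proof (cases "c = 0")
    case True
    then show False using c y by (simp add: l1_norm_def)
  next
    case False
    then have "0 < c" "c \<noteq> 1" using c \<open>d \<noteq> 0\<close> by (fastforce, force)
    then have yi: "y i = c / (1 - c)" if "i < d" for i
      using c(2)[OF that] by (simp add: field_simps)
    then have "l1_norm d y = real d * \<bar>c / (1 - c)\<bar>"
      by (simp add: l1_norm_def)
    with y have abs: "real d * \<bar>c / (1 - c)\<bar> = 1" by (simp only:)
    have "c \<le> 1" unfolding c_def using s push_amount_bounds by (simp add: mult_le_one)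
    then have "0 \<le> c / (1 - c)" using \<open>0 < c\<close> by simp
    then have eq: "real d * (c / (1 - c)) = 1"
      using abs by (simp only: abs_of_nonneg)
    have "\<bar>real d * y i - 1\<bar> = 0" if "i < d" for i
      unfolding yi[OF that] eq by simp
    then have "push_amount d y = 0"
      by (simp add: push_amount_def)
    then show False using False by (simp add: c_def)
  qed
qed

lemma push_of_nonpositive:
  assumes "j < d" "y j \<le> 0"
  shows "push d s y i = (1 - s) * y i - s"
  using push_amount_eq_1[of j d y] assms by (simp add: push_def)

lemma continuous_map_push:
  assumes "\<And>i. i < d \<Longrightarrow> continuous_map X euclideanreal (\<lambda>x. y x i)" "i < d"
    and "continuous_map X euclideanreal s"
  shows "continuous_map X euclideanreal (\<lambda>x. push d (s x) (y x) i)"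
    and "continuous_map X euclideanreal (\<lambda>x. push_amount d (y x))"
  using assms unfolding push_def push_amount_def by (auto intro!: continuous_intros)


section \<open>Joins of discrete sets\<close>
text \<open>The faces meet every fibre of \<open>\<beta>\<close> in at most one point, so this complex is the join of the fibres,
each regarded as a discrete set.\<close>
definition transversal_complex :: "'a set \<Rightarrow> ('a \<Rightarrow> 'b) \<Rightarrow> 'a set set" where
  "transversal_complex V \<beta> = {I. I \<subseteq> V \<and> inj_on \<beta> I}"

text \<open>Each block (fibre of \<open>\<beta>\<close>) gets a distinguished centre \<open>c i\<close>. A block is pictured as a star: a negative
half-line towards the centre and, for every other vertex, a positive half-line, all glued at the
origin. The realization is then the unit sphere of the \<open>l1\<close> norm in the product of these \<open>d\<close> stars, and
choosing one positive half-line in each star singles out a copy of \<open>\<real>\<^sup>d\<close> with its unit sphere.\<close>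
locale blocks =
  fixes V :: "'a set" and \<beta> :: "'a \<Rightarrow> nat" and d :: nat and c :: "nat \<Rightarrow> 'a"
  assumes finite_V: "finite V" and d_pos: "0 < d"
    and \<beta>_less: "v \<in> V \<Longrightarrow> \<beta> v < d"
    and c_in: "i < d \<Longrightarrow> c i \<in> V" and \<beta>_c: "i < d \<Longrightarrow> \<beta> (c i) = i"
begin

definition points :: "('a \<Rightarrow> real) set" where
  "points = barycentric_points V (transversal_complex V \<beta>)"

definition legs :: "nat \<Rightarrow> 'a set" where
  "legs i = {v \<in> V. \<beta> v = i \<and> v \<noteq> c i}"

text \<open>The signed position on each star. It forgets on which of the positive half-lines the point lies.\<close>
definition coords :: "('a \<Rightarrow> real) \<Rightarrow> nat \<Rightarrow> real" where
  "coords t i = sum t (legs i) - t (c i)"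

text \<open>The point of the realization with signed coordinates \<open>z\<close>, up to positive scaling, where \<open>\<epsilon>\<close> names the
half-lines that carry the positive coordinates. For fixed \<open>\<epsilon>\<close> this embeds a sphere.\<close>
definition place :: "(nat \<Rightarrow> 'a) \<Rightarrow> (nat \<Rightarrow> real) \<Rightarrow> 'a \<Rightarrow> real" where
  "place \<epsilon> z v =
     (if v \<in> V then ((if v = c (\<beta> v) then max 0 (- z (\<beta> v)) else 0)
                     + (if v = \<epsilon> (\<beta> v) then max 0 (z (\<beta> v)) else 0)) / l1_norm d z
      else 0)"

lemma finite_legs: "finite (legs i)"
  using finite_V by (simp add: legs_def)

lemma block_eq: "i < d \<Longrightarrow> {v \<in> V. \<beta> v = i} = insert (c i) (legs i)"
  using c_in \<beta>_c by (auto simp: legs_def)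

lemma c_notin_legs: "c i \<notin> legs i"
  by (simp add: legs_def)

lemma sum_V_blocks: "sum f V = (\<Sum>i<d. f (c i) + sum f (legs i))"
  for f :: "'a \<Rightarrow> real"
proof -
  have "sum f V = (\<Sum>i<d. sum f {v \<in> V. \<beta> v = i})"
    using finite_V \<beta>_less by (intro sum.group[symmetric]) auto
  also have "\<dots> = (\<Sum>i<d. f (c i) + sum f (legs i))"
    by (rule sum.cong) (simp_all add: block_eq finite_legs c_notin_legs)
  finally show ?thesis .
qed

lemma complex_Union: "\<Union>(transversal_complex V \<beta>) \<subseteq> V"
  by (auto simp: transversal_complex_def)

lemmas continuous_into = continuous_map_into_realization[OF finite_V complex_Union, folded points_def]
lemmas homotopic_into = homotopic_in_realization[OF finite_V complex_Union, folded points_def]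

lemma topspace_points: "topspace (geometric_realization (transversal_complex V \<beta>)) = points"
  unfolding points_def by (rule topspace_geometric_realization[OF finite_V complex_Union])

lemma points_nonneg: "t \<in> points \<Longrightarrow> 0 \<le> t v"
  by (simp add: points_def barycentric_points_def)

lemma points_unique:
  assumes "t \<in> points" "t v \<noteq> 0" "t w \<noteq> 0" "\<beta> v = \<beta> w"
  shows "v = w"
  using assms by (auto simp: points_def barycentric_points_def transversal_complex_def inj_on_def)

lemma points_outside: "t \<in> points \<Longrightarrow> v \<notin> V \<Longrightarrow> t v = 0"
  by (auto simp: points_def barycentric_points_def transversal_complex_def)

lemma coords_leg:
  assumes t: "t \<in> points" and v: "v \<in> legs i" "t v \<noteq> 0"
  shows "coords t i = t v"
proof -
  have "t w = 0" if "w \<in> insert (c i) (legs i)" "w \<noteq> v" "i < d" for w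
  proof (rule ccontr)
    assume "t w \<noteq> 0"
    moreover have "\<beta> v = \<beta> w" using that v(1) \<beta>_c by (auto simp: legs_def)
    ultimately show False using points_unique[OF t v(2)] that(2) by blast
  qed
  moreover have "i < d" using v \<beta>_less by (auto simp: legs_def)
  ultimately have zero: "t w = 0" if "w \<in> insert (c i) (legs i)" "w \<noteq> v" for w
    using that by blast
  have "t (c i) = 0" using zero[of "c i"] v(1) by (auto simp: legs_def)
  moreover have "sum t (legs i) = sum t {v}"
    using v(1) finite_legs zero by (intro sum.mono_neutral_right) auto
  ultimately show ?thesis by (simp add: coords_def)
qed

lemma coords_pos_leg:
  assumes "t \<in> points" "0 < coords t i"
  obtains v where "v \<in> legs i" "t v \<noteq> 0"
proof -
  have "0 < sum t (legs i)" using assms points_nonneg[of t "c i"] by (simp add: coords_def)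
  then have "\<not> (\<forall>v\<in>legs i. t v = 0)" by (metis less_irrefl sum.neutral)
  then show thesis using that by blast
qed

lemma abs_coords:
  assumes t: "t \<in> points"
  shows "\<bar>coords t i\<bar> = t (c i) + sum t (legs i)"
proof (cases "\<exists>v\<in>legs i. t v \<noteq> 0")
  case True
  then obtain v where v: "v \<in> legs i" "t v \<noteq> 0" by blast
  have "0 \<le> coords t i" using coords_leg[OF t v] points_nonneg[OF t] by simp
  moreover have "t (c i) = 0"
  proof (rule ccontr)
    assume "t (c i) \<noteq> 0"
    moreover have "i < d" using v \<beta>_less by (auto simp: legs_def)
    ultimately have "v = c i" using points_unique[OF t v(2)] v(1) \<beta>_c by (auto simp: legs_def)
    then show False using v(1) c_notin_legs by blast
  qed
  ultimately show ?thesis by (simp add: coords_def)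
next
  case False
  then have "sum t (legs i) = 0" by simp
  then show ?thesis using points_nonneg[OF t] by (simp add: coords_def)
qed

lemma l1_norm_coords: "t \<in> points \<Longrightarrow> l1_norm d (coords t) = 1"
  by (simp add: l1_norm_def abs_coords flip: sum_V_blocks)
    (simp add: points_def barycentric_points_def)

lemma place_c: "i < d \<Longrightarrow> \<epsilon> i \<in> legs i \<or> z i \<le> 0 \<Longrightarrow> place \<epsilon> z (c i) = max 0 (- z i) / l1_norm d z"
proof -
  assume i: "i < d" and \<epsilon>: "\<epsilon> i \<in> legs i \<or> z i \<le> 0"
  have "c i = \<epsilon> i \<Longrightarrow> max 0 (z i) = 0" using \<epsilon> c_notin_legs[of i] by auto
  then show ?thesis using c_in[OF i] \<beta>_c[OF i] by (cases "c i = \<epsilon> i") (auto simp: place_def)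
qed

lemma sum_place_legs:
  assumes "i < d" "\<epsilon> i \<in> legs i \<or> z i \<le> 0"
  shows "sum (place \<epsilon> z) (legs i) = max 0 (z i) / l1_norm d z"
proof -
  have "sum (place \<epsilon> z) (legs i) = (\<Sum>v\<in>legs i. if v = \<epsilon> i then max 0 (z i) / l1_norm d z else 0)"
    by (intro sum.cong) (auto simp: place_def legs_def)
  also have "\<dots> = max 0 (z i) / l1_norm d z"
    using assms finite_legs by auto
  finally show ?thesis .
qed

lemma coords_place:
  assumes "i < d" "\<epsilon> i \<in> legs i \<or> z i \<le> 0"
  shows "coords (place \<epsilon> z) i = z i / l1_norm d z"
  using assms by (auto simp: coords_def sum_place_legs place_c max_def)

lemma place_in_points:
  assumes z: "0 < l1_norm d z" and \<epsilon>: "\<And>i. i < d \<Longrightarrow> \<epsilon> i \<in> legs i \<or> z i \<le> 0"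
  shows "place \<epsilon> z \<in> points"
proof -
  have nonneg: "0 \<le> place \<epsilon> z v" for v
    using z by (simp add: place_def)
  have "sum (place \<epsilon> z) V = (\<Sum>i<d. \<bar>z i\<bar> / l1_norm d z)"
    unfolding sum_V_blocks
  proof (rule sum.cong)
    fix i assume "i \<in> {..<d}"
    then have "place \<epsilon> z (c i) + sum (place \<epsilon> z) (legs i)
        = (max 0 (- z i) + max 0 (z i)) / l1_norm d z"
      using \<epsilon>[of i] by (simp add: place_c sum_place_legs add_divide_distrib)
    also have "max 0 (- z i) + max 0 (z i) = \<bar>z i\<bar>" by simp
    finally show "place \<epsilon> z (c i) + sum (place \<epsilon> z) (legs i) = \<bar>z i\<bar> / l1_norm d z" .
  qed simp
  also have "\<dots> = 1"
    using z by (simp add: l1_norm_def flip: sum_divide_distrib)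
  finally have "sum (place \<epsilon> z) V = 1" .
  moreover have "inj_on \<beta> {v. place \<epsilon> z v \<noteq> 0}"
  proof (rule inj_onI)
    show "v = w" if "v \<in> {v. place \<epsilon> z v \<noteq> 0}" "w \<in> {v. place \<epsilon> z v \<noteq> 0}" "\<beta> v = \<beta> w" for v w
      using that by (auto simp: place_def max_def split: if_splits)
  qed
  moreover have "{v. place \<epsilon> z v \<noteq> 0} \<subseteq> V"
    by (rule subsetI, rule ccontr) (simp add: place_def)
  ultimately show ?thesis
    using nonneg by (simp add: points_def barycentric_points_def transversal_complex_def)
qed

lemma place_scale:
  assumes "0 < r"
    and "\<And>i. i < d \<Longrightarrow> z' i = z i / r"
  shows "place \<epsilon> z' = place \<epsilon> z"
proof
  fix v
  have "l1_norm d z' = l1_norm d z / r"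
    using assms by (simp add: l1_norm_def flip: sum_divide_distrib)
  moreover have "max 0 (x / r) = max 0 x / r" for x
    using assms(1) by (simp add: max_def zero_le_divide_iff divide_le_0_iff)
  from this[of "- z (\<beta> v)"] this[of "z (\<beta> v)"]
  have "v \<in> V \<Longrightarrow> max 0 (- z' (\<beta> v)) = max 0 (- z (\<beta> v)) / r"
    "v \<in> V \<Longrightarrow> max 0 (z' (\<beta> v)) = max 0 (z (\<beta> v)) / r"
    using \<beta>_less assms(2) by simp_all
  moreover have "(a / r + b / r) / (n / r) = (a + b) / n" for a b n
    using assms(1) by (simp flip: add_divide_distrib)
  ultimately show "place \<epsilon> z' v = place \<epsilon> z v"
    using assms(1) by (simp add: place_def)
qed

lemma place_cong:
  assumes "\<And>i. i < d \<Longrightarrow> 0 < z i \<Longrightarrow> \<epsilon> i = \<epsilon>' i"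
  shows "place \<epsilon> z = place \<epsilon>' z"
proof
  fix v
  show "place \<epsilon> z v = place \<epsilon>' z v"
    using assms[of "\<beta> v"] \<beta>_less[of v] by (cases "0 < z (\<beta> v)") (auto simp: place_def)
qed

text \<open>The push, performed on the product of stars. The formula is written without naming the positive
half-lines that carry \<open>t\<close>, since these do not depend continuously on \<open>t\<close>; the next lemma recovers
them.\<close>
definition flow :: "real \<Rightarrow> ('a \<Rightarrow> real) \<Rightarrow> 'a \<Rightarrow> real" where
  "flow s t v =
     (if v \<in> V then
        (if v = c (\<beta> v) then max 0 (- push d s (coords t) (\<beta> v))
         else max 0 ((1 - s * push_amount d (coords t)) * t v - s * push_amount d (coords t)))
        / l1_norm d (push d s (coords t))
      else 0)"

lemma flow_eq_place:
  assumes t: "t \<in> points" and s: "s \<in> {0..1}"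
    and \<epsilon>: "\<And>i. i < d \<Longrightarrow> 0 < coords t i \<Longrightarrow> \<epsilon> i \<in> legs i \<and> t (\<epsilon> i) \<noteq> 0"
  shows "flow s t = place \<epsilon> (push d s (coords t))"
proof
  fix v
  let ?z = "push d s (coords t)" and ?a = "s * push_amount d (coords t)"
  have a: "0 \<le> ?a" using s push_amount_bounds by simp
  show "flow s t v = place \<epsilon> ?z v"
  proof (cases "v \<in> V \<and> v \<noteq> c (\<beta> v)")
    case True
    then have v: "v \<in> legs (\<beta> v)" "\<beta> v < d" using \<beta>_less by (auto simp: legs_def)
    have "max 0 ((1 - ?a) * t v - ?a) = (if v = \<epsilon> (\<beta> v) then max 0 (?z (\<beta> v)) else 0)"
    proof (cases "t v = 0")
      case True
      then have "0 < coords t (\<beta> v) \<Longrightarrow> v \<noteq> \<epsilon> (\<beta> v)" using \<epsilon> v by metis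
      then have "v = \<epsilon> (\<beta> v) \<Longrightarrow> ?z (\<beta> v) \<le> 0"
        using push_pos_imp_pos[OF s] by (meson not_le)
      then show ?thesis using True a by auto
    next
      case False
      have tv: "coords t (\<beta> v) = t v" using coords_leg[OF t v(1) False] .
      then have "0 < coords t (\<beta> v)" using False points_nonneg[OF t, of v] by simp
      then have "\<epsilon> (\<beta> v) \<in> legs (\<beta> v)" "t (\<epsilon> (\<beta> v)) \<noteq> 0" using \<epsilon> v by auto
      then have "v = \<epsilon> (\<beta> v)"
        using points_unique[OF t False] by (simp add: legs_def)
      then show ?thesis by (simp add: push_def tv)
    qed
    then show ?thesis using True by (simp add: flow_def place_def)
  next
    case False
    have "max 0 (?z (\<beta> v)) = 0" if "v \<in> V" "v = \<epsilon> (\<beta> v)"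
    proof -
      have "v = c (\<beta> v)" "\<beta> v < d" using False that \<beta>_less by auto
      then have "\<not> 0 < coords t (\<beta> v)" using \<epsilon>[of "\<beta> v"] that c_notin_legs by metis
      then show ?thesis using push_pos_imp_pos[OF s] by (metis max.absorb1 not_le)
    qed
    then show ?thesis using False by (auto simp: flow_def place_def)
  qed
qed

definition carrier_leg :: "('a \<Rightarrow> real) \<Rightarrow> nat \<Rightarrow> 'a" where
  "carrier_leg t i = (SOME v. v \<in> legs i \<and> t v \<noteq> 0)"

lemma carrier_leg:
  assumes "t \<in> points" "0 < coords t i"
  shows "carrier_leg t i \<in> legs i \<and> t (carrier_leg t i) \<noteq> 0"
  unfolding carrier_leg_def using coords_pos_leg[OF assms] by (metis (mono_tags, lifting) someI_ex)

lemma flow_in_points: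
  assumes "t \<in> points" "s \<in> {0..1}"
  shows "flow s t \<in> points"
proof -
  have "flow s t = place (carrier_leg t) (push d s (coords t))"
    using assms carrier_leg by (intro flow_eq_place) auto
  moreover have "carrier_leg t i \<in> legs i \<or> push d s (coords t) i \<le> 0" for i
    using carrier_leg[OF assms(1)] push_pos_imp_pos[OF assms(2)] by (meson not_le)
  ultimately show ?thesis
    using place_in_points l1_norm_push_pos[OF assms(2) l1_norm_coords[OF assms(1)]] by simp
qed

lemma flow_0:
  assumes t: "t \<in> points"
  shows "flow 0 t = t"
proof
  fix v
  show "flow 0 t v = t v"
  proof (cases "v \<in> V \<and> v = c (\<beta> v)")
    case True
    have "max 0 (- coords t (\<beta> v)) = t v"
    proof -
      have "\<bar>coords t (\<beta> v)\<bar> = t v + sum t (legs (\<beta> v))" "coords t (\<beta> v) = sum t (legs (\<beta> v)) - t v"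
        using True abs_coords[OF t, of "\<beta> v"] by (auto simp: coords_def)
      then show ?thesis using points_nonneg[OF t, of v] sum_nonneg[of "legs (\<beta> v)" t] points_nonneg[OF t]
        by (auto simp: max_def)
    qed
    then show ?thesis using True l1_norm_coords[OF t] by (simp add: flow_def push_0)
  next
    case False
    then show ?thesis using l1_norm_coords[OF t] points_nonneg[OF t, of v] points_outside[OF t, of v]
      by (auto simp: flow_def push_0)
  qed
qed

lemma continuous_map_coords:
  "continuous_map (geometric_realization K) euclideanreal (\<lambda>t. coords t i)"
  unfolding coords_def by (intro continuous_intros continuous_map_coordinate) (auto simp: finite_legs)

lemma continuous_map_flow:
  assumes K: "X = geometric_realization (transversal_complex V \<beta>)"
  shows "continuous_map (prod_topology (top_of_set {0..1}) X) euclideanreal (\<lambda>p. flow (fst p) (snd p) v)"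
proof (cases "v \<in> V")
  case True
  let ?P = "prod_topology (top_of_set {0..1::real}) X"
  have fst: "continuous_map ?P euclideanreal fst"
    by (rule continuous_map_homotopy_projections)
  have coords: "continuous_map ?P euclideanreal (\<lambda>p. coords (snd p) i)" for i
    unfolding K by (intro continuous_map_homotopy_projections continuous_map_coords)
  have push: "continuous_map ?P euclideanreal (\<lambda>p. push d (fst p) (coords (snd p)) i)" if "i < d" for i
    using continuous_map_push(1)[of d ?P "\<lambda>p. coords (snd p)" i fst] coords that fst by simp
  have amount: "continuous_map ?P euclideanreal (\<lambda>p. push_amount d (coords (snd p)))"
    using continuous_map_push(2)[of d ?P "\<lambda>p. coords (snd p)" 0 fst] coords d_pos fst by simp
  have t: "continuous_map ?P euclideanreal (\<lambda>p. snd p v)"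
    unfolding K by (intro continuous_map_homotopy_projections continuous_map_coordinate)
  have norm: "continuous_map ?P euclideanreal (\<lambda>p. l1_norm d (push d (fst p) (coords (snd p))))"
    unfolding l1_norm_def by (intro continuous_map_sum continuous_map_real_abs push) auto
  have norm_nz: "l1_norm d (push d (fst p) (coords (snd p))) \<noteq> 0" if "p \<in> topspace ?P" for p
    using that l1_norm_push_pos[OF _ l1_norm_coords, of "fst p" "snd p"]
    by (auto simp: K topspace_points)
  have numerator: "continuous_map ?P euclideanreal (\<lambda>p. if v = c (\<beta> v)
      then max 0 (- push d (fst p) (coords (snd p)) (\<beta> v))
      else max 0 ((1 - fst p * push_amount d (coords (snd p))) * snd p v
        - fst p * push_amount d (coords (snd p))))"
  proof (cases "v = c (\<beta> v)")
    case True
    have "continuous_map ?P euclideanreal (\<lambda>p. max 0 (- push d (fst p) (coords (snd p)) (\<beta> v)))"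
      by (intro continuous_map_real_max continuous_map_minus push \<beta>_less[OF \<open>v \<in> V\<close>]) simp
    then show ?thesis by (simp only: if_P[OF True])
  next
    case False
    have "continuous_map ?P euclideanreal (\<lambda>p. max 0 ((1 - fst p * push_amount d (coords (snd p))) * snd p v
        - fst p * push_amount d (coords (snd p))))"
      by (intro continuous_map_real_max continuous_map_diff continuous_map_real_mult fst amount t) simp_all
    then show ?thesis by (simp only: if_not_P[OF False])
  qed
  show ?thesis
    unfolding flow_def if_P[OF True]
    by (rule continuous_map_real_divide[OF numerator norm]) (rule norm_nz)
next
  case False
  then show ?thesis by (simp add: flow_def)
qed

text \<open>There is one sphere for every choice \<open>h j\<close> of a leg in each block, embedded by \<open>place (h j)\<close>. All these
spheres share the barycentre of the face of centres, so together they give a map \<open>g\<close> from the wedge to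
the realization. In the other direction \<open>f\<close> stretches the open facet spanned by \<open>h j\<close> over the sphere \<open>j\<close>
by means of \<open>push d 1\<close> and sends everything else, where some coordinate is nonpositive, to the base
point. Then \<open>g \<circ> f\<close> is the time-one map of the flow, and \<open>f \<circ> g\<close> is the time-one map of the push on each
sphere of the wedge; both are homotopic to the identity through the earlier times.\<close>
lemma wedge_decomposition:
  assumes legs: "\<And>i. i < d \<Longrightarrow> legs i \<noteq> {}"
  shows "geometric_realization (transversal_complex V \<beta>)
    homotopy_equivalent_space wedge_of_spheres (\<Prod>i<d. card (legs i)) (d - 1)"
proof -
  let ?X = "geometric_realization (transversal_complex V \<beta>)"
  define k where "k = (\<Prod>i<d. card (legs i))"
  define E where "E = PiE {..<d} legs"
  have "finite E" "card E = k"
    by (simp_all add: E_def k_def finite_PiE finite_legs card_PiE)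
  then obtain h where h: "bij_betw h {..<k} E"
    by (metis atLeast0LessThan ex_bij_betw_nat_finite)
  have h_legs: "h j i \<in> legs i" if "j < k" "i < d" for i j
    using bij_betw_apply[OF h, of j] that by (auto simp: E_def)
  have k_pos: "0 < k"
    using legs finite_legs by (auto simp: k_def card_gt_0_iff intro!: prod_pos)
  let ?N = "nsphere (d - 1)" and ?W = "wedge_of_spheres k (d - 1)"
  let ?S = "sum_topology (\<lambda>_. ?N) {..<k}"
  obtain q where q: "quotient_map ?S ?W q"
    and q_eq: "\<And>i x j y. i < k \<Longrightarrow> x \<in> topspace ?N \<Longrightarrow> j < k \<Longrightarrow> y \<in> topspace ?N \<Longrightarrow>
        q (i, x) = q (j, y) \<longleftrightarrow> i = j \<and> x = y \<or> x = sphere_base \<and> y = sphere_base"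
    by (rule wedge_of_spheres_quotient_map[of "d - 1" k], rule that)
  have base: "sphere_base \<in> topspace ?N" by (rule in_topspace_nsphere)
  have q_base: "q (i, sphere_base) = q (j, sphere_base)" if "i < k" "j < k" for i j
    using q_eq that base by blast
  have q_cont: "continuous_map ?N ?W (\<lambda>x. q (j, x))" if "j < k" for j
    using continuous_map_compose[OF continuous_map_sum_injection quotient_imp_continuous_map[OF q], of j] that
    by (simp add: o_def)

  define \<sigma> where "\<sigma> t = to_sphere d (push d 1 (coords t))" for t
  \<comment> \<open>the index of the open facet containing \<open>t\<close>; the default \<open>0\<close> is harmless, since then \<open>\<sigma> t\<close> is the base point\<close>
  define \<kappa> where "\<kappa> t = (if \<exists>j<k. \<forall>i<d. t (h j i) \<noteq> 0 then SOME j. j < k \<and> (\<forall>i<d. t (h j i) \<noteq> 0) else 0)" for t :: "'a \<Rightarrow> real"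
  define f where "f t = q (\<kappa> t, \<sigma> t)" for t
  have \<kappa>_less: "\<kappa> t < k" for t
    unfolding \<kappa>_def using k_pos by (auto intro: someI2_ex)
  have \<sigma>_in: "\<sigma> t \<in> topspace ?N" if "t \<in> points" for t
    unfolding \<sigma>_def using that
    by (intro to_sphere_in_nsphere d_pos l1_norm_push_pos l1_norm_coords) auto
  have \<sigma>_base: "\<sigma> t = sphere_base" if "i < d" "coords t i \<le> 0" for t i
    unfolding \<sigma>_def using that
    by (intro to_sphere_negative_const[where c = 1] d_pos) (auto simp: push_of_nonpositive)
  have \<kappa>_eq: "\<kappa> t = j" if t: "t \<in> points" and j: "j < k" "\<And>i. i < d \<Longrightarrow> t (h j i) \<noteq> 0" for t j
  proof -
    have "j' = j" if j': "j' < k" "\<forall>i<d. t (h j' i) \<noteq> 0" for j'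
    proof -
      have "h j' i = h j i" if "i < d" for i
        using points_unique[OF t, of "h j' i" "h j i"] j(2)[OF that] j'(2) that
          h_legs[OF j(1) that] h_legs[OF j'(1) that] by (auto simp: legs_def)
      moreover have "h j \<in> E" "h j' \<in> E" using bij_betw_apply[OF h] j j' by auto
      ultimately have "h j' = h j" unfolding E_def by (intro PiE_ext) auto
      then show ?thesis using bij_betw_imp_inj_on[OF h] j j' by (auto dest: inj_onD)
    qed
    moreover have ex: "\<exists>j<k. \<forall>i<d. t (h j i) \<noteq> 0" using j by blast
    ultimately show ?thesis
      unfolding \<kappa>_def if_P[OF ex] using someI_ex[OF ex] by blast
  qed
  have f_facet: "f t = q (j, \<sigma> t)"
    if t: "t \<in> points" and j: "j < k" "\<And>v. v \<in> V \<Longrightarrow> v \<notin> h j ` {..<d} \<Longrightarrow> t v = 0" for t j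
  proof (cases "\<forall>i<d. t (h j i) \<noteq> 0")
    case True
    then show ?thesis using \<kappa>_eq[OF t j(1)] by (simp add: f_def)
  next
    case False
    then obtain i where i: "i < d" "t (h j i) = 0" by blast
    have "t v = 0" if "v \<in> legs i" for v
    proof (cases "v \<in> h j ` {..<d}")
      case True
      then obtain i' where i': "i' < d" "v = h j i'" by blast
      then have "i' = i" using h_legs[OF j(1) i'(1)] that by (simp add: legs_def)
      then show ?thesis using i i' by simp
    next
      case False
      then show ?thesis using j(2) that by (simp add: legs_def)
    qed
    then have "coords t i \<le> 0" using points_nonneg[OF t] by (simp add: coords_def)
    then have "\<sigma> t = sphere_base" using \<sigma>_base i by blast
    then show ?thesis using q_base[OF \<kappa>_less j(1)] by (simp add: f_def)
  qed
  have f_base: "f t = q (0, \<sigma> t)" if "i < d" "coords t i \<le> 0" for t i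
    using \<sigma>_base[OF that] q_base[OF \<kappa>_less k_pos] by (simp add: f_def)
  have facet_exists: "\<exists>j<k. (\<forall>i<d. t (h j i) \<noteq> 0) \<and> (\<forall>v\<in>V. v \<notin> h j ` {..<d} \<longrightarrow> t v = 0)"
    if t: "t \<in> points" and pos: "\<And>i. i < d \<Longrightarrow> 0 < coords t i" for t
  proof -
    have "restrict (carrier_leg t) {..<d} \<in> E"
      using carrier_leg[OF t pos] by (auto simp: E_def)
    then obtain j where j: "j < k" "h j = restrict (carrier_leg t) {..<d}"
      using h by (metis bij_betw_iff_bijections lessThan_iff)
    then have nz: "t (h j i) \<noteq> 0" if "i < d" for i
      using carrier_leg[OF t pos] that by simp
    have "t v = 0" if "v \<in> V" "v \<notin> h j ` {..<d}" for v
    proof (rule ccontr)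
      assume "t v \<noteq> 0"
      moreover have "\<beta> (h j (\<beta> v)) = \<beta> v" "\<beta> v < d"
        using h_legs[OF j(1)] \<beta>_less that(1) by (auto simp: legs_def)
      ultimately have "v = h j (\<beta> v)" using points_unique[OF t] nz by metis
      then show False using that \<open>\<beta> v < d\<close> by blast
    qed
    then show ?thesis using j nz by blast
  qed
  have \<sigma>_cont: "continuous_map ?X ?N \<sigma>"
    unfolding \<sigma>_def[abs_def]
  proof (rule continuous_map_to_sphere[OF d_pos])
    show "continuous_map ?X euclideanreal (\<lambda>t. push d 1 (coords t) i)" if "i < d" for i
      using continuous_map_push(1)[of d ?X coords i "\<lambda>_. 1"] that continuous_map_coords by simp
    show "0 < l1_norm d (push d 1 (coords t))" if "t \<in> topspace ?X" for t
      using that by (intro l1_norm_push_pos l1_norm_coords) (auto simp: topspace_points)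
  qed
  \<comment> \<open>the closed facets and the set of points with a nonpositive coordinate form a finite closed cover\<close>
  have f_cont: "continuous_map ?X ?W f"
  proof (rule pasting_lemma_closed)
    let ?T = "\<lambda>j. if j < k then {t \<in> points. \<forall>v\<in>V - h j ` {..<d}. t v \<in> {0}}
      else {t \<in> points. \<exists>i<d. coords t i \<in> {..0}}"
    let ?f = "\<lambda>j t. if j < k then q (j, \<sigma> t) else q (0, \<sigma> t)"
    show "finite {..k}" by simp
    have on_T: "?f j t = f t" if "t \<in> ?T j" for t j
    proof (cases "j < k")
      case True
      then show ?thesis using that f_facet[of t j] by auto
    next
      case False
      then show ?thesis using that f_base[of _ t] by auto
    qed
    show "?f i t = ?f j t" if "t \<in> topspace ?X \<inter> ?T i \<inter> ?T j" for i j t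
    proof (rule trans[OF on_T on_T[symmetric]])
      show "t \<in> ?T i" using that by (rule IntD2[OF IntD1])
      show "t \<in> ?T j" using that by (rule IntD2)
    qed
    show "\<exists>j. j \<in> {..k} \<and> t \<in> ?T j \<and> f t = ?f j t" if t: "t \<in> topspace ?X" for t
    proof -
      have "\<exists>j\<le>k. t \<in> ?T j"
      proof (cases "\<forall>i<d. 0 < coords t i")
        case True
        then obtain j where "j < k" "\<forall>v\<in>V. v \<notin> h j ` {..<d} \<longrightarrow> t v = 0"
          using facet_exists[of t] t by (auto simp: topspace_points)
        then show ?thesis using t by (intro exI[of _ j]) (auto simp: topspace_points)
      next
        case False
        then show ?thesis using t by (intro exI[of _ k]) (auto simp: topspace_points not_less)
      qed
      then obtain j where j: "j \<le> k" "t \<in> ?T j" by blast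
      then show ?thesis using on_T[OF j(2)] by (intro exI[of _ j]) simp
    qed
    fix j assume "j \<in> {..k}"
    show "closedin ?X (?T j)"
    proof (cases "j < k")
      case True
      let ?zero = "\<lambda>v. {t \<in> topspace ?X. t v \<in> {0}}"
      have "closedin ?X (?zero v)" for v
        by (rule closedin_continuous_map_preimage[OF continuous_map_coordinate]) simp
      then have "closedin ?X (\<Inter>(insert (topspace ?X) (?zero ` (V - h j ` {..<d}))))"
        by (intro closedin_Inter) auto
      also have "\<Inter>(insert (topspace ?X) (?zero ` (V - h j ` {..<d})))
          = {t \<in> topspace ?X. \<forall>v\<in>V - h j ` {..<d}. t v \<in> {0}}"
        by auto
      finally have "closedin ?X {t \<in> topspace ?X. \<forall>v\<in>V - h j ` {..<d}. t v \<in> {0}}" .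
      then show ?thesis using True by (simp add: topspace_points)
    next
      case False
      have "closedin ?X {t \<in> topspace ?X. coords t i \<in> {..0}}" for i
        by (rule closedin_continuous_map_preimage[OF continuous_map_coords]) simp
      then have "closedin ?X (\<Union>i\<in>{..<d}. {t \<in> topspace ?X. coords t i \<in> {..0}})"
        by (intro closedin_Union) auto
      moreover have "(\<Union>i\<in>{..<d}. {t \<in> topspace ?X. coords t i \<in> {..0}})
          = {t \<in> topspace ?X. \<exists>i<d. coords t i \<in> {..0}}" by blast
      ultimately show ?thesis using False by (simp add: topspace_points)
    qed
    have "continuous_map ?X ?W (?f j)"
      using continuous_map_compose[OF \<sigma>_cont q_cont, of "if j < k then j else 0"] k_pos
      by (auto simp: o_def split: if_splits)
    then show "continuous_map (subtopology ?X (?T j)) ?W (?f j)"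
      by (rule continuous_map_from_subtopology)
  qed

  define G where "G = (\<lambda>(j, x). place (h j) (reflect d x))"
  have G_in: "G (j, x) \<in> points" if "j < k" "x \<in> topspace ?N" for j x
    unfolding G_def using that l1_norm_reflect_pos[OF d_pos] h_legs by (auto intro!: place_in_points)
  have reflect_base: "reflect d sphere_base i = - 1" if "i < d" for i
    using that by (simp add: reflect_def)
  have G_base: "G (j, sphere_base) = G (j', sphere_base)" for j j'
    unfolding G_def by (auto intro!: place_cong simp: reflect_base)
  have reflect_cont: "continuous_map ?N euclideanreal (\<lambda>x. reflect d x i)" for i
    by (cases "i < d"; cases "i = 0")
      (simp_all add: reflect_def continuous_map_nsphere_projection continuous_map_diff)
  have minus_part: "continuous_map ?N euclideanreal (\<lambda>x. max 0 (- reflect d x i))"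
    and plus_part: "continuous_map ?N euclideanreal (\<lambda>x. max 0 (reflect d x i))" for i
    by (intro continuous_map_real_max continuous_map_minus reflect_cont; simp)+
  have norm_cont: "continuous_map ?N euclideanreal (\<lambda>x. l1_norm d (reflect d x))"
    unfolding l1_norm_def by (intro continuous_map_sum continuous_map_real_abs reflect_cont) auto
  have norm_nz: "l1_norm d (reflect d x) \<noteq> 0" if "x \<in> topspace ?N" for x
    using l1_norm_reflect_pos[OF d_pos that] by simp
  have G_cont: "continuous_map ?S ?X G"
  proof (rule continuous_map_from_sum_topology, rule continuous_into)
    fix j assume j: "j \<in> {..<k}"
    show "G (j, x) \<in> points" if "x \<in> topspace ?N" for x
      using G_in j that by simp
    show "continuous_map ?N euclideanreal (\<lambda>x. G (j, x) v)" for v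
    proof (cases "v \<in> V")
      case True
      have "continuous_map ?N euclideanreal (\<lambda>x. if v = c (\<beta> v) then max 0 (- reflect d x (\<beta> v)) else 0)"
        using minus_part[of "\<beta> v"] by (cases "v = c (\<beta> v)") simp_all
      moreover have "continuous_map ?N euclideanreal (\<lambda>x. if v = h j (\<beta> v) then max 0 (reflect d x (\<beta> v)) else 0)"
        using plus_part[of "\<beta> v"] by (cases "v = h j (\<beta> v)") simp_all
      ultimately show ?thesis
        unfolding G_def place_def prod.case if_P[OF True]
        by (intro continuous_map_real_divide continuous_map_add norm_cont norm_nz)
    next
      case False
      then show ?thesis by (simp add: G_def place_def)
    qed
  qed
  obtain g where g: "continuous_map ?W ?X g" and gq: "\<And>a. a \<in> topspace ?S \<Longrightarrow> g (q a) = G a"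
  proof (rule quotient_map_lift_exists[OF q G_cont])
    show "G a = G b" if ab: "a \<in> topspace ?S" "b \<in> topspace ?S" "q a = q b" for a b
    proof -
      obtain i x j y where "a = (i, x)" "b = (j, y)" by (cases a, cases b)
      then consider "a = b" | "a = (i, sphere_base)" "b = (j, sphere_base)"
        using ab q_eq[of i x j y] by auto
      then show ?thesis using G_base by cases auto
    qed
  qed (use that in blast)

  have gf: "homotopic_with (\<lambda>_. True) ?X ?X (g \<circ> f) id"
  proof (rule homotopic_with_symD, rule homotopic_into)
    show "continuous_map (prod_topology (top_of_set {0..1}) ?X) euclideanreal (\<lambda>p. flow (fst p) (snd p) v)" for v
      by (rule continuous_map_flow) simp
    show "flow s t \<in> points" if "s \<in> {0..1}" "t \<in> topspace ?X" for s t
      using that flow_in_points by (simp add: topspace_points)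
    fix t assume "t \<in> topspace ?X"
    then have t: "t \<in> points" by (simp add: topspace_points)
    show "flow 0 t = id t" using flow_0[OF t] by simp
    obtain r where r: "0 < r" "\<And>i. i < d \<Longrightarrow> reflect d (\<sigma> t) i = push d 1 (coords t) i / r"
      unfolding \<sigma>_def using reflect_to_sphere[OF l1_norm_push_pos[OF _ l1_norm_coords[OF t], of 1]] by auto
    have "(g \<circ> f) t = place (h (\<kappa> t)) (reflect d (\<sigma> t))"
      using gq[of "(\<kappa> t, \<sigma> t)"] \<kappa>_less \<sigma>_in[OF t] by (simp add: f_def G_def)
    also have "\<dots> = place (h (\<kappa> t)) (push d 1 (coords t))"
      using r by (rule place_scale)
    also have "\<dots> = place (carrier_leg t) (push d 1 (coords t))"
    proof (rule place_cong)
      fix i assume i: "i < d" "0 < push d 1 (coords t) i"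
      have pos: "0 < coords t j" if "j < d" for j
      proof (rule ccontr)
        assume "\<not> 0 < coords t j"
        then have "push d 1 (coords t) i = - 1"
          using that by (simp add: push_of_nonpositive)
        then show False using i by simp
      qed
      then obtain j where j: "j < k" "\<forall>i<d. t (h j i) \<noteq> 0" using facet_exists[OF t] by blast
      then have "\<kappa> t = j" using \<kappa>_eq[OF t] by blast
      then show "h (\<kappa> t) i = carrier_leg t i"
        using points_unique[OF t, of "h j i" "carrier_leg t i"] j i h_legs[of j i] carrier_leg[OF t pos, of i]
        by (auto simp: legs_def)
    qed
    also have "\<dots> = flow 1 t"
      using carrier_leg[OF t] by (intro flow_eq_place[symmetric] t) auto
    finally show "flow 1 t = (g \<circ> f) t" ..
  qed

  \<comment> \<open>the push on one sphere of the wedge; it fixes the base point and hence descends to the wedge\<close>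
  define \<Phi> where "\<Phi> s x = to_sphere d (push d s (\<lambda>i. reflect d x i / l1_norm d (reflect d x)))" for s x
  let ?I = "top_of_set {0..1::real}"
  have norm_unit: "l1_norm d (\<lambda>i. reflect d x i / l1_norm d (reflect d x)) = 1"
    if "x \<in> topspace ?N" for x
  proof -
    have "l1_norm d (\<lambda>i. y i / r) = l1_norm d y / r" if "0 < r" for y r
      using that by (simp add: l1_norm_def flip: sum_divide_distrib)
    then show ?thesis using l1_norm_reflect_pos[OF d_pos that] by simp
  qed
  have \<Phi>_base: "\<Phi> s sphere_base = sphere_base" if s: "s \<in> {0..1}" for s
  proof -
    have norm: "l1_norm d (reflect d sphere_base) = real d"
      by (simp add: l1_norm_def reflect_base)
    show ?thesis
      unfolding \<Phi>_def
    proof (rule to_sphere_negative_const[OF d_pos])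
      have "0 \<le> (1 - s) / real d" using s by simp
      moreover have "0 < (1 - s) / real d" if "s = 0" using that d_pos by simp
      moreover have "0 \<le> s" using s by simp
      ultimately show "0 < (1 - s) / real d + s" by linarith
      show "push d s (\<lambda>i. reflect d sphere_base i / l1_norm d (reflect d sphere_base)) i
          = - ((1 - s) / real d + s)" if "i < d" for i
        unfolding norm using that d_pos
        by (subst push_of_nonpositive[where j = i]) (simp_all add: reflect_base)
    qed
  qed
  have \<Phi>_cont: "continuous_map (prod_topology ?I ?N) ?N (\<lambda>p. \<Phi> (fst p) (snd p))"
    unfolding \<Phi>_def
  proof (rule continuous_map_to_sphere[OF d_pos])
    let ?P = "prod_topology ?I ?N"
    have "continuous_map ?N euclideanreal (\<lambda>x. reflect d x i / l1_norm d (reflect d x))" for i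
      by (intro continuous_map_real_divide reflect_cont norm_cont norm_nz)
    then have "continuous_map ?P euclideanreal (\<lambda>p. reflect d (snd p) i / l1_norm d (reflect d (snd p)))" for i
      by (rule continuous_map_homotopy_projections)
    then show "continuous_map ?P euclideanreal
        (\<lambda>p. push d (fst p) (\<lambda>i. reflect d (snd p) i / l1_norm d (reflect d (snd p))) i)" if "i < d" for i
      using continuous_map_push(1)[where s = fst and X = ?P and d = d and i = i
          and y = "\<lambda>p i. reflect d (snd p) i / l1_norm d (reflect d (snd p))"]
        that continuous_map_homotopy_projections(1)[of ?N] by simp
    show "0 < l1_norm d (push d (fst p) (\<lambda>i. reflect d (snd p) i / l1_norm d (reflect d (snd p))))"
      if "p \<in> topspace ?P" for p
      using that by (intro l1_norm_push_pos norm_unit) auto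
  qed
  have fg: "homotopic_with (\<lambda>_. True) ?W ?W (f \<circ> g) id"
  proof (rule homotopic_with_symD)
    let ?q = "\<lambda>(s, a). (s, q a)"
    let ?H = "\<lambda>(s, j, x). q (j, \<Phi> s x)"
    have Q: "quotient_map (prod_topology ?I ?S) (prod_topology ?I ?W) ?q"
      by (intro quotient_map_prod_right q)
        (auto intro!: compact_imp_locally_compact_space Hausdorff_space_subtopology
          simp: compact_space_subtopology)
    have H: "continuous_map (prod_topology ?I ?S) ?W ?H"
    proof (rule continuous_map_from_prod_sum_topology)
      fix j assume "j \<in> {..<k}"
      then show "continuous_map (prod_topology ?I ?N) ?W (\<lambda>(s, x). ?H (s, j, x))"
        using continuous_map_compose[OF \<Phi>_cont q_cont, of j] by (simp add: o_def case_prod_unfold)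
    qed
    obtain H' where H': "continuous_map (prod_topology ?I ?W) ?W H'"
      and H'q: "\<And>p. p \<in> topspace (prod_topology ?I ?S) \<Longrightarrow> H' (?q p) = ?H p"
    proof (rule quotient_map_lift_exists[OF Q H])
      show "?H a = ?H b" if ab: "a \<in> topspace (prod_topology ?I ?S)" "b \<in> topspace (prod_topology ?I ?S)"
        "?q a = ?q b" for a b
      proof -
        obtain s i x where a: "a = (s, i, x)" by (cases a)
        obtain s' j y where b: "b = (s', j, y)" by (cases b)
        have in_top: "s \<in> {0..1}" "s' = s" "i < k" "x \<in> topspace ?N" "j < k" "y \<in> topspace ?N"
          and "q (i, x) = q (j, y)"
          using ab by (auto simp: a b)
        then consider "i = j" "x = y" | "x = sphere_base" "y = sphere_base"
          using q_eq by blast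
        then show ?thesis
        proof cases
          case 1
          then show ?thesis by (simp add: a b in_top)
        next
          case 2
          then show ?thesis
            using in_top q_base[of i j] \<Phi>_base[of s] by (simp add: a b)
        qed
      qed
    qed (use that in blast)
    have W: "\<exists>j<k. \<exists>x\<in>topspace ?N. w = q (j, x)" if "w \<in> topspace ?W" for w
    proof -
      have "w \<in> q ` topspace ?S"
        using that by (simp only: quotient_imp_surjective_map[OF q])
      then obtain a where "a \<in> topspace ?S" "w = q a" by blast
      then show ?thesis by (cases a) auto
    qed
    have H'_ends: "H' (0, w) = id w \<and> H' (1, w) = (f \<circ> g) w" if w_in: "w \<in> topspace ?W" for w
    proof -
      obtain j x where w: "j < k" "x \<in> topspace ?N" "w = q (j, x)" using W[OF w_in] by blast
      let ?r = "l1_norm d (reflect d x)"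
      have r: "0 < ?r" using l1_norm_reflect_pos[OF d_pos w(2)] .
      have "\<Phi> 0 x = x"
        unfolding \<Phi>_def push_0 using to_sphere_scale[OF r] to_sphere_reflect[OF d_pos w(2)] by simp
      then have H0: "H' (0, w) = id w"
        using H'q[of "(0, j, x)"] w by simp
      have G: "G (j, x) \<in> points" using G_in w by blast
      have coords_G: "coords (G (j, x)) i = reflect d x i / ?r" if "i < d" for i
        using that h_legs[OF w(1)] by (simp add: G_def coords_place)
      then have \<sigma>_G: "\<sigma> (G (j, x)) = \<Phi> 1 x"
        unfolding \<sigma>_def \<Phi>_def by (intro to_sphere_cong push_cong)
      have "f (G (j, x)) = q (j, \<sigma> (G (j, x)))"
      proof (cases "\<forall>i<d. 0 < reflect d x i")
        case True
        show ?thesis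
        proof (rule f_facet[OF G w(1)])
          fix v assume v: "v \<in> V" "v \<notin> h j ` {..<d}"
          then have "v \<noteq> h j (\<beta> v)" "0 < reflect d x (\<beta> v)" using \<beta>_less True by auto
          then show "G (j, x) v = 0" by (simp add: G_def place_def)
        qed
      next
        case False
        then obtain i where i: "i < d" "reflect d x i \<le> 0" by (auto simp: not_less)
        then have "coords (G (j, x)) i \<le> 0"
          using coords_G r by (simp add: divide_nonpos_pos)
        then have "f (G (j, x)) = q (0, \<sigma> (G (j, x)))" "\<sigma> (G (j, x)) = sphere_base"
          using f_base[OF i(1)] \<sigma>_base[OF i(1)] by auto
        then show ?thesis using q_base[OF k_pos w(1)] by simp
      qed
      then show ?thesis
        using H0 H'q[of "(1, j, x)"] gq[of "(j, x)"] w by (simp add: \<sigma>_G)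
    qed
    show "homotopic_with (\<lambda>_. True) ?W ?W id (f \<circ> g)"
      using H' H'_ends by (subst homotopic_with) auto
  qed
  show ?thesis
    unfolding k_def[symmetric] homotopy_equivalent_space_def using f_cont g gf fg by blast
qed

end

text \<open>The general form: number the blocks and choose a centre in each. A block of size \<open>k\<close> has \<open>k - 1\<close> legs.\<close>
lemma transversal_wedge:
  fixes \<beta> :: "'a \<Rightarrow> 'b"
  assumes V: "finite V" "V \<noteq> {}"
    and blocks: "\<And>b. b \<in> \<beta> ` V \<Longrightarrow> 2 \<le> card {v \<in> V. \<beta> v = b}"
  shows "geometric_realization (transversal_complex V \<beta>) homotopy_equivalent_space
    wedge_of_spheres (\<Prod>b\<in>\<beta> ` V. card {v \<in> V. \<beta> v = b} - 1) (card (\<beta> ` V) - 1)"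
proof -
  define d where "d = card (\<beta> ` V)"
  have "finite (\<beta> ` V)" using V by simp
  then obtain e where e: "bij_betw e (\<beta> ` V) {..<d}"
    unfolding d_def by (metis atLeast0LessThan ex_bij_betw_finite_nat)
  define \<gamma> where "\<gamma> v = e (\<beta> v)" for v
  have e_inj: "inj_on e (\<beta> ` V)" and e_im: "e ` \<beta> ` V = {..<d}"
    using e by (auto simp: bij_betw_def)
  have \<gamma>_eq: "\<gamma> v = \<gamma> w \<longleftrightarrow> \<beta> v = \<beta> w" if "v \<in> V" "w \<in> V" for v w
    using that e_inj by (auto simp: \<gamma>_def inj_on_eq_iff)
  have complex: "transversal_complex V \<gamma> = transversal_complex V \<beta>"
    using \<gamma>_eq by (auto simp: transversal_complex_def inj_on_def subset_iff)
  define c where "c i = (SOME v. v \<in> V \<and> \<gamma> v = i)" for i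
  have c: "c i \<in> V \<and> \<gamma> (c i) = i" if "i < d" for i
  proof -
    have "i \<in> e ` \<beta> ` V" using that e_im by simp
    then have "\<exists>v. v \<in> V \<and> \<gamma> v = i" by (auto simp: \<gamma>_def)
    then show ?thesis unfolding c_def by (rule someI_ex)
  qed
  interpret blocks V \<gamma> d c
  proof
    show "\<gamma> v < d" if "v \<in> V" for v
      using that e_im by (auto simp: \<gamma>_def)
  qed (use V c in \<open>auto simp: d_def card_gt_0_iff\<close>)
  have card_legs: "card (legs (e b)) = card {v \<in> V. \<beta> v = b} - 1" if b: "b \<in> \<beta> ` V" for b
  proof -
    have "e b < d" using e_im b by blast
    have "{v \<in> V. \<beta> v = b} = {v \<in> V. \<gamma> v = e b}"
      using b e_inj by (auto simp: \<gamma>_def inj_on_eq_iff)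
    also have "\<dots> = insert (c (e b)) (legs (e b))"
      using block_eq[OF \<open>e b < d\<close>] .
    finally show ?thesis using finite_legs c_notin_legs by simp
  qed
  have "legs i \<noteq> {}" if "i < d" for i
  proof -
    have "i \<in> e ` \<beta> ` V" using that e_im by simp
    then obtain b where "b \<in> \<beta> ` V" "i = e b" by blast
    then have "card (legs i) \<noteq> 0" using card_legs[of b] blocks[of b] by simp
    then show ?thesis by (metis card.empty)
  qed
  then have "geometric_realization (transversal_complex V \<gamma>) homotopy_equivalent_space
      wedge_of_spheres (\<Prod>i<d. card (legs i)) (d - 1)"
    by (rule wedge_decomposition)
  moreover have "(\<Prod>i<d. card (legs i)) = (\<Prod>b\<in>\<beta> ` V. card (legs (e b)))"
    using prod.reindex_bij_betw[OF e, of "\<lambda>i. card (legs i)"] by simp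
  ultimately show ?thesis
    using card_legs by (simp add: complex d_def)
qed

text \<open>Peel off one block: a face either misses it or contains exactly one of its points, and in the second
case the sign changes. So each block contributes the factor \<open>1 - k\<close>, where \<open>k\<close> is its size.\<close>
lemma alternating_sum_transversal:
  assumes V: "finite V"
  shows "alternating_sum (transversal_complex V \<beta>) = (\<Prod>b\<in>\<beta> ` V. 1 - int (card {v \<in> V. \<beta> v = b}))"
proof -
  let ?T = "\<lambda>J. transversal_complex {v \<in> V. \<beta> v \<in> J} \<beta>" and ?B = "\<lambda>b. {v \<in> V. \<beta> v = b}"
  have main: "alternating_sum (?T J) = (\<Prod>b\<in>J. 1 - int (card (?B b)))" if "finite J" for J
    using that
  proof (induction J)
    case empty
    have "?T {} = {{}}" by (auto simp: transversal_complex_def)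
    then show ?case by (simp add: alternating_sum_def)
  next
    case (insert b J)
    let ?ins = "\<lambda>(v, I). insert v I"
    have fin: "finite (?T J)" "\<And>I. I \<in> ?T J \<Longrightarrow> finite I"
      using V by (auto simp: transversal_complex_def intro: finite_subset)
    have notin: "w \<notin> I" if "I \<in> ?T J" "w \<in> ?B b" for w I
      using that insert.hyps by (auto simp: transversal_complex_def)
    have split: "?T (insert b J) = ?T J \<union> ?ins ` (?B b \<times> ?T J)"
    proof (intro equalityI subsetI)
      fix I assume I: "I \<in> ?T (insert b J)"
      show "I \<in> ?T J \<union> ?ins ` (?B b \<times> ?T J)"
      proof (cases "\<exists>v\<in>I. \<beta> v = b")
        case True
        then obtain v where v: "v \<in> I" "\<beta> v = b" by blast
        then have "I - {v} \<in> ?T J"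
          using I by (auto simp: transversal_complex_def inj_on_def)
        moreover have "I = ?ins (v, I - {v})" using v by auto
        moreover have "v \<in> ?B b" using v I by (auto simp: transversal_complex_def)
        ultimately show ?thesis by blast
      qed (use I in \<open>auto simp: transversal_complex_def\<close>)
    next
      fix I assume "I \<in> ?T J \<union> ?ins ` (?B b \<times> ?T J)"
      then consider "I \<in> ?T J" | v I' where "v \<in> ?B b" "I' \<in> ?T J" "I = insert v I'" by auto
      then show "I \<in> ?T (insert b J)"
      proof cases
        case 1
        then show ?thesis by (auto simp: transversal_complex_def)
      next
        case 2
        have "\<beta> v \<notin> \<beta> ` I'"
          using 2 insert.hyps by (auto simp: transversal_complex_def subset_iff)
        then have "inj_on \<beta> I"
          using 2 by (auto simp: transversal_complex_def)
        then show ?thesis using 2 by (auto simp: transversal_complex_def)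
      qed
    qed
    have inj: "inj_on ?ins (?B b \<times> ?T J)"
    proof (rule inj_onI, clarify)
      fix v I v' I' assume *: "v \<in> V" "b = \<beta> v" "I \<in> ?T J" "v' \<in> V" "\<beta> v' = \<beta> v" "I' \<in> ?T J"
        "insert v I = insert v' I'"
      have "v \<notin> I" "v \<notin> I'" "v' \<notin> I" "v' \<notin> I'" using notin * by auto
      then show "v = v' \<and> I = I'" using * by (metis insert_ident insert_iff)
    qed
    have disj: "?T J \<inter> ?ins ` (?B b \<times> ?T J) = {}" using notin by auto
    have "(\<Sum>I\<in>?ins ` (?B b \<times> ?T J). (-1) ^ card I) = (\<Sum>p\<in>?B b \<times> ?T J. (-1) ^ card (?ins p) :: int)"
      by (simp add: sum.reindex[OF inj])
    also have "\<dots> = (\<Sum>p\<in>?B b \<times> ?T J. - ((-1) ^ card (snd p)))"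
      using fin notin by (intro sum.cong) auto
    also have "\<dots> = - int (card (?B b)) * alternating_sum (?T J)"
      using sum.cartesian_product[of "\<lambda>_ I. (-1) ^ card I :: int" "?T J" "?B b"]
      by (simp add: alternating_sum_def sum_negf case_prod_unfold)
    finally have "alternating_sum (?T (insert b J)) = (1 - int (card (?B b))) * alternating_sum (?T J)"
      unfolding split using disj fin V
      by (subst alternating_sum_def, subst sum.union_disjoint) (auto simp: alternating_sum_def algebra_simps)
    then show ?case using insert by simp
  qed
  have all: "?T (\<beta> ` V) = transversal_complex V \<beta>"
    by (intro arg_cong[where f = "\<lambda>W. transversal_complex W \<beta>"]) auto
  show ?thesis
    using main[OF finite_imageI[OF V, of \<beta>]] unfolding all .
qed

section \<open>Independence complexes of relations\<close>
text \<open>Edges may be listed in either direction, and a loop \<open>(v, v)\<close> deletes the vertex \<open>v\<close>. Thus adding an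
edge and deleting a vertex are the same operation.\<close>
definition ind :: "'a set \<Rightarrow> 'a rel \<Rightarrow> 'a set set" where
  "ind V E = {I. I \<subseteq> V \<and> E \<inter> I \<times> I = {}}"

lemma simplicial_complex_ind:
  assumes "finite V"
  shows "simplicial_complex (ind V E)"
proof -
  have "ind V E \<subseteq> Pow V" by (auto simp: ind_def)
  then show ?thesis
    using assms unfolding simplicial_complex_def
    by (auto simp: ind_def finite_subset intro: finite_subset[of _ "Pow V"])
qed

lemma ind_Union: "\<Union>(ind V E) \<subseteq> V"
  by (auto simp: ind_def)

lemma ind_cong:
  assumes "\<And>u v. u \<in> V \<Longrightarrow> v \<in> V \<Longrightarrow> (u, v) \<in> E \<union> E\<inverse> \<longleftrightarrow> (u, v) \<in> E' \<union> E'\<inverse>"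
  shows "ind V E = ind V E'"
  using assms unfolding ind_def by blast

lemma ind_loop: "ind V (insert (s, s) E) = ind (V - {s}) E"
  by (auto simp: ind_def)

lemma ind_image:
  assumes inj: "inj_on f V"
    and adj: "\<And>u v. u \<in> V \<Longrightarrow> v \<in> V \<Longrightarrow> (u, v) \<in> E \<union> E\<inverse> \<longleftrightarrow> (f u, f v) \<in> E' \<union> E'\<inverse>"
  shows "(`) f ` ind V E = ind (f ` V) E'"
proof -
  have indep: "E \<inter> I \<times> I = {} \<longleftrightarrow> E' \<inter> (f ` I) \<times> (f ` I) = {}" if "I \<subseteq> V" for I
  proof -
    have "E \<inter> I \<times> I = {} \<longleftrightarrow> (\<forall>u\<in>I. \<forall>v\<in>I. (u, v) \<notin> E \<union> E\<inverse>)" by blast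
    also have "\<dots> \<longleftrightarrow> (\<forall>u\<in>I. \<forall>v\<in>I. (f u, f v) \<notin> E' \<union> E'\<inverse>)" using adj that by blast
    also have "\<dots> \<longleftrightarrow> E' \<inter> (f ` I) \<times> (f ` I) = {}" by blast
    finally show ?thesis .
  qed
  show ?thesis
  proof (intro equalityI subsetI)
    fix J assume "J \<in> ind (f ` V) E'"
    then obtain I where "I \<subseteq> V" "J = f ` I" by (auto simp: ind_def subset_image_iff)
    then show "J \<in> (`) f ` ind V E" using \<open>J \<in> ind (f ` V) E'\<close> indep by (auto simp: ind_def)
  qed (use indep in \<open>auto simp: ind_def\<close>)
qed

text \<open>If every neighbour of \<open>w\<close> is a neighbour of \<open>u\<close> or \<open>v\<close>, then an independent set containing \<open>u\<close> and \<open>v\<close>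
can always be enlarged by \<open>w\<close>. For \<open>u = v\<close> this is the fold lemma: a vertex whose neighbourhood
contains that of another vertex may be deleted.\<close>
lemma fold_equiv_insert_edge:
  assumes V: "finite V" "w \<in> V" and w: "w \<notin> {u, v}" "(w, w) \<notin> E"
    and dom: "\<And>x. x \<in> V \<Longrightarrow> (w, x) \<in> E \<union> E\<inverse> \<Longrightarrow> (x, u) \<in> E \<union> E\<inverse> \<or> (x, v) \<in> E \<union> E\<inverse>"
  shows "fold_equiv (ind V E) (ind V (insert (u, v) E))"
proof -
  have "ind V (insert (u, v) E) = {\<tau> \<in> ind V E. \<not> (u \<in> \<tau> \<and> v \<in> \<tau>)}"
    by (auto simp: ind_def)
  moreover have "insert w \<tau> \<in> ind V E" if \<tau>: "\<tau> \<in> ind V E" "u \<in> \<tau>" "v \<in> \<tau>" for \<tau>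
  proof -
    have "(w, x) \<notin> E \<union> E\<inverse>" if "x \<in> \<tau>" for x
      using dom[of x] that \<tau> by (auto simp: ind_def)
    then show ?thesis using \<tau> V w by (auto simp: ind_def)
  qed
  ultimately show ?thesis
    using fold_delete[OF simplicial_complex_ind[OF V(1)] w(1)] by simp
qed

text \<open>Delete the vertices of \<open>S\<close> in order of increasing rank. When the turn of \<open>s\<close> comes, the neighbours of
\<open>w s\<close> that are not neighbours of \<open>s\<close> have already been deleted.\<close>
lemma fold_equiv_delete_dominated:
  fixes rank :: "'a \<Rightarrow> 'r::linorder"
  assumes V: "finite V" and S: "finite S"
    and w: "\<And>s. s \<in> S \<Longrightarrow> w s \<in> V - S" "\<And>s. s \<in> S \<Longrightarrow> (w s, w s) \<notin> E"
    and dom: "\<And>s x. s \<in> S \<Longrightarrow> x \<in> V \<Longrightarrow> (w s, x) \<in> E \<union> E\<inverse> \<Longrightarrow>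
      (x, s) \<in> E \<union> E\<inverse> \<or> x \<in> S \<and> rank x < rank s"
  shows "fold_equiv (ind V E) (ind (V - S) E)"
  using S w dom
proof (induction S rule: finite_ranking_induct[where f = rank])
  case empty
  then show ?case by (simp add: fold_refl)
next
  case (insert s S)
  show ?case
  proof (cases "s \<in> S")
    case True
    then show ?thesis using insert by (simp add: insert_absorb)
  next
    case False
    have "fold_equiv (ind V E) (ind (V - S) E)"
    proof (rule insert.IH)
      show "(x, s') \<in> E \<union> E\<inverse> \<or> x \<in> S \<and> rank x < rank s'"
        if "s' \<in> S" "x \<in> V" "(w s', x) \<in> E \<union> E\<inverse>" for s' x
        using insert.prems(3)[of s' x] insert.hyps(2)[of s'] that by auto
    qed (use insert.prems in auto)
    also have "fold_equiv (ind (V - S) E) (ind (V - S) (insert (s, s) E))"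
    proof (rule fold_equiv_insert_edge)
      show "w s \<in> V - S" "w s \<notin> {s, s}" "(w s, w s) \<notin> E" using insert.prems by auto
      show "(x, s) \<in> E \<union> E\<inverse> \<or> (x, s) \<in> E \<union> E\<inverse>" if "x \<in> V - S" "(w s, x) \<in> E \<union> E\<inverse>" for x
        using insert.prems(3)[of s x] that by auto
    qed (use V in simp)
    finally show ?thesis by (simp add: ind_loop Diff_insert2[symmetric] flip: Diff_insert)
  qed
qed

section \<open>Joins of families of complexes\<close>
definition join_over :: "'i set \<Rightarrow> ('i \<Rightarrow> 'a set set) \<Rightarrow> ('i \<times> 'a) set set" where
  "join_over A K = {I. I \<subseteq> A \<times> UNIV \<and> (\<forall>k\<in>A. I `` {k} \<in> K k)}"

lemma simplicial_complex_join_over: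
  assumes A: "finite A" and K: "\<And>k. k \<in> A \<Longrightarrow> simplicial_complex (K k)"
  shows "simplicial_complex (join_over A K)"
proof -
  have bound: "I \<subseteq> Sigma A (\<lambda>k. \<Union>(K k))" if "I \<in> join_over A K" for I
    using that by (auto simp: join_over_def)
  have fin: "finite (Sigma A (\<lambda>k. \<Union>(K k)))"
    using A simplicial_complexD(2)[OF K] by blast
  have "finite (join_over A K)"
    by (rule finite_subset[of _ "Pow (Sigma A (\<lambda>k. \<Union>(K k)))"]) (use bound fin in auto)
  moreover have "J \<in> join_over A K" if "I \<in> join_over A K" "J \<subseteq> I" for I J
  proof -
    have "J `` {k} \<in> K k" if "k \<in> A" for k
      using simplicial_complexD(4)[OF K[OF that], of "I `` {k}" "J `` {k}"] that
        \<open>I \<in> join_over A K\<close> \<open>J \<subseteq> I\<close> by (auto simp: join_over_def)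
    then show ?thesis using that by (auto simp: join_over_def)
  qed
  ultimately show ?thesis
    using finite_subset[OF bound fin] by (auto simp: simplicial_complex_def)
qed

lemma fold_equiv_simplicial:
  assumes "fold_equiv K L"
  shows "simplicial_complex K \<longleftrightarrow> simplicial_complex L"
  using assms
proof induction
  case (fold_delete K w u v)
  then show ?case by (auto simp: simplicial_complex_def)
qed auto

lemma fold_equiv_join_component:
  assumes eq: "fold_equiv P Q" and A: "finite A" "k \<in> A"
    and P: "simplicial_complex P" and K: "\<And>i. i \<in> A \<Longrightarrow> simplicial_complex (K i)"
  shows "fold_equiv (join_over A (K(k := P))) (join_over A (K(k := Q)))"
  using eq P
proof induction
  case (fold_delete P w u v)
  let ?J = "join_over A (K(k := P))"
  have "simplicial_complex ?J"
    using A K fold_delete by (intro simplicial_complex_join_over) auto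
  moreover have "insert (k, w) I \<in> ?J" if I: "I \<in> ?J" "(k, u) \<in> I" "(k, v) \<in> I" for I
  proof -
    have "(insert (k, w) I) `` {i} = (if i = k then insert w (I `` {i}) else I `` {i})" for i by auto
    moreover have "insert w (I `` {k}) \<in> P"
      using I A(2) by (intro fold_delete.hyps(3)) (auto simp: join_over_def)
    ultimately show ?thesis using I A(2) by (auto simp: join_over_def)
  qed
  ultimately have "fold_equiv ?J {I \<in> ?J. \<not> ((k, u) \<in> I \<and> (k, v) \<in> I)}"
    using fold_delete.hyps(2) by (intro fold_equiv.fold_delete[of _ "(k, w)"]) auto
  also have "{I \<in> ?J. \<not> ((k, u) \<in> I \<and> (k, v) \<in> I)}
      = join_over A (K(k := {\<tau> \<in> P. \<not> (u \<in> \<tau> \<and> v \<in> \<tau>)}))"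
    using A(2) by (auto simp: join_over_def)
  finally show ?case .
next
  case (fold_refl P)
  show ?case by (rule fold_equiv.fold_refl)
next
  case (fold_sym P Q)
  then show ?case using fold_equiv_simplicial[of P Q] by (blast intro: fold_equiv.fold_sym)
next
  case (fold_trans P Q R)
  then show ?case using fold_equiv_simplicial[of P Q] by (blast intro: fold_equiv.fold_trans)
qed

lemma fold_equiv_join:
  assumes eq: "fold_equiv P Q" and P: "simplicial_complex P" and A: "finite A"
  shows "fold_equiv (join_over A (\<lambda>_. P)) (join_over A (\<lambda>_. Q))"
proof -
  have "fold_equiv (join_over A (\<lambda>_. P)) (join_over A (\<lambda>i. if i \<in> B then Q else P))"
    if "finite B" "B \<subseteq> A" for B
    using that
  proof (induction B)
    case empty
    then show ?case by (simp add: fold_refl)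
  next
    case (insert k B)
    let ?K = "\<lambda>i. if i \<in> B then Q else P"
    have "?K(k := P) = ?K" "?K(k := Q) = (\<lambda>i. if i \<in> insert k B then Q else P)"
      using insert.hyps by (auto simp: fun_eq_iff)
    moreover have "simplicial_complex Q" using fold_equiv_simplicial[OF eq] P by simp
    then have "fold_equiv (join_over A (?K(k := P))) (join_over A (?K(k := Q)))"
      using insert.prems A P by (intro fold_equiv_join_component eq) auto
    ultimately show ?case using insert by (auto intro: fold_trans)
  qed
  from this[OF A] show ?thesis
    by (simp add: join_over_def cong: conj_cong)
qed

lemma join_over_ind:
  "join_over A (\<lambda>_. ind V E) = ind (A \<times> V) {((k, a), (k, b)) | k a b. (a, b) \<in> E}"
proof -
  let ?E = "{((k, a), (k, b)) | k a b. (a, b) \<in> E}"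
  have components: "?E \<inter> I \<times> I = {} \<longleftrightarrow> (\<forall>k\<in>A. E \<inter> (I `` {k}) \<times> (I `` {k}) = {})" if "I \<subseteq> A \<times> UNIV" for I
  proof -
    have "?E \<inter> I \<times> I = {} \<longleftrightarrow> (\<forall>k a b. (k, a) \<in> I \<and> (k, b) \<in> I \<longrightarrow> (a, b) \<notin> E)"
      by blast
    also have "\<dots> \<longleftrightarrow> (\<forall>k\<in>A. E \<inter> (I `` {k}) \<times> (I `` {k}) = {})"
      using that by blast
    finally show ?thesis .
  qed
  have subset_product: "I \<subseteq> A \<times> V \<longleftrightarrow> I \<subseteq> A \<times> UNIV \<and> (\<forall>k\<in>A. I `` {k} \<subseteq> V)" for I
    by auto
  show ?thesis
  proof (rule set_eqI)
    fix J
    show "J \<in> join_over A (\<lambda>_. ind V E) \<longleftrightarrow> J \<in> ind (A \<times> V) ?E"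
    proof (cases "J \<subseteq> A \<times> UNIV")
      case True
      then show ?thesis
        by (simp only: join_over_def ind_def mem_Collect_eq components[OF True] subset_product
            ball_conj_distrib conj_assoc)
    next
      case False
      then show ?thesis by (simp only: join_over_def ind_def mem_Collect_eq subset_product simp_thms)
    qed
  qed
qed

lemma join_over_transversal:
  "join_over A (\<lambda>_. transversal_complex W \<beta>) = transversal_complex (A \<times> W) (\<lambda>(k, a). (k, \<beta> a))"
proof -
  have components: "inj_on (\<lambda>(k, a). (k, \<beta> a)) I \<longleftrightarrow> (\<forall>k\<in>A. inj_on \<beta> (I `` {k}))" if "I \<subseteq> A \<times> UNIV" for I
  proof -
    have "inj_on (\<lambda>(k, a). (k, \<beta> a)) I
        \<longleftrightarrow> (\<forall>k a b. (k, a) \<in> I \<and> (k, b) \<in> I \<longrightarrow> \<beta> a = \<beta> b \<longrightarrow> a = b)"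
      by (auto simp: inj_on_def)
    also have "\<dots> \<longleftrightarrow> (\<forall>k\<in>A. inj_on \<beta> (I `` {k}))"
      using that unfolding inj_on_def by blast
    finally show ?thesis .
  qed
  have subset_product: "I \<subseteq> A \<times> W \<longleftrightarrow> I \<subseteq> A \<times> UNIV \<and> (\<forall>k\<in>A. I `` {k} \<subseteq> W)" for I
    by auto
  show ?thesis
  proof (rule set_eqI)
    fix J
    show "J \<in> join_over A (\<lambda>_. transversal_complex W \<beta>) \<longleftrightarrow> J \<in> transversal_complex (A \<times> W) (\<lambda>(k, a). (k, \<beta> a))"
    proof (cases "J \<subseteq> A \<times> UNIV")
      case True
      then show ?thesis
        by (simp only: join_over_def transversal_complex_def mem_Collect_eq components[OF True] subset_product
            ball_conj_distrib conj_assoc)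
    next
      case False
      then show ?thesis by (simp only: join_over_def transversal_complex_def mem_Collect_eq subset_product simp_thms)
    qed
  qed
qed

section \<open>Reducing a cycle to disjoint edges\<close>
text \<open>All edges of the ray \<open>0, 1, 2, \<dots>\<close>, except that the edge from \<open>l - 1\<close> to \<open>l\<close> is replaced by one that
closes up a cycle of length \<open>l\<close>.\<close>
definition cycle_edges :: "nat \<Rightarrow> nat rel" where
  "cycle_edges l = insert (l - 1, 0) {(i, Suc i) | i. i \<noteq> l - 1}"

text \<open>From \<open>l\<close> onwards every third vertex is left out, which cuts the rest of the ray into disjoint edges
\<open>{l, l + 1}\<close>, \<open>{l + 3, l + 4}\<close>, and so on. For \<open>l = M\<close> only the cycle remains.\<close>
definition cycle_and_edges :: "nat \<Rightarrow> nat \<Rightarrow> nat set" where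
  "cycle_and_edges M l = {a. a < M \<and> (a < l \<or> a mod 3 \<noteq> (l + 2) mod 3)}"

lemma finite_cycle_and_edges: "finite (cycle_and_edges M l)"
  by (simp add: cycle_and_edges_def)

text \<open>A cycle may be shortened by three at the cost of a disjoint edge. The vertex \<open>L + 1\<close> allows adding the
chord from \<open>L - 1\<close> to \<open>0\<close>, because its neighbours \<open>L\<close> and \<open>L + 2\<close> are adjacent to the ends of the chord.
Then \<open>L + 2\<close>, with neighbours \<open>L + 1\<close> and \<open>0\<close>, allows removing the edge from \<open>L - 1\<close> to \<open>L\<close>. What is left
is a cycle of length \<open>L\<close> with the tail \<open>L + 2, L + 1, L\<close> attached at \<open>0\<close>, and \<open>L + 2\<close> may
be deleted because the only neighbour of the leaf \<open>L\<close> is also a neighbour of it.\<close>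
lemma fold_equiv_cycle_step:
  assumes L: "2 \<le> L" "L + 3 \<le> M"
  shows "fold_equiv (ind (cycle_and_edges M (L + 3)) (cycle_edges (L + 3)))
    (ind (cycle_and_edges M L) (cycle_edges L))"
proof -
  let ?V = "cycle_and_edges M (L + 3)"
  define E where "E = cycle_edges (L + 3)"
  define F where "F = insert (L - 1, 0) (E - {(L - 1, L)})"
  have E: "(a, b) \<in> E \<longleftrightarrow> a = L + 2 \<and> b = 0 \<or> b = Suc a \<and> a \<noteq> L + 2" for a b
    by (auto simp: E_def cycle_edges_def)
  have F: "(a, b) \<in> F \<longleftrightarrow> a = L - 1 \<and> b = 0 \<or> a = L + 2 \<and> b = 0 \<or> b = Suc a \<and> a \<noteq> L + 2 \<and> a \<noteq> L - 1" for a b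
    using L by (auto simp: F_def E)
  have in_V: "a \<in> ?V" if "a < L + 3" for a
    using that L by (auto simp: cycle_and_edges_def)
  have "fold_equiv (ind ?V E) (ind ?V (insert (L - 1, 0) E))"
    by (rule fold_equiv_insert_edge[where w = "L + 1"])
      (use L in \<open>auto simp: E finite_cycle_and_edges in_V\<close>)
  also have "insert (L - 1, 0) E = insert (L - 1, L) F"
    using L by (auto simp: F E)
  also have "fold_equiv (ind ?V (insert (L - 1, L) F)) (ind ?V F)"
    by (rule fold_sym, rule fold_equiv_insert_edge[where w = "L + 2"])
      (use L in \<open>auto simp: F finite_cycle_and_edges in_V\<close>)
  also have "fold_equiv (ind ?V F) (ind ?V (insert (L + 2, L + 2) F))"
    by (rule fold_equiv_insert_edge[where w = L])
      (use L in \<open>auto simp: F finite_cycle_and_edges in_V\<close>)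
  also have "ind ?V (insert (L + 2, L + 2) F) = ind (?V - {L + 2}) F"
    by (rule ind_loop)
  also have "?V - {L + 2} = cycle_and_edges M L"
  proof (rule set_eqI)
    fix a
    show "a \<in> ?V - {L + 2} \<longleftrightarrow> a \<in> cycle_and_edges M L"
    proof (cases "a < L")
      case False
      have "L mod 3 \<noteq> (L + 2) mod 3" "(L + 1) mod 3 \<noteq> (L + 2) mod 3"
        by (simp_all add: mod_Suc)
      moreover have "(L + 3 + 2) mod 3 = (L + 2) mod 3"
        by presburger
      moreover have "a = L \<or> a = L + 1 \<or> a = L + 2 \<or> L + 3 \<le> a" using False by linarith
      ultimately show ?thesis using False by (auto simp: cycle_and_edges_def)
    qed (auto simp: cycle_and_edges_def)
  qed
  also have "ind (cycle_and_edges M L) F = ind (cycle_and_edges M L) (cycle_edges L)"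
  proof (rule ind_cong)
    fix a b assume "a \<in> cycle_and_edges M L" "b \<in> cycle_and_edges M L"
    then have "a \<noteq> L + 2" "b \<noteq> L + 2" by (auto simp: cycle_and_edges_def)
    then show "(a, b) \<in> F \<union> F\<inverse> \<longleftrightarrow> (a, b) \<in> cycle_edges L \<union> (cycle_edges L)\<inverse>"
      by (auto simp: F cycle_edges_def)
  qed
  finally show ?thesis unfolding E_def .
qed

text \<open>The lower bound on \<open>r\<close> keeps the two ends of the chord distinct.\<close>
lemma fold_equiv_cycle_shorten:
  assumes "2 \<le> r" "r + 3 * j \<le> M"
  shows "fold_equiv (ind (cycle_and_edges M (r + 3 * j)) (cycle_edges (r + 3 * j)))
    (ind (cycle_and_edges M r) (cycle_edges r))"
  using assms(2)
proof (induction j)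
  case (Suc j)
  have eq: "r + 3 * Suc j = r + 3 * j + 3" by simp
  show ?case
    unfolding eq
  proof (rule fold_trans[OF fold_equiv_cycle_step Suc.IH])
    show "2 \<le> r + 3 * j" "r + 3 * j + 3 \<le> M" "r + 3 * j \<le> M"
      using Suc.prems assms(1) by auto
  qed
qed (simp add: fold_refl)

text \<open>A disjoint union of complete graphs has the join of its vertex sets as independence complex.\<close>
lemma ind_eq_transversal:
  assumes "\<And>a b. a \<in> W \<Longrightarrow> b \<in> W \<Longrightarrow> (a, b) \<in> E \<union> E\<inverse> \<longleftrightarrow> a \<noteq> b \<and> \<beta> a = \<beta> b"
  shows "ind W E = transversal_complex W \<beta>"
proof -
  have "E \<inter> I \<times> I = {} \<longleftrightarrow> inj_on \<beta> I" if "I \<subseteq> W" for I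
  proof -
    have "E \<inter> I \<times> I = {} \<longleftrightarrow> (\<forall>a\<in>I. \<forall>b\<in>I. (a, b) \<notin> E \<union> E\<inverse>)" by blast
    also have "\<dots> \<longleftrightarrow> inj_on \<beta> I" using assms that unfolding inj_on_def by blast
    finally show ?thesis .
  qed
  then show ?thesis by (auto simp: ind_def transversal_complex_def)
qed

lemma ind_cycle_edges_eq_transversal:
  assumes wrap: "r - 1 \<in> W \<Longrightarrow> 0 \<in> W \<Longrightarrow> r - 1 \<noteq> 0 \<and> \<beta> (r - 1) = \<beta> 0"
    and step: "\<And>a. a \<in> W \<Longrightarrow> Suc a \<in> W \<Longrightarrow> a \<noteq> r - 1 \<Longrightarrow> \<beta> a = \<beta> (Suc a)"
    and conv: "\<And>a b. a \<in> W \<Longrightarrow> b \<in> W \<Longrightarrow> a < b \<Longrightarrow> \<beta> a = \<beta> b \<Longrightarrow>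
      a = 0 \<and> b = r - 1 \<or> b = Suc a \<and> a \<noteq> r - 1"
  shows "ind W (cycle_edges r) = transversal_complex W \<beta>"
proof (rule ind_eq_transversal)
  have E: "(a, b) \<in> cycle_edges r \<longleftrightarrow> a = r - 1 \<and> b = 0 \<or> b = Suc a \<and> a \<noteq> r - 1" for a b
    by (auto simp: cycle_edges_def)
  fix a b assume W: "a \<in> W" "b \<in> W"
  show "(a, b) \<in> cycle_edges r \<union> (cycle_edges r)\<inverse> \<longleftrightarrow> a \<noteq> b \<and> \<beta> a = \<beta> b"
  proof
    assume "(a, b) \<in> cycle_edges r \<union> (cycle_edges r)\<inverse>"
    then consider "a = r - 1" "b = 0" | "b = Suc a" "a \<noteq> r - 1" | "b = r - 1" "a = 0" | "a = Suc b" "b \<noteq> r - 1"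
      unfolding Un_iff converse_iff E by satx
    then show "a \<noteq> b \<and> \<beta> a = \<beta> b"
    proof cases
      case 1
      then show ?thesis using wrap W by simp
    next
      case 2
      then show ?thesis using step[of a] W by simp
    next
      case 3
      then show ?thesis using wrap W by simp
    next
      case 4
      then show ?thesis using step[of b] W by simp
    qed
  next
    assume "a \<noteq> b \<and> \<beta> a = \<beta> b"
    then show "(a, b) \<in> cycle_edges r \<union> (cycle_edges r)\<inverse>"
      unfolding Un_iff converse_iff E using conv[OF W] conv[OF W(2,1)] by (metis nat_neq_iff)
  qed
qed

lemma div_3_eq_less:
  assumes "(a::nat) < b" "a div 3 = b div 3"
  shows "b = Suc a \<or> b = Suc (Suc a)"
  using assms div_mult_mod_eq[of a 3] div_mult_mod_eq[of b 3]
    mod_less_divisor[of 3 a] mod_less_divisor[of 3 b] by linarith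

lemma div_3_eq_Suc_Suc: "a div 3 = Suc (Suc a) div 3 \<Longrightarrow> a mod 3 = 0"
  by (simp add: div_Suc mod_Suc dvd_eq_mod_eq_0 split: if_splits)

lemma div_mod_3: "(a::nat) div 3 = i \<and> a mod 3 = s \<longleftrightarrow> a = 3 * i + s \<and> s < 3"
proof
  assume "a div 3 = i \<and> a mod 3 = s"
  then show "a = 3 * i + s \<and> s < 3"
    using div_mult_mod_eq[of a 3] mod_less_divisor[of 3 a] by auto
qed auto

lemma mod_3_neq:
  "(a::nat) mod 3 \<noteq> 0 \<longleftrightarrow> a mod 3 = 1 \<or> a mod 3 = 2"
  "(a::nat) mod 3 \<noteq> 1 \<longleftrightarrow> a mod 3 = 0 \<or> a mod 3 = 2"
  "(a::nat) mod 3 \<noteq> 2 \<longleftrightarrow> a mod 3 = 0 \<or> a mod 3 = 1"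
  using mod_less_divisor[of 3 a] by linarith+

lemma div_3_block_01: "(a::nat) div 3 = i \<and> a mod 3 \<noteq> 2 \<longleftrightarrow> a = 3 * i \<or> a = 3 * i + 1"
  by (simp only: mod_3_neq conj_disj_distribL div_mod_3) simp

lemma div_3_block_12: "(a::nat) div 3 = i \<and> a mod 3 \<noteq> 0 \<longleftrightarrow> a = 3 * i + 1 \<or> a = 3 * i + 2"
  by (simp only: mod_3_neq conj_disj_distribL div_mod_3) simp

lemma Suc_div_3_block: "Suc a div 3 = Suc i \<and> a mod 3 \<noteq> 1 \<longleftrightarrow> a = 3 * i + 2 \<or> a = 3 * i + 3"
proof -
  have "a mod 3 \<noteq> 1 \<longleftrightarrow> Suc a mod 3 \<noteq> 2" by (simp add: mod_Suc)
  then show ?thesis using div_3_block_01[of "Suc a" "Suc i"] by (simp only:) (simp add: add.commute)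
qed

definition block_sizes :: "nat set \<Rightarrow> (nat \<Rightarrow> nat) \<Rightarrow> nat \<Rightarrow> nat \<Rightarrow> bool" where
  "block_sizes W \<beta> m s \<longleftrightarrow> finite W \<and> \<beta> ` W = {..<m} \<and>
     (\<forall>i<m. card {a \<in> W. \<beta> a = i} = (if i = 0 then s else 2))"

lemma block_sizesI:
  assumes "finite W" "\<And>a. a \<in> W \<Longrightarrow> \<beta> a < m" "2 \<le> s"
    and "\<And>i. i < m \<Longrightarrow> {a \<in> W. \<beta> a = i} = B i" "\<And>i. i < m \<Longrightarrow> card (B i) = (if i = 0 then s else 2)"
  shows "block_sizes W \<beta> m s"
proof -
  have "i \<in> \<beta> ` W" if "i < m" for i
  proof -
    have "card (B i) \<noteq> 0" using assms(3,5) that by simp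
    then have "{a \<in> W. \<beta> a = i} \<noteq> {}" using assms(4)[OF that] by (metis card.empty)
    then show ?thesis by blast
  qed
  then show ?thesis using assms by (auto simp: block_sizes_def)
qed

text \<open>Shortening by three ends with a cycle of length \<open>3\<close>, \<open>4\<close> or \<open>2\<close>. The triangle is a block of three
pairwise adjacent vertices; a cycle of length four folds to a single edge, and one of length two is
a single edge.\<close>
lemma fold_equiv_cycle:
  assumes M: "2 \<le> M"
  defines "m \<equiv> (M + 1) div 3"
  obtains W \<beta> where "fold_equiv (ind {..<M} (cycle_edges M)) (transversal_complex W \<beta>)"
    and "block_sizes W \<beta> m (if M mod 3 = 0 then 3 else 2)"
proof -
  have start: "{..<M} = cycle_and_edges M M" by (auto simp: cycle_and_edges_def)
  have shorten: "fold_equiv (ind {..<M} (cycle_edges M)) (ind (cycle_and_edges M r) (cycle_edges r))"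
    if "M = r + 3 * j" "2 \<le> r" for r j
    unfolding start using fold_equiv_cycle_shorten[of r j M] that by simp
  consider (0) "M mod 3 = 0" | (1) "M mod 3 = 1" | (2) "M mod 3 = 2" by linarith
  then show thesis
  proof cases
    case 0
    define W where "W = cycle_and_edges M 3"
    have M_eq: "M = 3 + 3 * (m - 1)" "1 \<le> m" using 0 M unfolding m_def by presburger+
    have W: "a \<in> W \<longleftrightarrow> a < M \<and> (a < 3 \<or> a mod 3 \<noteq> 2)" for a
      by (simp add: W_def cycle_and_edges_def)
    have "ind W (cycle_edges 3) = transversal_complex W (\<lambda>a. a div 3)"
    proof (rule ind_cycle_edges_eq_transversal)
      show "a div 3 = Suc a div 3" if "a \<in> W" "a \<noteq> 3 - 1" for a
        using that by (auto simp: W div_Suc mod_Suc dvd_eq_mod_eq_0)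
      show "a = 0 \<and> b = 3 - 1 \<or> b = Suc a \<and> a \<noteq> 3 - 1"
        if ab: "a \<in> W" "b \<in> W" "a < b" "a div 3 = b div 3" for a b
        using div_3_eq_less[OF ab(3,4)]
      proof
        assume b: "b = Suc a"
        then have "a \<noteq> 2" using ab(4) by auto
        then show ?thesis using b by simp
      next
        assume b: "b = Suc (Suc a)"
        then have "a mod 3 = 0"
          using ab(4) div_3_eq_Suc_Suc by simp
        then have "b mod 3 = 2" by (simp add: b mod_Suc)
        then show ?thesis using ab(2) b by (simp add: W)
      qed
    qed simp
    then have "fold_equiv (ind {..<M} (cycle_edges M)) (transversal_complex W (\<lambda>a. a div 3))"
      using shorten[OF M_eq(1)] by (simp add: W_def)
    moreover have "block_sizes W (\<lambda>a. a div 3) m 3"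
    proof (rule block_sizesI)
      show "{a \<in> W. a div 3 = i} = (if i = 0 then {0, 1, 2} else {3 * i, 3 * i + 1})" if "i < m" for i
      proof (cases "i = 0")
        case True
        then show ?thesis using M_eq(1) by (auto simp: W)
      next
        case False
        then have "{a \<in> W. a div 3 = i} = {a. a < M \<and> (a div 3 = i \<and> a mod 3 \<noteq> 2)}"
          by (auto simp: W)
        also have "\<dots> = {3 * i, 3 * i + 1}"
        proof -
          have "3 * i + 1 < M" using that M_eq by linarith
          then show ?thesis unfolding div_3_block_01 by auto
        qed
        finally show ?thesis using False by simp
      qed
      show "a div 3 < m" if "a \<in> W" for a
        using that M_eq by (auto simp: W)
    qed (auto simp: W_def finite_cycle_and_edges)
    ultimately show thesis using that 0 by simp
  next
    case 1
    \<comment> \<open>deleting \<open>0\<close> and \<open>3\<close> keeps the edge \<open>{1, 2}\<close>, so that the blocks are \<open>{3 i + 1, 3 i + 2}\<close> throughout\<close>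
    define W where "W = cycle_and_edges M 4 - {0} - {3}"
    have M_eq: "M = 4 + 3 * (m - 1)" "1 \<le> m" using 1 M unfolding m_def by presburger+
    have small: "a \<in> cycle_and_edges M 4" if "a < 4" for a
      using that M_eq by (auto simp: cycle_and_edges_def)
    have W: "a \<in> W \<longleftrightarrow> a < M \<and> a mod 3 \<noteq> 0" for a
    proof (cases "a < 4")
      case True
      then have "a = 0 \<or> a = 1 \<or> a = 2 \<or> a = 3" by linarith
      then show ?thesis using M_eq by (auto simp: W_def cycle_and_edges_def)
    next
      case False
      then show ?thesis by (auto simp: W_def cycle_and_edges_def)
    qed
    note shorten[OF M_eq(1)]
    also have "fold_equiv (ind (cycle_and_edges M 4) (cycle_edges 4))
        (ind (cycle_and_edges M 4) (insert (0, 0) (cycle_edges 4)))"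
      by (rule fold_equiv_insert_edge[where w = 2])
        (auto simp: finite_cycle_and_edges small cycle_edges_def)
    also have "ind (cycle_and_edges M 4) (insert (0, 0) (cycle_edges 4))
        = ind (cycle_and_edges M 4 - {0}) (cycle_edges 4)"
      by (rule ind_loop)
    also have "fold_equiv \<dots> (ind (cycle_and_edges M 4 - {0}) (insert (3, 3) (cycle_edges 4)))"
      by (rule fold_equiv_insert_edge[where w = 1])
        (auto simp: finite_cycle_and_edges small cycle_edges_def)
    also have "ind (cycle_and_edges M 4 - {0}) (insert (3, 3) (cycle_edges 4)) = ind W (cycle_edges 4)"
      unfolding W_def by (rule ind_loop)
    also have "\<dots> = transversal_complex W (\<lambda>a. a div 3)"
    proof (rule ind_cycle_edges_eq_transversal)
      show "a div 3 = Suc a div 3" if "Suc a \<in> W" for a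
        using that by (simp add: W div_Suc dvd_eq_mod_eq_0)
      show "a = 0 \<and> b = 4 - 1 \<or> b = Suc a \<and> a \<noteq> 4 - 1"
        if ab: "a \<in> W" "b \<in> W" "a < b" "a div 3 = b div 3" for a b
        using div_3_eq_less[OF ab(3,4)]
      proof
        assume "b = Suc a"
        then show ?thesis using ab(1) by (auto simp: W)
      next
        assume "b = Suc (Suc a)"
        then have "a mod 3 = 0"
          using ab(4) div_3_eq_Suc_Suc by simp
        then show ?thesis using ab(1) by (simp add: W)
      qed
    qed (simp add: W)
    finally have "fold_equiv (ind {..<M} (cycle_edges M)) (transversal_complex W (\<lambda>a. a div 3))"
      by simp
    moreover have "block_sizes W (\<lambda>a. a div 3) m 2"
    proof (rule block_sizesI)
      show "{a \<in> W. a div 3 = i} = {3 * i + 1, 3 * i + 2}" if "i < m" for i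
      proof -
        have "{a \<in> W. a div 3 = i} = {a. a < M \<and> (a div 3 = i \<and> a mod 3 \<noteq> 0)}"
          by (auto simp: W)
        also have "\<dots> = {3 * i + 1, 3 * i + 2}"
        proof -
          have "3 * i + 2 < M" using that M_eq by linarith
          then show ?thesis unfolding div_3_block_12 by auto
        qed
        finally show ?thesis .
      qed
      show "a div 3 < m" if "a \<in> W" for a
      proof -
        have "a \<noteq> 3 * m" "a < 3 * m + 1" using that M_eq by (auto simp: W)
        then show ?thesis by (simp add: less_mult_imp_div_less)
      qed
    qed (auto simp: W_def finite_cycle_and_edges)
    ultimately show thesis using that 1 by simp
  next
    case 2
    define W where "W = cycle_and_edges M 2"
    have M_eq: "M = 2 + 3 * (m - 1)" "1 \<le> m" using 2 M unfolding m_def by presburger+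
    have W: "a \<in> W \<longleftrightarrow> a < M \<and> (a < 2 \<or> a mod 3 \<noteq> 1)" for a
      by (simp add: W_def cycle_and_edges_def)
    have "ind W (cycle_edges 2) = transversal_complex W (\<lambda>a. Suc a div 3)"
    proof (rule ind_cycle_edges_eq_transversal)
      show "Suc a div 3 = Suc (Suc a) div 3" if "a \<in> W" "Suc a \<in> W" "a \<noteq> 2 - 1" for a
      proof -
        have "a = 0 \<or> a mod 3 \<noteq> 1" using that by (auto simp: W)
        then show ?thesis by (auto simp: div_Suc mod_Suc dvd_eq_mod_eq_0 split: if_splits)
      qed
      show "a = 0 \<and> b = 2 - 1 \<or> b = Suc a \<and> a \<noteq> 2 - 1"
        if ab: "a \<in> W" "b \<in> W" "a < b" "Suc a div 3 = Suc b div 3" for a b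
      proof -
        have "Suc b = Suc (Suc a) \<or> Suc b = Suc (Suc (Suc a))"
          using div_3_eq_less[of "Suc a" "Suc b"] ab by simp
        then show ?thesis
        proof
          assume b: "Suc b = Suc (Suc a)"
          then have "a \<noteq> 1" using ab(4) by auto
          then show ?thesis using b by simp
        next
          assume b: "Suc b = Suc (Suc (Suc a))"
          then have "Suc a div 3 = Suc (Suc (Suc a)) div 3"
            using ab(4) by simp
          then have "Suc a mod 3 = 0"
            by (rule div_3_eq_Suc_Suc)
          then have "Suc (Suc a) mod 3 = 1" by (subst mod_Suc) simp
          then show ?thesis using ab(2) b by (simp add: W)
        qed
      qed
    qed simp
    then have "fold_equiv (ind {..<M} (cycle_edges M)) (transversal_complex W (\<lambda>a. Suc a div 3))"
      using shorten[OF M_eq(1)] by (simp add: W_def)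
    moreover have "block_sizes W (\<lambda>a. Suc a div 3) m 2"
    proof (rule block_sizesI)
      show "{a \<in> W. Suc a div 3 = i} = (if i = 0 then {0, 1} else {3 * i - 1, 3 * i})" if "i < m" for i
      proof (cases i)
        case 0
        have small: "Suc a div 3 = 0 \<longleftrightarrow> a = 0 \<or> a = 1" for a by auto
        have "1 < M" using M by simp
        then have "{a \<in> W. Suc a div 3 = 0} = {0, 1}"
          unfolding W small by auto
        then show ?thesis using 0 by simp
      next
        case (Suc j)
        then have "{a \<in> W. Suc a div 3 = i} = {a. a < M \<and> (Suc a div 3 = Suc j \<and> a mod 3 \<noteq> 1)}"
          by (auto simp: W)
        also have "\<dots> = {3 * j + 2, 3 * j + 3}"
        proof -
          have "3 * j + 3 < M" using Suc that M_eq by linarith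
          then show ?thesis unfolding Suc_div_3_block by auto
        qed
        finally show ?thesis using Suc by (simp add: add.commute)
      qed
      show "Suc a div 3 < m" if "a \<in> W" for a
      proof -
        have "Suc a < m * 3" using that M_eq by (simp only: W) linarith
        then show ?thesis by (rule less_mult_imp_div_less)
      qed
    qed (auto simp: W_def finite_cycle_and_edges)
    ultimately show thesis using that 2 by simp
  qed
qed

section \<open>The cylindric grid in row and column coordinates\<close>
text \<open>A sum of two integer squares is one only if one of them is zero and the other is one.\<close>
lemma dist_int_eq_1_iff:
  "dist (real_of_int x, real_of_int y) (real_of_int x', real_of_int y') = 1
    \<longleftrightarrow> \<bar>x - x'\<bar> + \<bar>y - y'\<bar> = 1"
proof -
  have squares: "a\<^sup>2 + b\<^sup>2 = 1 \<longleftrightarrow> \<bar>a\<bar> + \<bar>b\<bar> = 1" for a b :: int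
  proof
    assume "a\<^sup>2 + b\<^sup>2 = 1"
    moreover from this have "a\<^sup>2 \<le> 1" "b\<^sup>2 \<le> 1"
      using zero_le_power2[of a] zero_le_power2[of b] by linarith+
    then have "\<bar>a\<bar> \<le> 1" "\<bar>b\<bar> \<le> 1" by (simp_all add: abs_square_le_1)
    then have "a = -1 \<or> a = 0 \<or> a = 1" "b = -1 \<or> b = 0 \<or> b = 1" by linarith+
    ultimately show "\<bar>a\<bar> + \<bar>b\<bar> = 1" by auto
  next
    assume "\<bar>a\<bar> + \<bar>b\<bar> = 1"
    then have "a = 0 \<and> \<bar>b\<bar> = 1 \<or> \<bar>a\<bar> = 1 \<and> b = 0" by linarith
    then show "a\<^sup>2 + b\<^sup>2 = 1" by (auto simp: power2_eq_1_iff abs_if split: if_splits)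
  qed
  have "dist (real_of_int x, real_of_int y) (real_of_int x', real_of_int y') = 1
      \<longleftrightarrow> (real_of_int x - real_of_int x')\<^sup>2 + (real_of_int y - real_of_int y')\<^sup>2 = 1"
    by (simp add: dist_Pair_Pair dist_real_def)
  also have "\<dots> \<longleftrightarrow> real_of_int ((x - x')\<^sup>2 + (y - y')\<^sup>2) = real_of_int 1"
    by simp
  also have "\<dots> \<longleftrightarrow> \<bar>x - x'\<bar> + \<bar>y - y'\<bar> = 1"
    unfolding of_int_eq_iff by (rule squares)
  finally show ?thesis .
qed

locale cylinder =
  fixes M N :: nat
  assumes M: "even M" "1 \<le> M" and N: "1 \<le> N"
begin

definition strip :: "(int \<times> int) set" where
  "strip = {(x, y). y \<le> x \<and> x \<le> y + int M \<and> - y \<le> x \<and> x \<le> - y + int N - 1}"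

text \<open>In the coordinates \<open>x + y\<close> and \<open>x - y\<close> a unit step changes both coordinates by one, and the two
identified sides are the lines \<open>x - y = 0\<close> and \<open>x - y = M\<close>. Hence the cylinder is obtained by reading
\<open>x - y\<close> modulo \<open>M\<close>.\<close>
definition row_col :: "int \<times> int \<Rightarrow> int \<times> int" where
  "row_col = (\<lambda>(x, y). (x + y, (x - y) mod int M))"

definition cells :: "(int \<times> int) set" where
  "cells = {(b, a). 0 \<le> b \<and> b < int N \<and> 0 \<le> a \<and> a < int M \<and> even (b + a)}"

definition cell_edges :: "(int \<times> int) rel" where
  "cell_edges = {((b, a), (b + 1, a')) | b a a'. a' = (a + 1) mod int M \<or> a = (a' + 1) mod int M}"

lemma M_ge_2: "2 \<le> int M"
  using M by auto

lemma vertices_grid: "vertices (grid_R (M + 1) N) = strip"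
  by (auto simp: grid_R_def induced_subgraph_def square_grid_def strip_def)

lemma adjacent_grid:
  "adjacent (grid_R (M + 1) N) (x, y) (x', y')
    \<longleftrightarrow> (x, y) \<in> strip \<and> (x', y') \<in> strip \<and> \<bar>x - x'\<bar> + \<bar>y - y'\<bar> = 1"
proof -
  have "{(x, y), (x', y')} \<in> edges square_grid \<longleftrightarrow> \<bar>x - x'\<bar> + \<bar>y - y'\<bar> = 1"
    by (auto simp: square_grid_def dist_int_eq_1_iff doubleton_eq_iff)
  then show ?thesis
    by (auto simp: adjacent_def grid_R_def induced_subgraph_def strip_def)
qed

lemma cells_image: "row_col ` strip = cells"
proof (intro equalityI subsetI)
  fix p assume "p \<in> row_col ` strip"
  then obtain x y where "(x, y) \<in> strip" "p = row_col (x, y)" by auto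
  moreover have "even ((x + y) + (x - y) mod int M)"
    using M by (simp add: dvd_mod_iff)
  ultimately show "p \<in> cells"
    using M_ge_2 by (auto simp: cells_def row_col_def strip_def)
next
  fix p assume p: "p \<in> cells"
  obtain b a where ba: "p = (b, a)" by (cases p)
  have "even (b + a)" "even (b - a)" using p ba by (auto simp: cells_def)
  then have "(b + a) div 2 + (b - a) div 2 = b" "(b + a) div 2 - (b - a) div 2 = a"
    by presburger+
  then have "((b + a) div 2, (b - a) div 2) \<in> strip" "row_col ((b + a) div 2, (b - a) div 2) = p"
    using p ba by (auto simp: strip_def row_col_def cells_def)
  then show "p \<in> row_col ` strip" by (metis imageI)
qed

lemma mod_M_strip:
  assumes "(x, y) \<in> strip"
  shows "(x - y) mod int M = (if x - y = int M then 0 else x - y)"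
  using assms by (auto simp: strip_def)

definition seam :: "(int \<times> int) rel" where
  "seam = {((i, i), (int M div 2 + i, - (int M div 2) + i)) | i. 0 \<le> i \<and> i \<le> \<lfloor>(real N - 1) / 2\<rfloor>}"

lemma seam_iff: "(u, v) \<in> seam \<longleftrightarrow>
  (\<exists>i. u = (i, i) \<and> v = (int M div 2 + i, - (int M div 2) + i) \<and> 0 \<le> i \<and> 2 * i \<le> int N - 1)"
proof -
  have "i \<le> \<lfloor>(real N - 1) / 2\<rfloor> \<longleftrightarrow> 2 * i \<le> int N - 1" for i
  proof -
    have "i \<le> \<lfloor>(real N - 1) / 2\<rfloor> \<longleftrightarrow> real_of_int (2 * i) \<le> real_of_int (int N - 1)"
      by (simp add: le_floor_iff field_simps)
    then show ?thesis by (simp only: of_int_le_iff)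
  qed
  then show ?thesis by (auto simp: seam_def)
qed

text \<open>Two points of the strip with the same row and the same column modulo \<open>M\<close> are equal, or one lies on each
of the two sides; in the latter case they are one of the identified pairs. Evenness of \<open>M\<close> is what
lets the shift by \<open>M div 2\<close> in both coordinates change \<open>x - y\<close> by exactly \<open>M\<close>.\<close>
lemma generated_equiv_seam:
  "(u, v) \<in> generated_equiv strip seam \<longleftrightarrow> u \<in> strip \<and> v \<in> strip \<and> row_col u = row_col v"
proof
  assume *: "(u, v) \<in> generated_equiv strip seam"
  have half: "int M div 2 + int M div 2 = int M" using M by presburger
  have seam: "row_col p = row_col q" if pq: "(p, q) \<in> seam" for p q
  proof -
    obtain i where i: "p = (i, i)" "q = (int M div 2 + i, - (int M div 2) + i)"
      using pq unfolding seam_iff by blast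
    have "int M div 2 + i - (- (int M div 2) + i) = int M" using half by linarith
    then show ?thesis by (simp add: i row_col_def)
  qed
  have "(u, v) \<in> (seam \<union> seam\<inverse>)\<^sup>*" using * by (simp add: generated_equiv_def)
  then have "row_col u = row_col v"
  proof (induction rule: rtrancl_induct)
    case (step p q)
    then consider "(p, q) \<in> seam" | "(q, p) \<in> seam" by blast
    then show ?case using seam[of p q] seam[of q p] step.IH by cases simp_all
  qed simp
  then show "u \<in> strip \<and> v \<in> strip \<and> row_col u = row_col v"
    using * by (simp add: generated_equiv_def)
next
  assume uv: "u \<in> strip \<and> v \<in> strip \<and> row_col u = row_col v"
  obtain x y x' y' where xy: "u = (x, y)" "v = (x', y')" by (cases u, cases v)
  have seam_pair: "((p, q), (p', q')) \<in> seam"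
    if "(p, q) \<in> strip" "p - q = 0" "p' - q' = int M" "p + q = p' + q'" for p q p' q'
  proof -
    have "p' = int M div 2 + p" "q' = - (int M div 2) + p" "q = p"
      using that M by presburger+
    then show ?thesis using that by (auto simp: seam_iff strip_def)
  qed
  have sum: "x + y = x' + y'" and diff: "(x - y) mod int M = (x' - y') mod int M"
    using uv xy by (auto simp: row_col_def)
  have in_strip: "(x, y) \<in> strip" "(x', y') \<in> strip" using uv xy by auto
  consider "x - y = x' - y'" | "x - y = 0" "x' - y' = int M" | "x' - y' = 0" "x - y = int M"
    using diff mod_M_strip[OF in_strip(1)] mod_M_strip[OF in_strip(2)] by (auto split: if_splits)
  then have "(u, v) \<in> (seam \<union> seam\<inverse>)\<^sup>*"
  proof cases
    case 1
    then have "u = v" using sum xy by simp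
    then show ?thesis by simp
  next
    case 2
    then show ?thesis using seam_pair[OF in_strip(1)] sum xy by blast
  next
    case 3
    then show ?thesis using seam_pair[OF in_strip(2)] sum xy by (metis Un_iff converseI r_into_rtrancl)
  qed
  then show "(u, v) \<in> generated_equiv strip seam"
    using uv by (simp add: generated_equiv_def)
qed

lemma row_col_adjacent:
  assumes "\<bar>x - x'\<bar> + \<bar>y - y'\<bar> = 1"
  shows "(row_col (x, y), row_col (x', y')) \<in> cell_edges \<union> cell_edges\<inverse>"
proof -
  consider "x' = x + 1" "y' = y" | "x' = x - 1" "y' = y" | "x' = x" "y' = y + 1" | "x' = x" "y' = y - 1"
    using assms by linarith
  moreover have "(z + 1) mod int M = (z mod int M + 1) mod int M" for z
    by (simp add: mod_add_left_eq)
  from this[of "x - y"] this[of "x - y - 1"]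
  have "(x + 1 - y) mod int M = ((x - y) mod int M + 1) mod int M"
    "(x - y) mod int M = ((x - 1 - y) mod int M + 1) mod int M"
    "(x - y) mod int M = ((x - (y + 1)) mod int M + 1) mod int M"
    "(x - (y - 1)) mod int M = ((x - y) mod int M + 1) mod int M"
    by (simp_all add: algebra_simps)
  ultimately show ?thesis
    by cases (auto simp: row_col_def cell_edges_def algebra_simps)
qed

text \<open>The representatives have to be chosen to suit the edge: a step from column \<open>M - 1\<close> to column \<open>0\<close> is
realized in the strip by ending at the side \<open>x - y = M\<close>.\<close>
lemma lift_cell_edge:
  assumes "(p, q) \<in> cell_edges" "p \<in> cells" "q \<in> cells"
  obtains x y x' y' where "(x, y) \<in> strip" "(x', y') \<in> strip" "\<bar>x - x'\<bar> + \<bar>y - y'\<bar> = 1"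
    "row_col (x, y) = p" "row_col (x', y') = q"
proof -
  let ?pt = "\<lambda>b e :: int. ((b + e) div 2, (b - e) div 2)"
  have pt: "?pt b e \<in> strip" "row_col (?pt b e) = (b, e mod int M)"
    if "0 \<le> b" "b < int N" "0 \<le> e" "e \<le> int M" "even (b + e)" for b e
  proof -
    have "(b + e) div 2 + (b - e) div 2 = b" "(b + e) div 2 - (b - e) div 2 = e"
      using that(5) by presburger+
    then show "?pt b e \<in> strip" "row_col (?pt b e) = (b, e mod int M)"
      using that by (auto simp: strip_def row_col_def)
  qed
  obtain b a a' where ba: "p = (b, a)" "q = (b + 1, a')"
    and "a' = (a + 1) mod int M \<or> a = (a' + 1) mod int M"
    using assms(1) by (auto simp: cell_edges_def)
  have range: "0 \<le> b" "b + 1 < int N" "0 \<le> a" "a < int M" "even (b + a)"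
    "0 \<le> a'" "a' < int M" "even (b + 1 + a')"
    using assms ba by (auto simp: cells_def)
  show thesis
    using \<open>a' = (a + 1) mod int M \<or> a = (a' + 1) mod int M\<close>
  proof
    assume a': "a' = (a + 1) mod int M"
    have "even (b + 1 + (a + 1))" using range by simp
    then have "?pt (b + 1) (a + 1) \<in> strip" "row_col (?pt (b + 1) (a + 1)) = q"
      using pt[of "b + 1" "a + 1"] range ba a' by auto
    moreover have "?pt b a \<in> strip" "row_col (?pt b a) = p"
      using pt[of b a] range ba by auto
    moreover have "\<bar>(b + a) div 2 - (b + 1 + (a + 1)) div 2\<bar> + \<bar>(b - a) div 2 - (b + 1 - (a + 1)) div 2\<bar> = 1"
      by simp
    ultimately show thesis using that by blast
  next
    assume a: "a = (a' + 1) mod int M"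
    have "even (b + (a' + 1))" using range(8) by presburger
    then have "?pt b (a' + 1) \<in> strip" "row_col (?pt b (a' + 1)) = p"
      using pt[of b "a' + 1"] range ba a by auto
    moreover have "?pt (b + 1) a' \<in> strip" "row_col (?pt (b + 1) a') = q"
      using pt[of "b + 1" a'] range ba by auto
    moreover have "\<bar>(b + (a' + 1)) div 2 - (b + 1 + a') div 2\<bar> + \<bar>(b - (a' + 1)) div 2 - (b + 1 - a') div 2\<bar> = 1"
    proof -
      have "(b + 1 - a') div 2 = (b - (a' + 1)) div 2 + 1"
        using div_add_self2[of 2 "b - (a' + 1)"] by (simp add: algebra_simps)
      then show ?thesis by (simp add: algebra_simps)
    qed
    ultimately show thesis using that by blast
  qed
qed

abbreviation seam_class :: "int \<times> int \<Rightarrow> (int \<times> int) set" where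
  "seam_class u \<equiv> generated_equiv strip seam `` {u}"

lemma cyl_R_eq:
  "cyl_R M N = \<lparr>vertices = strip // generated_equiv strip seam,
     edges = {{seam_class u, seam_class v} | u v.
       u \<in> strip \<and> v \<in> strip \<and> adjacent (grid_R (M + 1) N) u v}\<rparr>"
  unfolding cyl_R_def identify_vertices_def Let_def vertices_grid seam_def[symmetric] ..

lemma adjacent_cyl_representatives:
  "adjacent (cyl_R M N) C D \<longleftrightarrow> (\<exists>u v. u \<in> strip \<and> v \<in> strip \<and>
    adjacent (grid_R (M + 1) N) u v \<and> {C, D} = {seam_class u, seam_class v})"
proof -
  have "edges (cyl_R M N) = {{seam_class u, seam_class v} | u v.
      u \<in> strip \<and> v \<in> strip \<and> adjacent (grid_R (M + 1) N) u v}"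
    by (simp only: cyl_R_eq graph.simps)
  then show ?thesis
    by (simp only: adjacent_def[of "cyl_R M N"] mem_Collect_eq conj_ac)
qed

text \<open>All representatives of a class have the same row and column, so the choice is immaterial.\<close>
definition cell_of :: "(int \<times> int) set \<Rightarrow> int \<times> int" where
  "cell_of C = row_col (SOME u. u \<in> C)"

lemma cell_of_class:
  assumes "u \<in> strip"
  shows "cell_of (seam_class u) = row_col u"
proof -
  have "u \<in> seam_class u" using assms by (simp add: generated_equiv_seam)
  then have "(SOME v. v \<in> seam_class u) \<in> seam_class u" by (rule someI)
  then have "row_col u = row_col (SOME v. v \<in> seam_class u)"
    unfolding Image_singleton_iff generated_equiv_seam by blast
  then show ?thesis by (simp only: cell_of_def)
qed

lemma seam_class_eq_iff:
  assumes "u \<in> strip" "v \<in> strip"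
  shows "seam_class u = seam_class v \<longleftrightarrow> row_col u = row_col v"
  using eq_equiv_class_iff[OF equiv_generated_equiv assms] generated_equiv_seam assms by simp

lemma adjacent_cyl:
  assumes u: "u \<in> strip" and v: "v \<in> strip"
  shows "adjacent (cyl_R M N) (seam_class u) (seam_class v)
    \<longleftrightarrow> (row_col u, row_col v) \<in> cell_edges \<union> cell_edges\<inverse>"
proof
  assume "adjacent (cyl_R M N) (seam_class u) (seam_class v)"
  then obtain p q where pq: "p \<in> strip" "q \<in> strip" "adjacent (grid_R (M + 1) N) p q"
    and "{seam_class u, seam_class v} = {seam_class p, seam_class q}"
    unfolding adjacent_cyl_representatives by blast
  then have "row_col u = row_col p \<and> row_col v = row_col q \<or> row_col u = row_col q \<and> row_col v = row_col p"
    using u v seam_class_eq_iff by (auto simp: doubleton_eq_iff)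
  moreover have "(row_col p, row_col q) \<in> cell_edges \<union> cell_edges\<inverse>"
  proof -
    obtain x y x' y' where xy: "p = (x, y)" "q = (x', y')" by (cases p, cases q)
    have "\<bar>x - x'\<bar> + \<bar>y - y'\<bar> = 1" using pq(3) unfolding xy adjacent_grid by blast
    then show ?thesis unfolding xy by (rule row_col_adjacent)
  qed
  ultimately show "(row_col u, row_col v) \<in> cell_edges \<union> cell_edges\<inverse>" by auto
next
  have edge: "adjacent (cyl_R M N) (seam_class u) (seam_class v)"
    if uv: "u \<in> strip" "v \<in> strip" and e: "(row_col u, row_col v) \<in> cell_edges" for u v
  proof -
    have "row_col u \<in> cells" "row_col v \<in> cells" using uv cells_image by auto
    from lift_cell_edge[OF e this] obtain x y x' y' where
      *: "(x, y) \<in> strip" "(x', y') \<in> strip" "\<bar>x - x'\<bar> + \<bar>y - y'\<bar> = 1"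
      "row_col (x, y) = row_col u" "row_col (x', y') = row_col v" by metis
    then have "seam_class u = seam_class (x, y)" "seam_class v = seam_class (x', y')"
      using uv seam_class_eq_iff by metis+
    moreover have "adjacent (grid_R (M + 1) N) (x, y) (x', y')"
      unfolding adjacent_grid using * by blast
    ultimately show ?thesis unfolding adjacent_cyl_representatives using * by metis
  qed
  assume "(row_col u, row_col v) \<in> cell_edges \<union> cell_edges\<inverse>"
  then consider "(row_col u, row_col v) \<in> cell_edges" | "(row_col v, row_col u) \<in> cell_edges" by auto
  then show "adjacent (cyl_R M N) (seam_class u) (seam_class v)"
  proof cases
    case 1
    then show ?thesis using edge u v by blast
  next
    case 2
    then show ?thesis using edge[OF v u] by (metis adjacent_def insert_commute)
  qed
qed

lemma finite_cells: "finite cells"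
  by (rule finite_subset[of _ "{0..int N} \<times> {0..int M}"]) (auto simp: cells_def)

lemma cyl_R_cells:
  "geometric_realization (independence_complex (cyl_R M N))
    homotopy_equivalent_space geometric_realization (ind cells cell_edges)"
  "alternating_number (cyl_R M N) = alternating_sum (ind cells cell_edges)"
proof -
  let ?V = "vertices (cyl_R M N)" and ?E = "{(C, D). adjacent (cyl_R M N) C D}"
  have V: "C \<in> ?V \<longleftrightarrow> (\<exists>u\<in>strip. C = seam_class u)" for C
    by (auto simp: cyl_R_eq quotient_def)
  have adj: "(C, D) \<in> ?E \<union> ?E\<inverse> \<longleftrightarrow> (cell_of C, cell_of D) \<in> cell_edges \<union> cell_edges\<inverse>"
    if "C \<in> ?V" "D \<in> ?V" for C D
    using that adjacent_cyl by (auto simp: V cell_of_class)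
  have inj: "inj_on cell_of ?V"
  proof (rule inj_onI)
    fix C D assume "C \<in> ?V" "D \<in> ?V" and eq: "cell_of C = cell_of D"
    then obtain u v where uv: "u \<in> strip" "C = seam_class u" "v \<in> strip" "D = seam_class v"
      unfolding V by blast
    then have "row_col u = row_col v" using eq cell_of_class by metis
    then show "C = D" unfolding uv(2,4) using seam_class_eq_iff uv by blast
  qed
  have image: "cell_of ` ?V = cells"
  proof -
    have "?V = seam_class ` strip" using V by blast
    then have "cell_of ` ?V = (\<lambda>u. cell_of (seam_class u)) ` strip"
      by (simp only: image_image)
    also have "\<dots> = row_col ` strip"
      using cell_of_class by (rule image_cong[OF refl])
    finally show ?thesis by (simp only: cells_image)
  qed
  then have "finite ?V" using finite_imageD[OF _ inj] finite_cells by simp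
  have "(p, p) \<notin> cell_edges" for p by (auto simp: cell_edges_def)
  then have irrefl: "\<not> adjacent (cyl_R M N) C C" if "C \<in> ?V" for C
    using adj[OF that that] by auto
  have "pairwise (\<lambda>C D. \<not> adjacent (cyl_R M N) C D) I \<longleftrightarrow> ?E \<inter> I \<times> I = {}" if "I \<subseteq> ?V" for I
  proof -
    have "pairwise (\<lambda>C D. \<not> adjacent (cyl_R M N) C D) I \<longleftrightarrow> (\<forall>C\<in>I. \<forall>D\<in>I. \<not> adjacent (cyl_R M N) C D)"
      unfolding pairwise_def using irrefl that by (metis subsetD)
    also have "\<dots> \<longleftrightarrow> ?E \<inter> I \<times> I = {}" by blast
    finally show ?thesis .
  qed
  then have complex: "independence_complex (cyl_R M N) = ind ?V ?E"
    unfolding independence_complex_def ind_def by (intro Collect_cong conj_cong refl)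
  have simplicial: "simplicial_complex (ind ?V ?E)"
    using \<open>finite ?V\<close> by (rule simplicial_complex_ind)
  have inj': "inj_on cell_of (\<Union>(ind ?V ?E))"
    using inj ind_Union by (rule inj_on_subset)
  have "(`) cell_of ` ind ?V ?E = ind cells cell_edges"
    using ind_image[OF inj adj] image by simp
  then show "geometric_realization (independence_complex (cyl_R M N))
      homotopy_equivalent_space geometric_realization (ind cells cell_edges)"
    "alternating_number (cyl_R M N) = alternating_sum (ind cells cell_edges)"
    using relabel_complex[OF simplicial inj']
    by (simp_all add: complex alternating_number_def alternating_sum_def)
qed

section \<open>Removing every third row\<close>
definition kept_cells :: "(int \<times> int) set" where
  "kept_cells = {(b, a) \<in> cells. b mod 3 \<noteq> 2}"

text \<open>A cell \<open>(b, a)\<close> in a row \<open>b\<close> congruent to \<open>2\<close> modulo \<open>3\<close> is dominated by the cell \<open>(b - 2, a)\<close> two rows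
below: their common neighbours lie in row \<open>b - 1\<close>, and the other neighbours of the lower cell lie in row
\<open>b - 3\<close>, which has been removed before.\<close>
lemma fold_equiv_kept_cells: "fold_equiv (ind cells cell_edges) (ind kept_cells cell_edges)"
proof -
  let ?S = "{(b, a) \<in> cells. b mod 3 = 2}"
  have "fold_equiv (ind cells cell_edges) (ind (cells - ?S) cell_edges)"
  proof (rule fold_equiv_delete_dominated[where rank = fst and w = "\<lambda>(b, a). (b - 2, a)"])
    show "finite ?S" using finite_cells by (rule finite_subset[rotated]) auto
    fix s assume "s \<in> ?S"
    then obtain b a where s: "s = (b, a)" "(b, a) \<in> cells" "b mod 3 = 2" by auto
    have "2 \<le> b" "(b - 2) mod 3 = 0" using s by (auto simp: cells_def) presburger+
    then show "(\<lambda>(b, a). (b - 2, a)) s \<in> cells - ?S"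
      using s by (auto simp: cells_def)
    show "((\<lambda>(b, a). (b - 2, a)) s, (\<lambda>(b, a). (b - 2, a)) s) \<notin> cell_edges"
      by (auto simp: cell_edges_def)
    fix x assume x: "x \<in> cells" "((\<lambda>(b, a). (b - 2, a)) s, x) \<in> cell_edges \<union> cell_edges\<inverse>"
    obtain b' a' where x_eq: "x = (b', a')" by (cases x)
    have "a' = (a + 1) mod int M \<or> a = (a' + 1) mod int M" "b' = b - 1 \<or> b' = b - 3"
      using x s x_eq by (auto simp: cell_edges_def)
    moreover have "(b - 3) mod 3 = 2" using s(3) by presburger
    ultimately show "(x, s) \<in> cell_edges \<union> cell_edges\<inverse> \<or> x \<in> ?S \<and> fst x < fst s"
      using x(1) s(1) x_eq by (auto simp: cell_edges_def)
  qed (rule finite_cells)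
  moreover have "cells - ?S = kept_cells" by (auto simp: kept_cells_def)
  ultimately show ?thesis by simp
qed

text \<open>The last row has number \<open>N - 1\<close>, divisible by three, and the only row that could be adjacent to it,
\<open>N - 2\<close>, has been removed.\<close>
lemma isolated_last_row:
  assumes "N mod 3 = 1"
  obtains p where "p \<in> kept_cells" "\<And>x. x \<in> kept_cells \<Longrightarrow> (p, x) \<notin> cell_edges \<union> cell_edges\<inverse>"
proof
  let ?p = "(int N - 1, (int N - 1) mod 2)"
  have N3: "int N mod 3 = 1" using assms by (metis of_nat_1 of_nat_mod of_nat_numeral)
  show "?p \<in> kept_cells"
  proof -
    have "even (int N - 1 + (int N - 1) mod 2)" by presburger
    moreover have "(int N - 1) mod 3 \<noteq> 2" using N3 by presburger
    moreover have "(int N - 1) mod 2 < int M"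
      using M_ge_2 pos_mod_bound[of 2 "int N - 1"] by linarith
    ultimately show ?thesis using N by (auto simp: kept_cells_def cells_def)
  qed
  have "(int N - 1 - 1) mod 3 = 2" using N3 by presburger
  then show "(?p, x) \<notin> cell_edges \<union> cell_edges\<inverse>" if "x \<in> kept_cells" for x
    using that by (auto simp: kept_cells_def cells_def cell_edges_def)
qed

text \<open>After the removal the rows come in adjacent pairs \<open>3 k\<close> and \<open>3 k + 1\<close>. Such a pair is a cycle of length
\<open>M\<close>, since each column meets exactly one of the two rows, namely the one of matching parity.\<close>
lemma cells_to_cycles:
  assumes N3: "N mod 3 \<noteq> 1"
  defines "n \<equiv> (N + 2) div 3" and "f \<equiv> (\<lambda>(b, a). (nat (b div 3), nat a))"
  shows "inj_on f kept_cells"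
    and "(`) f ` ind kept_cells cell_edges = join_over {..<n} (\<lambda>_. ind {..<M} (cycle_edges M))"
proof -
  have kept: "(b, a) \<in> kept_cells \<longleftrightarrow>
      0 \<le> b \<and> b < int N \<and> b mod 3 \<noteq> 2 \<and> 0 \<le> a \<and> a < int M \<and> even (b + a)" for b a
    by (auto simp: kept_cells_def cells_def)
  have same: "b = b'" if "b div 3 = b' div 3" "b mod 3 \<noteq> 2" "b' mod 3 \<noteq> 2" "even (b + b')" for b b' :: int
    using that by presburger
  show inj: "inj_on f kept_cells"
  proof (rule inj_onI, clarify)
    fix b a b' a' assume *: "(b, a) \<in> kept_cells" "(b', a') \<in> kept_cells" "f (b, a) = f (b', a')"
    then have "b div 3 = b' div 3" "a = a'"
      by (auto simp: f_def kept pos_imp_zdiv_nonneg_iff eq_nat_nat_iff)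
    moreover have "even (b + b')" using * \<open>a = a'\<close> by (auto simp: kept)
    ultimately show "b = b' \<and> a = a'" using same[of b b'] * by (auto simp: kept)
  qed
  have image: "f ` kept_cells = {..<n} \<times> {..<M}"
  proof (intro equalityI subsetI)
    fix p assume "p \<in> f ` kept_cells"
    then obtain b a where ba: "(b, a) \<in> kept_cells" "p = (nat (b div 3), nat a)" by (auto simp: f_def)
    then have "nat b < N" "nat (b div 3) = nat b div 3" by (auto simp: kept nat_div_distrib)
    then have "nat (b div 3) < n" unfolding n_def by linarith
    then show "p \<in> {..<n} \<times> {..<M}" using ba by (auto simp: kept)
  next
    fix p assume "p \<in> {..<n} \<times> {..<M}"
    then obtain k a where ka: "p = (k, a)" "k < n" "a < M" by auto
    let ?b = "3 * int k + (int k + int a) mod 2"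
    have "3 * k + 1 < N" using ka(2) N3 unfolding n_def by presburger
    moreover have "0 \<le> (int k + int a) mod 2" "(int k + int a) mod 2 < 2" by simp_all
    moreover have "even (?b + int a)" by presburger
    moreover from calculation(2,3) have "?b mod 3 \<noteq> 2" "?b div 3 = int k" by presburger+
    ultimately have "(?b, int a) \<in> kept_cells" "f (?b, int a) = p"
      using ka by (auto simp: kept f_def)
    then show "p \<in> f ` kept_cells" by (metis imageI)
  qed
  define E where "E = {((k, a), (k, b)) | (k :: nat) a b. (a, b) \<in> cycle_edges M}"
  have E: "((k, a), (k', a')) \<in> E \<union> E\<inverse> \<longleftrightarrow> k = k' \<and>
      (a = M - 1 \<and> a' = 0 \<or> a' = Suc a \<and> a \<noteq> M - 1 \<or> a' = M - 1 \<and> a = 0 \<or> a = Suc a' \<and> a' \<noteq> M - 1)" for k a k' a'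
    by (auto simp: E_def cycle_edges_def)
  have "(`) f ` ind kept_cells cell_edges = ind ({..<n} \<times> {..<M}) E"
    unfolding image[symmetric]
  proof (rule ind_image[OF inj])
    fix u v assume uv: "u \<in> kept_cells" "v \<in> kept_cells"
    obtain b a b' a' where ba: "u = (b, a)" "v = (b', a')" by (cases u, cases v)
    have r: "0 \<le> b" "b mod 3 \<noteq> 2" "0 \<le> a" "a < int M" "even (b + a)"
      "0 \<le> b'" "b' mod 3 \<noteq> 2" "0 \<le> a'" "a' < int M" "even (b' + a')"
      using uv ba by (auto simp: kept)
    have succ: "z = (y + 1) mod int M \<longleftrightarrow> (y = int M - 1 \<and> z = 0 \<or> z = y + 1 \<and> y \<noteq> int M - 1)"
      if "0 \<le> y" "y < int M" "0 \<le> z" "z < int M" for y z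
    proof (cases "y = int M - 1")
      case False
      then have "(y + 1) mod int M = y + 1" using that by simp
      then show ?thesis using False by auto
    qed auto
    let ?next = "a' = (a + 1) mod int M \<or> a = (a' + 1) mod int M"
    have "(u, v) \<in> cell_edges \<union> cell_edges\<inverse> \<longleftrightarrow> (b' = b + 1 \<or> b = b' + 1) \<and> ?next"
      by (auto simp: ba cell_edges_def)
    also have "\<dots> \<longleftrightarrow> b div 3 = b' div 3 \<and> ?next"
    proof -
      have "even (int M)" using M(1) by simp
      have "odd (a + a')" if nxt: "?next"
      proof -
        have "a = int M - 1 \<and> a' = 0 \<or> a' = a + 1 \<or> a' = int M - 1 \<and> a = 0 \<or> a = a' + 1"
          using nxt succ[OF r(3,4) r(8,9)] succ[OF r(8,9) r(3,4)] by argo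
        then show ?thesis using \<open>even (int M)\<close> by (elim disjE conjE) simp_all
      qed
      then have "odd (b + b')" if "?next" using that r(5,10) by (simp add: even_add)
      moreover have "b' = b + 1 \<or> b = b' + 1 \<longleftrightarrow> b div 3 = b' div 3" if odd: "odd (b + b')"
      proof -
        have b: "b = 3 * (b div 3) + b mod 3" "b' = 3 * (b' div 3) + b' mod 3" by simp_all
        have "0 \<le> b mod 3" "b mod 3 \<le> 1" "0 \<le> b' mod 3" "b' mod 3 \<le> 1"
          using r(2,7) pos_mod_bound[of 3 b] pos_mod_bound[of 3 b'] by simp_all
        note bounds = b this
        have "b \<noteq> b'" using odd by auto
        moreover have "b' = b + 1 \<or> b = b' + 1 \<or> b = b'" if "b div 3 = b' div 3"
          using bounds that by linarith
        moreover have "\<not> b div 3 < b' div 3" "\<not> b' div 3 < b div 3" if "b' = b + 1 \<or> b = b' + 1"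
          using bounds that by linarith+
        ultimately show ?thesis by (metis linorder_neqE)
      qed
      ultimately show ?thesis by blast
    qed
    also have "\<dots> \<longleftrightarrow> (f u, f v) \<in> E \<union> E\<inverse>"
    proof -
      obtain k k' where k: "b div 3 = int k" "b' div 3 = int k'"
        using r by (metis nonneg_int_cases pos_imp_zdiv_nonneg_iff zero_less_numeral)
      obtain j j' where j: "a = int j" "a' = int j'" using r by (metis nonneg_int_cases)
      have "?next \<longleftrightarrow> j = M - 1 \<and> j' = 0 \<or> j' = Suc j \<and> j \<noteq> M - 1 \<or> j' = M - 1 \<and> j = 0 \<or> j = Suc j' \<and> j' \<noteq> M - 1"
      proof -
        have conv: "int i = int M - 1 \<longleftrightarrow> i = M - 1" "int i = 0 \<longleftrightarrow> i = 0"
          "int i = int i' + 1 \<longleftrightarrow> i = Suc i'" for i i'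
          using M(2) by linarith+
        show ?thesis
          unfolding succ[OF r(3,4) r(8,9)] succ[OF r(8,9) r(3,4)] unfolding j conv by argo
      qed
      then show ?thesis unfolding ba f_def prod.case k j nat_int E by auto
    qed
    finally show "(u, v) \<in> cell_edges \<union> cell_edges\<inverse> \<longleftrightarrow> (f u, f v) \<in> E \<union> E\<inverse>" .
  qed
  then show "(`) f ` ind kept_cells cell_edges = join_over {..<n} (\<lambda>_. ind {..<M} (cycle_edges M))"
    by (simp add: join_over_ind E_def)
qed

end

section \<open>The homotopy type of the cylinder\<close>
lemma prod_first_factor:
  fixes x y :: "'a::comm_semiring_1"
  assumes "1 \<le> m"
  shows "(\<Prod>i<m. if i = 0 then x else y) = x * y ^ (m - 1)"
proof -
  have "(\<Prod>i<m. if i = 0 then x else y) = x * (\<Prod>i\<in>{..<m} - {0}. if i = 0 then x else y)"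
    using assms by (subst prod.remove[of _ 0]) auto
  also have "(\<Prod>i\<in>{..<m} - {0}. if i = 0 then x else y) = (\<Prod>i\<in>{..<m} - {0}. y)"
    by (intro prod.cong) auto
  finally show ?thesis using assms by simp
qed

lemma prod_grid_first_factor:
  fixes x y :: "'a::comm_semiring_1"
  assumes "1 \<le> m"
  shows "(\<Prod>p\<in>{..<n} \<times> {..<m}. if snd p = 0 then x else y) = (x * y ^ (m - 1)) ^ n"
proof -
  have "(\<Prod>p\<in>{..<n} \<times> {..<m}. if snd p = 0 then x else y) = (\<Prod>k<n. \<Prod>i<m. if i = 0 then x else y)"
    unfolding prod.cartesian_product by (simp add: case_prod_unfold)
  then show ?thesis by (simp only: prod_first_factor[OF assms] prod_constant card_lessThan)
qed

text \<open>The join of \<open>n\<close> copies of a reduced cycle has \<open>m * n\<close> blocks, of which \<open>n\<close> have size \<open>s\<close> and all others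
are pairs.\<close>
lemma transversal_family:
  fixes W :: "nat set" and \<beta> :: "nat \<Rightarrow> nat"
  assumes W: "block_sizes W \<beta> m s" and m: "1 \<le> m" and n: "1 \<le> n" and s: "2 \<le> s"
  defines "T \<equiv> transversal_complex ({..<n} \<times> W) (\<lambda>(k, a). (k, \<beta> a))"
  shows "geometric_realization T homotopy_equivalent_space wedge_of_spheres ((s - 1) ^ n) (m * n - 1)"
    and "alternating_sum T = ((1 - int s) * (- 1) ^ (m - 1)) ^ n"
proof -
  let ?V = "{..<n} \<times> W" and ?\<gamma> = "\<lambda>(k, a). (k, \<beta> a)"
  have fin: "finite ?V" using W by (simp add: block_sizes_def)
  have image: "?\<gamma> ` ?V = {..<n} \<times> {..<m}"
  proof -
    have "?\<gamma> ` ?V = {..<n} \<times> \<beta> ` W" by force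
    then show ?thesis using W by (simp add: block_sizes_def)
  qed
  have "?V \<noteq> {}"
  proof -
    have "?\<gamma> ` ?V \<noteq> {}" unfolding image using m n by (auto simp: lessThan_empty_iff)
    then show ?thesis by blast
  qed
  have card: "card {v \<in> ?V. ?\<gamma> v = p} = (if snd p = 0 then s else 2)" if p_in: "p \<in> ?\<gamma> ` ?V" for p
  proof -
    have "p \<in> {..<n} \<times> {..<m}" using p_in by (simp only: image)
    then obtain k i where p: "p = (k, i)" "k < n" "i < m" by auto
    have "{v \<in> ?V. ?\<gamma> v = p} = {k} \<times> {a \<in> W. \<beta> a = i}" using p by auto
    then show ?thesis using W p by (simp add: block_sizes_def card_cartesian_product_singleton)
  qed
  have "geometric_realization T homotopy_equivalent_space
      wedge_of_spheres (\<Prod>p\<in>?\<gamma> ` ?V. card {v \<in> ?V. ?\<gamma> v = p} - 1) (card (?\<gamma> ` ?V) - 1)"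
    unfolding T_def using card s by (intro transversal_wedge fin \<open>?V \<noteq> {}\<close>) auto
  moreover have "(\<Prod>p\<in>?\<gamma> ` ?V. card {v \<in> ?V. ?\<gamma> v = p} - 1)
      = (\<Prod>p\<in>?\<gamma> ` ?V. if snd p = 0 then s - 1 else 1)"
    using card by (intro prod.cong) auto
  moreover have "card (?\<gamma> ` ?V) = m * n"
    unfolding image by (simp add: card_cartesian_product)
  ultimately show "geometric_realization T homotopy_equivalent_space wedge_of_spheres ((s - 1) ^ n) (m * n - 1)"
    using prod_grid_first_factor[OF m, where n = n and x = "s - 1" and y = 1] by (simp only: image) simp
  have "alternating_sum T = (\<Prod>p\<in>?\<gamma> ` ?V. if snd p = 0 then 1 - int s else - 1)"
    unfolding T_def alternating_sum_transversal[OF fin] using card by (intro prod.cong) auto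
  then show "alternating_sum T = ((1 - int s) * (- 1) ^ (m - 1)) ^ n"
    by (simp only: image prod_grid_first_factor[OF m])
qed

context cylinder
begin

lemma contractible_case:
  assumes "N mod 3 = 1"
  shows "contractible_space (geometric_realization (independence_complex (cyl_R M N)))"
    and "alternating_number (cyl_R M N) = 0"
proof -
  have finite: "finite kept_cells"
    by (rule finite_subset[OF _ finite_cells]) (auto simp: kept_cells_def)
  obtain p where p: "p \<in> kept_cells" "\<And>x. x \<in> kept_cells \<Longrightarrow> (p, x) \<notin> cell_edges \<union> cell_edges\<inverse>"
    using isolated_last_row[OF assms] by blast
  have cone: "insert p I \<in> ind kept_cells cell_edges" if "I \<in> ind kept_cells cell_edges" for I
    using that p by (auto simp: ind_def)
  have "{} \<in> ind kept_cells cell_edges" by (simp add: ind_def)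
  then have "ind kept_cells cell_edges \<noteq> {}" by blast
  note cone' = contractible_cone[OF simplicial_complex_ind[OF finite] this cone]
  show "contractible_space (geometric_realization (independence_complex (cyl_R M N)))"
    using cyl_R_cells(1) fold_equiv_imp(1)[OF fold_equiv_kept_cells] cone'(1)
      homotopy_equivalent_space_contractibility homotopy_eqv_trans by metis
  show "alternating_number (cyl_R M N) = 0"
    using cyl_R_cells(2) fold_equiv_imp(2)[OF fold_equiv_kept_cells] cone'(2) by simp
qed

lemma wedge_case:
  assumes N3: "N mod 3 \<noteq> 1"
  defines "m \<equiv> (M + 1) div 3" and "n \<equiv> (N + 2) div 3" and "s \<equiv> if M mod 3 = 0 then 3 else 2"
  shows "geometric_realization (independence_complex (cyl_R M N))
      homotopy_equivalent_space wedge_of_spheres ((s - 1) ^ n) (m * n - 1)"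
    and "alternating_number (cyl_R M N) = ((1 - int s) * (- 1) ^ (m - 1)) ^ n"
proof -
  have M2: "2 \<le> M" using M_ge_2 by simp
  obtain W \<beta> where W: "fold_equiv (ind {..<M} (cycle_edges M)) (transversal_complex W \<beta>)"
    "block_sizes W \<beta> m s"
    using fold_equiv_cycle[OF M2] unfolding m_def s_def by blast
  let ?C = "join_over {..<n} (\<lambda>_. ind {..<M} (cycle_edges M))"
  let ?T = "transversal_complex ({..<n} \<times> W) (\<lambda>(k, a). (k, \<beta> a))"
  have "fold_equiv ?C ?T"
    using fold_equiv_join[OF W(1) simplicial_complex_ind, of "{..<n}"] by (simp add: join_over_transversal)
  note CT = fold_equiv_imp[OF this]
  have "finite kept_cells"
    by (rule finite_subset[OF _ finite_cells]) (auto simp: kept_cells_def)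
  note kept = relabel_complex[OF simplicial_complex_ind[OF this, of cell_edges]
      inj_on_subset[OF cells_to_cycles(1)[OF N3] ind_Union], unfolded cells_to_cycles(2)[OF N3], folded n_def]
  note QK = fold_equiv_imp[OF fold_equiv_kept_cells]
  have "1 \<le> m" "1 \<le> n" "2 \<le> s" using M2 N by (auto simp: m_def n_def s_def)
  note T = transversal_family[OF W(2) this]
  show "geometric_realization (independence_complex (cyl_R M N))
      homotopy_equivalent_space wedge_of_spheres ((s - 1) ^ n) (m * n - 1)"
    by (rule homotopy_eqv_trans[OF cyl_R_cells(1) homotopy_eqv_trans[OF QK(1)
          homotopy_eqv_trans[OF kept(1) homotopy_eqv_trans[OF CT(1) T(1)]]]])
  show "alternating_number (cyl_R M N) = ((1 - int s) * (- 1) ^ (m - 1)) ^ n"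
    using cyl_R_cells(2) QK(2) kept(2) CT(2) T(2) by simp
qed

end

theorem theorem7:
  fixes M N m n :: nat and G :: "(int \<times> int) set graph"
  assumes "M \<ge> 1" and "N \<ge> 1" and "even M"
    and "m = nat \<lfloor>(real M + 1) / 3\<rfloor>"
    and "n = nat \<lceil>real N / 3\<rceil>"
    and "G = cyl_R M N"
  shows
    "(N mod 3 = 1 \<longrightarrow>
        contractible_space (geometric_realization (independence_complex G)) \<and>
        alternating_number G = 0) \<and>
     (N mod 3 \<noteq> 1 \<longrightarrow>
        (M mod 3 = 0 \<longrightarrow>
           geometric_realization (independence_complex G)
             homotopy_equivalent_space wedge_of_spheres (2 ^ n) (m * n - 1) \<and>
           alternating_number G = 2 ^ n) \<and>
        (M mod 3 = 1 \<or> M mod 3 = 2 \<longrightarrow>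
           geometric_realization (independence_complex G)
             homotopy_equivalent_space nsphere (m * n - 1) \<and>
           alternating_number G = (-1) ^ n))"
proof -
  interpret cylinder M N using assms by unfold_locales auto
  have m: "m = (M + 1) div 3"
  proof -
    have "\<lfloor>(real M + 1) / 3\<rfloor> = int ((M + 1) div 3)"
      using floor_divide_of_nat_eq[of "M + 1" 3, where ?'a = real] by (simp add: add.commute)
    then show ?thesis using assms(4) by simp
  qed
  have n: "n = (N + 2) div 3"
  proof -
    have "\<lceil>real N / 3\<rceil> = int ((N + 2) div 3)"
    proof (rule ceiling_unique)
      have "3 * ((N + 2) div 3) \<le> N + 2" "N \<le> 3 * ((N + 2) div 3)" by presburger+
      then have "3 * real ((N + 2) div 3) \<le> real N + 2" "real N \<le> 3 * real ((N + 2) div 3)"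
        by (metis of_nat_le_iff of_nat_add of_nat_mult of_nat_numeral)+
      then show "real_of_int (int ((N + 2) div 3)) - 1 < real N / 3"
        "real N / 3 \<le> real_of_int (int ((N + 2) div 3))"
        by simp_all
    qed
    then show ?thesis using assms(5) by simp
  qed
  have "1 \<le> m" using M_ge_2 by (simp add: m)
  show ?thesis
  proof (intro conjI impI)
    assume "N mod 3 = 1"
    then show "contractible_space (geometric_realization (independence_complex G))"
      "alternating_number G = 0"
      using contractible_case assms(6) by simp_all
  next
    assume N3: "N mod 3 \<noteq> 1" and M3: "M mod 3 = 0"
    show "geometric_realization (independence_complex G)
        homotopy_equivalent_space wedge_of_spheres (2 ^ n) (m * n - 1)"
      using wedge_case(1)[OF N3] M3 assms(6) by (simp add: m n)
    \<comment> \<open>the sign is controlled by the parity of \<open>m\<close>: for even \<open>M\<close> it is even if three divides \<open>M\<close> and odd otherwise\<close>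
    have "even m" using M3 assms(3) unfolding m by presburger
    then have "odd (m - 1)" using \<open>1 \<le> m\<close> by simp
    then show "alternating_number G = 2 ^ n"
      using wedge_case(2)[OF N3] M3 assms(6) by (simp add: m n)
  next
    assume N3: "N mod 3 \<noteq> 1" and M3: "M mod 3 = 1 \<or> M mod 3 = 2"
    then have "M mod 3 \<noteq> 0" by auto
    then have "geometric_realization (independence_complex G)
        homotopy_equivalent_space wedge_of_spheres 1 (m * n - 1)"
      using wedge_case(1)[OF N3] assms(6) by (simp add: m n)
    then show "geometric_realization (independence_complex G)
        homotopy_equivalent_space nsphere (m * n - 1)"
      using wedge_of_one_sphere homotopy_eqv_trans homeomorphic_imp_homotopy_equivalent_space by blast
    have "odd m" using M3 assms(3) unfolding m by presburger
    then have "even (m - 1)" by simp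
    then show "alternating_number G = (-1) ^ n"
      using wedge_case(2)[OF N3] \<open>M mod 3 \<noteq> 0\<close> assms(6) by (simp add: m n)
  qed
qed

end
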